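(* Let $n\ge1$ and $m\ge0$ be integers. There are constants $c_{n,m}^{+}>0$ and $c_{n,m}^->0$, depending only on $n$ and $m$, such that $$\mathcal{A}_n\cap\Big((2m+1-c_{n,m}^-,\,2m+1)\cup(2m+1,\,2m+1+c_{n,m}^+)\Big)=\emptyset.$$
   Context: Points of $\mathbb{R}^{n+1}$ are written $x=(x',x_{n+1})$; $B_1$ is the unit ball of $\mathbb{R}^{n+1}$ and $B_1'=B_1\cap\{x_{n+1}=0\}$. A function $u$ is a solution to the thin obstacle problem with zero obstacle if $\Delta u=0$ in $B_1\setminus\{(x',0):u(x',0)=0\}$, $\Delta u\le0$ in $B_1$, $u(x',0)\ge0$ on $B_1'$, and $u(x',x_{n+1})=u(x',-x_{n+1})$ in $B_1$. The set of admissible frequencies $\mathcal{A}_n$ is the set of all $\mu>0$ for which there exists a non-trivial (not identically zero) $\mu$-homogeneous solution to this zero-obstacle problem in $\mathbb{R}^{n+1}$. *)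

theory Defs
  imports "HOL-Analysis.Analysis"
begin

text \<open>
  A point \<open>x = (x', x\<^sub>n\<^sub>+\<^sub>1)\<close> of Euclidean \<open>(n+1)\<close>-space is a pair in \<open>(real ^ 'n) \<times> real\<close> with
  \<open>n = CARD('n)\<close>; the norm on the product type is the Euclidean one, and \<open>lborel\<close> is Lebesgue
  measure.
\<close>

definition partial :: "'a::euclidean_space \<Rightarrow> ('a \<Rightarrow> real) \<Rightarrow> 'a \<Rightarrow> real" where
  "partial b f x = frechet_derivative f (at x) b"

fun C_k :: "nat \<Rightarrow> ('a::euclidean_space \<Rightarrow> real) \<Rightarrow> bool" where
  "C_k 0 f \<longleftrightarrow> continuous_on UNIV f"
| "C_k (Suc k) f \<longleftrightarrow> (\<forall>x. f differentiable (at x)) \<and> (\<forall>b\<in>Basis. C_k k (partial b f))"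

definition laplacian :: "('a::euclidean_space \<Rightarrow> real) \<Rightarrow> 'a \<Rightarrow> real" where
  "laplacian f x = (\<Sum>b\<in>Basis. partial b (partial b f) x)"

definition test_function :: "'a::euclidean_space set \<Rightarrow> ('a \<Rightarrow> real) \<Rightarrow> bool" where
  "test_function \<Omega> \<phi> \<longleftrightarrow>
     (\<forall>k. C_k k \<phi>) \<and> compact (closure {x. \<phi> x \<noteq> 0}) \<and> closure {x. \<phi> x \<noteq> 0} \<subseteq> \<Omega>"

text \<open>
  The (in)equations \<open>\<Delta> u = 0\<close> and \<open>\<Delta> u \<le> 0\<close> on an open set are meant in the sense of
  distributions. A solution of the thin obstacle problem is in general not differentiable across
  the thin space, where \<open>\<Delta> u\<close> is a nonpositive measure carried by the contact set.
\<close>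

definition distr_laplacian_eq_0_on :: "'a::euclidean_space set \<Rightarrow> ('a \<Rightarrow> real) \<Rightarrow> bool" where
  "distr_laplacian_eq_0_on \<Omega> u \<longleftrightarrow>
     (\<forall>\<phi>. test_function \<Omega> \<phi> \<longrightarrow> (LINT x:\<Omega>|lborel. u x * laplacian \<phi> x) = 0)"

definition distr_laplacian_le_0_on :: "'a::euclidean_space set \<Rightarrow> ('a \<Rightarrow> real) \<Rightarrow> bool" where
  "distr_laplacian_le_0_on \<Omega> u \<longleftrightarrow>
     (\<forall>\<phi>. test_function \<Omega> \<phi> \<and> (\<forall>x. \<phi> x \<ge> 0) \<longrightarrow>
        (LINT x:\<Omega>|lborel. u x * laplacian \<phi> x) \<le> 0)"

text \<open>
  The domain \<open>\<Omega>\<close> is meant to be open and symmetric in the last variable: the unit ball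
  \<open>ball 0 1\<close> for the local problem, \<open>UNIV\<close> for global solutions. Continuity is the standing
  regularity convention; it gives meaning to the values of \<open>u\<close> on the thin space and makes the
  complement of the contact set open in \<open>\<Omega>\<close>.
\<close>

definition thin_obstacle_solution ::
    "((real ^ 'n::finite) \<times> real) set \<Rightarrow> ((real ^ 'n) \<times> real \<Rightarrow> real) \<Rightarrow> bool" where
  "thin_obstacle_solution \<Omega> u \<longleftrightarrow>
     continuous_on \<Omega> u \<and>
     distr_laplacian_eq_0_on (\<Omega> - {(x', 0) | x'. u (x', 0) = 0}) u \<and>
     distr_laplacian_le_0_on \<Omega> u \<and>
     (\<forall>x'. (x', 0) \<in> \<Omega> \<longrightarrow> u (x', 0) \<ge> 0) \<and>
     (\<forall>x' y. (x', y) \<in> \<Omega> \<longrightarrow> u (x', y) = u (x', - y))"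

definition homogeneous :: "real \<Rightarrow> ('a::real_vector \<Rightarrow> real) \<Rightarrow> bool" where
  "homogeneous \<mu> u \<longleftrightarrow> (\<forall>t>0. \<forall>x. u (t *\<^sub>R x) = t powr \<mu> * u x)"

text \<open>The set \<open>\<A>\<^sub>n\<close> for \<open>n = CARD('n)\<close>; the argument only carries the dimension.\<close>

definition admissible_frequencies :: "'n::finite itself \<Rightarrow> real set" where
  "admissible_frequencies _ =
     {\<mu>. \<mu> > 0 \<and> (\<exists>u :: (real ^ 'n) \<times> real \<Rightarrow> real.
        thin_obstacle_solution UNIV u \<and> homogeneous \<mu> u \<and> (\<exists>x. u x \<noteq> 0))}"

end

theory Submission
  imports Defs "HOL-Complex_Analysis.Great_Picard"
begin

text \<open>
  Suppose that normalized solutions \<open>u\<^sub>k\<close> have frequencies \<open>\<mu>\<^sub>k \<noteq> d\<close> with \<open>\<mu>\<^sub>k \<rightarrow> d = 2m + 1\<close>. Write \<open>y\<close> for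
  the last variable. If \<open>P\<close> is harmonic, \<open>d\<close>-homogeneous and zero on \<open>{y = 0}\<close>, Green's identity in
  \<open>{y > 0}\<close> equates a weighted integral of \<open>u\<^sub>k \<partial>\<^sub>yP\<close> over the thin space with \<open>d - \<mu>\<^sub>k\<close> times a weighted
  integral of \<open>u\<^sub>k P\<close>. For \<open>P\<^sub>0 = \<Sum>\<^sub>i Im (x\<^sub>i + \<i>y)\<^sup>d\<close>, whose normal derivative is positive on the thin space
  off the origin, this shows that the traces of \<open>u\<^sub>k\<close> tend to zero in \<open>L\<^sup>1\<close> at the rate \<open>|\<mu>\<^sub>k - d|\<close>. Hence a
  subsequence converges off the thin space to \<open>Q(x', |y|)\<close> with \<open>Q\<close> harmonic, odd in \<open>y\<close> and
  \<open>d\<close>-homogeneous; a barrier gives \<open>Q \<noteq> 0\<close>, and superharmonicity gives \<open>\<partial>\<^sub>yQ \<le> 0\<close> on the thin space.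

  Now take \<open>P = Q\<close>. If \<open>\<mu>\<^sub>k < d\<close>, the two sides of the identity have opposite signs. If \<open>\<mu>\<^sub>k > d\<close>, the
  barrier shows that for large \<open>k\<close> the trace of \<open>u\<^sub>k\<close> vanishes wherever \<open>- \<partial>\<^sub>yQ > \<delta> \<partial>\<^sub>yP\<^sub>0\<close>, so comparison of
  the identities for \<open>Q\<close> and \<open>P\<^sub>0\<close> bounds the integral of \<open>Q\<^sup>2\<close> by \<open>O(\<delta>)\<close> for every \<open>\<delta> > 0\<close>.
\<close>

text \<open>The obstacle is regularity: a solution is only known to be continuous, so no gradient of
  \<open>u\<close> and no integral over a sphere may appear. Radial smooth weights take the place of
  balls and spheres, and homogeneity of \<open>u\<close> takes the place of its radial derivative.
  For \<open>\<mu> k > d\<close> both sides of the identity for \<open>Q\<close> are nonpositive and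
  both tend to zero, so signs decide nothing. The comparison works because the identities for
  \<open>Q\<close> and \<open>P\<^sub>0\<close> carry the same small factor
  \<open>d - \<mu> k\<close>; it cancels and leaves integrals over the half-space that stay of order
  one. The barrier is quadratic, while \<open>Q\<close> descends linearly where its normal
  derivative is negative. In a thin enough cylinder the linear descent wins, and this pins the trace
  to zero. That \<open>d\<close> is odd enters only through \<open>P\<^sub>0\<close>: its normal
  derivative on the thin space is a sum of even powers. The upper bound 2m + 2 for the frequencies
  serves only to make growth bounds independent of \<open>k\<close>.\<close>

lemma partial_eqI: "(f has_derivative D) (at x) \<Longrightarrow> partial b f x = D b"
  unfolding partial_def using frechet_derivative_at by metis

lemma frechet_derivative_worksI:
  "f differentiable (at x) \<Longrightarrow> (f has_derivative frechet_derivative f (at x)) (at x)"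
  by (simp add: frechet_derivative_works)

lemma has_derivative_partial:
  "f differentiable (at x) \<Longrightarrow> (f has_derivative (\<lambda>h. \<Sum>b\<in>Basis. (h \<bullet> b) * partial b f x)) (at x)"
proof -
  assume "f differentiable (at x)"
  then have d: "(f has_derivative frechet_derivative f (at x)) (at x)"
    using frechet_derivative_works by blast
  have l: "linear (frechet_derivative f (at x))" using d has_derivative_linear by blast
  have "frechet_derivative f (at x) = (\<lambda>h. \<Sum>b\<in>Basis. (h \<bullet> b) * partial b f x)"
  proof
    fix h
    have "frechet_derivative f (at x) (\<Sum>b\<in>Basis. (h \<bullet> b) *\<^sub>R b)
        = (\<Sum>b\<in>Basis. (h \<bullet> b) * frechet_derivative f (at x) b)"
      using l by (simp add: linear_sum linear_scale)
    then show "frechet_derivative f (at x) h = (\<Sum>b\<in>Basis. (h \<bullet> b) * partial b f x)"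
      by (simp add: euclidean_representation partial_def)
  qed
  with d show ?thesis by simp
qed

lemma C_k_Suc_imp: "C_k (Suc k) f \<Longrightarrow> C_k k f"
proof (induction k arbitrary: f)
  case 0
  then have "\<forall>x. f differentiable (at x)" by simp
  then show ?case
    by (auto intro!: differentiable_imp_continuous_on simp: differentiable_on_def
        intro: differentiable_at_withinI)
next
  case (Suc k)
  then show ?case by auto
qed

lemma C_k_continuous: "C_k k f \<Longrightarrow> continuous_on UNIV f"
  by (induction k) (auto dest: C_k_Suc_imp simp del: C_k.simps(2))

lemma C_k_const: "C_k k (\<lambda>x. c)"
proof (induction k arbitrary: c)
  case (Suc k)
  have "partial b (\<lambda>x. c) = (\<lambda>x. 0)" for b :: 'a
    by (rule ext, rule partial_eqI[of _ "\<lambda>_. 0", simplified]) simp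
  with Suc show ?case by simp
qed simp

lemma partial_add:
  assumes "f differentiable (at x)" "g differentiable (at x)"
  shows "partial b (\<lambda>x. f x + g x) x = partial b f x + partial b g x"
proof -
  have "((\<lambda>x. f x + g x) has_derivative
     (\<lambda>h. frechet_derivative f (at x) h + frechet_derivative g (at x) h)) (at x)"
    by (intro has_derivative_add frechet_derivative_worksI assms)
  from partial_eqI[OF this] show ?thesis by (simp add: partial_def)
qed

lemma partial_mult:
  fixes f g :: "'a::euclidean_space \<Rightarrow> real"
  assumes "f differentiable (at x)" "g differentiable (at x)"
  shows "partial b (\<lambda>x. f x * g x) x = f x * partial b g x + partial b f x * g x"
proof -
  have "((\<lambda>x. f x * g x) has_derivative
     (\<lambda>h. f x * frechet_derivative g (at x) h + frechet_derivative f (at x) h * g x)) (at x)"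
    by (intro has_derivative_mult frechet_derivative_worksI assms)
  from partial_eqI[OF this] show ?thesis by (simp add: partial_def)
qed

lemma C_k_add: "C_k k f \<Longrightarrow> C_k k g \<Longrightarrow> C_k k (\<lambda>x. f x + g x)"
proof (induction k arbitrary: f g)
  case 0 then show ?case by (simp add: continuous_on_add)
next
  case (Suc k)
  then have "partial b (\<lambda>x. f x + g x) = (\<lambda>x. partial b f x + partial b g x)" for b
    by (intro ext partial_add) auto
  with Suc show ?case by auto
qed

lemma C_k_mult: "C_k k f \<Longrightarrow> C_k k g \<Longrightarrow> C_k k (\<lambda>x. f x * g x)"
proof (induction k arbitrary: f g)
  case 0 then show ?case by (simp add: continuous_on_mult)
next
  case (Suc k)
  have "partial b (\<lambda>x. f x * g x) = (\<lambda>x. f x * partial b g x + partial b f x * g x)" for b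
    using Suc.prems by (intro ext partial_mult) auto
  moreover have "C_k k (\<lambda>x. f x * partial b g x + partial b f x * g x)" if "b \<in> Basis" for b
    using Suc.prems that C_k_Suc_imp[OF Suc.prems(1)] C_k_Suc_imp[OF Suc.prems(2)]
    by (intro C_k_add Suc.IH) auto
  ultimately show ?case using Suc.prems by auto
qed

section \<open>Smooth functions: closure properties and rules for the Laplacian\<close>

definition smooth :: "('a::euclidean_space \<Rightarrow> real) \<Rightarrow> bool" where
  "smooth f \<longleftrightarrow> (\<forall>k. C_k k f)"

lemma smooth_continuous: "smooth f \<Longrightarrow> continuous_on UNIV f"
  by (auto simp: smooth_def intro: C_k_continuous)

lemma smooth_isCont: "smooth f \<Longrightarrow> isCont f x"
  using smooth_continuous continuous_on_eq_continuous_at open_UNIV by blast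

lemma smooth_differentiable: "smooth f \<Longrightarrow> f differentiable (at x)"
  using C_k.simps(2) unfolding smooth_def by blast

lemma smooth_partial: "smooth f \<Longrightarrow> b \<in> Basis \<Longrightarrow> smooth (partial b f)"
  using C_k.simps(2) unfolding smooth_def by blast

text \<open>A coinduction principle: it suffices that the function lies in a class of differentiable
  functions closed under partial derivatives. The induction runs over \<open>C_k (Suc k)\<close>,
  because the continuity demanded by \<open>C_k 0\<close> is available only through
  differentiability.\<close>

lemma smoothI:
  assumes "S f" "\<And>f x. S f \<Longrightarrow> f differentiable (at x)"
    "\<And>f b. S f \<Longrightarrow> b \<in> Basis \<Longrightarrow> S (partial b f)"
  shows "smooth f"
proof -
  have "S f \<Longrightarrow> C_k (Suc k) f" for k f
    by (induction k arbitrary: f) (use assms(2,3) in \<open>auto intro!: differentiable_imp_continuous_on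
      differentiable_at_withinI simp: differentiable_on_def\<close>)
  then show ?thesis unfolding smooth_def using assms(1) C_k_Suc_imp by blast
qed

lemma smooth_const [simp, intro]: "smooth (\<lambda>x. c)"
  by (simp add: smooth_def C_k_const)
lemma smooth_add [intro]: "smooth f \<Longrightarrow> smooth g \<Longrightarrow> smooth (\<lambda>x. f x + g x)"
  by (simp add: smooth_def C_k_add)
lemma smooth_mult [intro]: "smooth f \<Longrightarrow> smooth g \<Longrightarrow> smooth (\<lambda>x. f x * g x)"
  by (simp add: smooth_def C_k_mult)
lemma smooth_minus [intro]: "smooth f \<Longrightarrow> smooth (\<lambda>x. - f x)"
  using smooth_mult[OF smooth_const[of "-1"], of f] by simp
lemma smooth_diff [intro]: "smooth f \<Longrightarrow> smooth g \<Longrightarrow> smooth (\<lambda>x. f x - g x)"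
  using smooth_add[OF _ smooth_minus[of g], of f] by simp
lemma smooth_sum [intro]: "(\<And>i. i \<in> I \<Longrightarrow> smooth (f i)) \<Longrightarrow> smooth (\<lambda>x. \<Sum>i\<in>I. f i x)"
  by (induction I rule: infinite_finite_induct) auto

lemma smooth_linear:
  fixes f :: "'a::euclidean_space \<Rightarrow> real"
  assumes "bounded_linear f" shows "smooth f"
  unfolding smooth_def
proof
  fix k
  have d: "(f has_derivative f) (at x)" for x
    using assms bounded_linear_imp_has_derivative by blast
  have "partial b f = (\<lambda>x. f b)" for b by (rule ext) (rule partial_eqI[OF d])
  moreover have "f differentiable (at x)" for x using d differentiableI by blast
  ultimately have "C_k (Suc k) f" by (simp add: C_k_const)
  then show "C_k k f" by (rule C_k_Suc_imp)
qed

lemma smooth_real_differentiable: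
  fixes g :: "real \<Rightarrow> real"
  assumes "smooth g"
  shows "(g has_real_derivative partial 1 g x) (at x)"
proof -
  have "(*) (partial 1 g x) = (\<lambda>h. h * partial 1 g x)" by auto
  with has_derivative_partial[OF smooth_differentiable[OF assms], of x]
  show ?thesis by (simp add: has_field_derivative_def)
qed

lemma partial_real: "(g has_real_derivative d) (at x) \<Longrightarrow> partial 1 g x = d"
  by (simp add: has_field_derivative_def partial_eqI)

lemma partial_compose:
  fixes g :: "real \<Rightarrow> real" and f :: "'a::euclidean_space \<Rightarrow> real"
  assumes "(g has_real_derivative d) (at (f x))" "f differentiable (at x)"
  shows "partial b (\<lambda>x. g (f x)) x = d * partial b f x"
    and "(\<lambda>x. g (f x)) differentiable (at x)"
proof -
  have *: "((\<lambda>x. g (f x)) has_derivative (\<lambda>h. d * frechet_derivative f (at x) h)) (at x)"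
    using has_derivative_compose[OF frechet_derivative_worksI[OF assms(2)], of g "(*) d"] assms(1)
    by (simp add: has_field_derivative_def)
  from partial_eqI[OF this] show "partial b (\<lambda>x. g (f x)) x = d * partial b f x"
    by (simp add: partial_def)
  from * show "(\<lambda>x. g (f x)) differentiable (at x)" by (rule differentiableI)
qed

text \<open>The chain rule replaces \<open>g\<close> by its derivative and multiplies by a partial
  of \<open>f\<close>. Hence the induction varies \<open>g\<close> and keeps \<open>f\<close>
  fixed.\<close>

lemma smooth_compose:
  fixes g :: "real \<Rightarrow> real" and f :: "'a::euclidean_space \<Rightarrow> real"
  assumes "smooth g" "smooth f"
  shows "smooth (\<lambda>x. g (f x))"
proof -
  have "C_k k (\<lambda>x. g (f x))" for k
    using assms(1)
  proof (induction k arbitrary: g)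
    case 0
    then show ?case
      using continuous_on_compose2[OF smooth_continuous[OF 0] smooth_continuous[OF assms(2)]] by simp
  next
    case (Suc k)
    have eq: "partial b (\<lambda>x. g (f x)) = (\<lambda>x. partial 1 g (f x) * partial b f x)" for b
      by (intro ext partial_compose(1) smooth_real_differentiable Suc.prems smooth_differentiable assms(2))
    have "C_k k (\<lambda>x. partial 1 g (f x) * partial b f x)" if "b \<in> Basis" for b
      using that assms(2) smooth_partial[of f b] smooth_partial[OF Suc.prems, of 1]
      by (intro C_k_mult Suc.IH) (auto simp: smooth_def)
    with eq show ?case
      using partial_compose(2)[OF smooth_real_differentiable[OF Suc.prems] smooth_differentiable[OF assms(2)]]
      by simp
  qed
  then show ?thesis by (simp add: smooth_def)
qed

text \<open>Each partial is a product of two copies of the inverse itself and a partial of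
  \<open>f\<close>, so the induction on the order closes for a fixed \<open>f\<close>.\<close>

lemma smooth_inverse:
  fixes f :: "'a::euclidean_space \<Rightarrow> real"
  assumes "smooth f" "\<And>x. f x \<noteq> 0"
  shows "smooth (\<lambda>x. inverse (f x))"
proof -
  have d: "(inverse has_real_derivative (- (inverse (f x) * inverse (f x)))) (at (f x))" for x
    using DERIV_inverse[OF assms(2)[of x]] by (simp add: power2_eq_square)
  have eq: "partial b (\<lambda>x. inverse (f x)) = (\<lambda>x. (- 1) * (inverse (f x) * inverse (f x)) * partial b f x)" for b
    by (rule ext, subst partial_compose(1)[where g = inverse and f = f, OF d])
      (simp_all add: smooth_differentiable assms)
  have "C_k k (\<lambda>x. inverse (f x))" for k
  proof (induction k)
    case 0
    then show ?case using smooth_continuous[OF assms(1)] assms(2) by (auto intro: continuous_intros)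
  next
    case (Suc k)
    have "C_k k (\<lambda>x. (- 1) * (inverse (f x) * inverse (f x)) * partial b f x)" if "b \<in> Basis" for b
      using that smooth_partial[OF assms(1)]
      by (intro C_k_mult Suc C_k_const) (auto simp: smooth_def)
    then show ?case
      using eq partial_compose(2)[where g = inverse and f = f, OF d] smooth_differentiable[OF assms(1)] by simp
  qed
  then show ?thesis by (simp add: smooth_def)
qed

lemma laplacian_add:
  assumes "smooth f" "smooth g"
  shows "laplacian (\<lambda>x. f x + g x) x = laplacian f x + laplacian g x"
proof -
  have 1: "partial b (\<lambda>x. f x + g x) = (\<lambda>x. partial b f x + partial b g x)" for b
    by (intro ext partial_add smooth_differentiable assms)
  show ?thesis unfolding laplacian_def 1
    by (simp add: partial_add smooth_differentiable smooth_partial assms sum.distrib)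
qed

lemma laplacian_mult:
  assumes "smooth f" "smooth g"
  shows "laplacian (\<lambda>x. f x * g x) x
    = f x * laplacian g x + 2 * (\<Sum>b\<in>Basis. partial b f x * partial b g x) + laplacian f x * g x"
proof -
  have 1: "partial b (\<lambda>x. f x * g x) = (\<lambda>x. f x * partial b g x + partial b f x * g x)" for b
    by (intro ext partial_mult smooth_differentiable assms)
  have "partial b (partial b (\<lambda>x. f x * g x)) x = f x * partial b (partial b g) x
      + 2 * (partial b f x * partial b g x) + partial b (partial b f) x * g x" if "b \<in> Basis" for b
    unfolding 1
    using that
    by (subst partial_add)
      (auto intro!: smooth_differentiable smooth_partial smooth_mult assms
        simp: partial_mult[OF smooth_differentiable smooth_differentiable] smooth_partial assms)
  then show ?thesis unfolding laplacian_def
    by (simp add: sum.distrib sum_distrib_left sum_distrib_right algebra_simps)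
qed

lemma laplacian_const: "laplacian (\<lambda>x. c) x = 0"
proof -
  have "partial b (\<lambda>x. c) = (\<lambda>x. 0)" for b :: 'a and c
    by (rule ext, rule partial_eqI[of _ "\<lambda>_. 0", simplified]) simp
  then show ?thesis by (simp add: laplacian_def)
qed

lemma laplacian_cmult: "smooth f \<Longrightarrow> laplacian (\<lambda>x. c * f x) x = c * laplacian f x"
  by (subst laplacian_mult) (auto simp: laplacian_const partial_eqI[OF has_derivative_const])

lemma laplacian_diff:
  assumes "smooth f" "smooth g"
  shows "laplacian (\<lambda>x. f x - g x) x = laplacian f x - laplacian g x"
  using laplacian_add[OF assms(1) smooth_mult[OF smooth_const[of "-1"] assms(2)], of x]
    laplacian_cmult[OF assms(2), of "-1" x] by simp

lemma smooth_laplacian: "smooth f \<Longrightarrow> smooth (laplacian f)"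
  unfolding laplacian_def[abs_def] by (intro smooth_sum smooth_partial)

text \<open>Squared distance in units of \<open>r\<close>. It is a polynomial, so radial functions
  written as profiles of \<open>sqd\<close> are smooth at the centre as well.\<close>

definition sqd :: "real \<Rightarrow> 'a::euclidean_space \<Rightarrow> 'a \<Rightarrow> real" where
  "sqd r a x = (x - a) \<bullet> (x - a) / r\<^sup>2"

lemma sqd_has_derivative: "(sqd r a has_derivative (\<lambda>h. 2 * ((x - a) \<bullet> h) / r\<^sup>2)) (at x)"
  unfolding sqd_def[abs_def]
  by (rule has_derivative_eq_rhs, rule bounded_linear.has_derivative[OF bounded_linear_divide])
    (auto intro!: derivative_eq_intros simp: inner_commute)

lemma partial_sqd: "partial b (sqd r a) x = 2 * ((x - a) \<bullet> b) / r\<^sup>2"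
  by (rule partial_eqI[OF sqd_has_derivative])

lemma smooth_inner: "smooth (\<lambda>x. (x - a) \<bullet> b)"
  unfolding inner_diff_left by (intro smooth_diff smooth_const smooth_linear bounded_linear_inner_left)

lemma smooth_sqd: "smooth (sqd r a)"
proof -
  have "sqd r a = (\<lambda>x. \<Sum>b\<in>Basis. inverse (r\<^sup>2) * (((x - a) \<bullet> b) * ((x - a) \<bullet> b)))"
    by (subst sqd_def[abs_def], subst euclidean_inner) (simp add: divide_inverse sum_distrib_left mult.commute)
  moreover have "smooth \<dots>"
    by (intro smooth_sum smooth_mult smooth_const smooth_inner)
  ultimately show ?thesis by simp
qed

lemma sqd_nonneg: "sqd r a x \<ge> 0" by (simp add: sqd_def)

lemma sqd_norm: "sqd r a x = (norm (x - a))\<^sup>2 / r\<^sup>2" by (simp add: sqd_def power2_norm_eq_inner)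

lemma laplacian_radial:
  fixes g g' g'' :: "real \<Rightarrow> real" and a :: "'a::euclidean_space"
  assumes "smooth g" "\<And>t. (g has_real_derivative g' t) (at t)" "\<And>t. (g' has_real_derivative g'' t) (at t)"
    and "r \<noteq> 0"
  shows "laplacian (\<lambda>x. g (sqd r a x)) x
    = (4 * sqd r a x * g'' (sqd r a x) + 2 * real DIM('a) * g' (sqd r a x)) / r\<^sup>2"
proof -
  have g': "smooth g'" using smooth_partial[OF assms(1), of 1] partial_real[OF assms(2)] 
    by (metis Basis_real_def ext insertI1)
  have 1: "partial b (\<lambda>x. g (sqd r a x)) = (\<lambda>x. g' (sqd r a x) * (2 / r\<^sup>2 * ((x - a) \<bullet> b)))" for b
    by (rule ext, subst partial_compose(1)[OF assms(2)])
      (simp_all add: partial_sqd smooth_differentiable smooth_sqd)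
  have 2: "partial b (\<lambda>x. g' (sqd r a x)) x = g'' (sqd r a x) * (2 * ((x - a) \<bullet> b) / r\<^sup>2)" for b
    by (subst partial_compose(1)[OF assms(3)])
      (simp_all add: partial_sqd smooth_differentiable smooth_sqd)
  have 4: "(\<lambda>x. 2 / r\<^sup>2 * ((x - a) \<bullet> b)) differentiable (at x)" for b
    by (intro smooth_differentiable smooth_mult smooth_const smooth_inner)
  have 3: "partial b (\<lambda>x. 2 / r\<^sup>2 * ((x - a) \<bullet> b)) x = 2 / r\<^sup>2" if "b \<in> Basis" for b
  proof -
    have "((\<lambda>x. 2 / r\<^sup>2 * ((x - a) \<bullet> b)) has_derivative (\<lambda>h. 2 / r\<^sup>2 * (h \<bullet> b))) (at x)"
      by (rule has_derivative_mult_right) (auto intro!: derivative_eq_intros)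
    from partial_eqI[OF this, of b] that show ?thesis by simp
  qed
  have "partial b (partial b (\<lambda>x. g (sqd r a x))) x
     = g' (sqd r a x) * (2 / r\<^sup>2) + 4 / r\<^sup>2 / r\<^sup>2 * g'' (sqd r a x) * (((x - a) \<bullet> b) * ((x - a) \<bullet> b))"
    if "b \<in> Basis" for b
    unfolding 1 
    by (subst partial_mult[OF smooth_differentiable[OF smooth_compose[OF g' smooth_sqd]] 4])
      (simp only: 2 3[OF that], simp add: power2_eq_square)
  then have "laplacian (\<lambda>x. g (sqd r a x)) x = 
     real DIM('a) * (g' (sqd r a x) * (2 / r\<^sup>2)) + 4 / r\<^sup>2 / r\<^sup>2 * g'' (sqd r a x) * ((x - a) \<bullet> (x - a))"
    unfolding laplacian_def by (subst euclidean_inner[of "x-a" "x-a"]) (simp add: sum.distrib sum_distrib_left)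
  then show ?thesis by (simp add: sqd_def divide_inverse algebra_simps)
qed

section \<open>A flat function\<close>

text \<open>The powers of 1/t in the denominator make the family closed under differentiation up to
  linear combinations.\<close>

definition flat :: "nat \<Rightarrow> real \<Rightarrow> real" where
  "flat j t = (if t > 0 then exp (- 1 / t) / t ^ j else 0)"

lemma flat_tendsto_0: "((\<lambda>t. flat j t) \<longlongrightarrow> 0) (at 0)"
proof -
  have "((\<lambda>s::real. s ^ j / exp s) \<longlongrightarrow> 0) at_top" by (rule tendsto_power_div_exp_0)
  then have "((\<lambda>t::real. inverse t ^ j / exp (inverse t)) \<longlongrightarrow> 0) (at_right 0)"
    by (simp add: filterlim_at_right_to_top)
  then have r: "((\<lambda>t. flat j t) \<longlongrightarrow> 0) (at_right 0)"
    by (rule Lim_transform_eventually)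
      (auto simp: flat_def eventually_at_right_field exp_minus field_simps power_inverse intro!: exI[of _ 1])
  have l: "((\<lambda>t. flat j t) \<longlongrightarrow> 0) (at_left 0)"
    by (rule Lim_transform_eventually[OF tendsto_const])
      (auto simp: flat_def eventually_at_left_field intro!: exI[of _ "-1"])
  show ?thesis using l r filterlim_at_split by blast
qed

lemma flat_has_derivative: "(flat j has_real_derivative (flat (j + 2) t - real j * flat (Suc j) t)) (at t)"
proof -
  consider "t > 0" | "t < 0" | "t = 0" by linarith
  then show ?thesis
  proof cases
    case 1
    have "((\<lambda>t. exp (- 1 / t) / t ^ j) has_real_derivative (flat (j + 2) t - real j * flat (Suc j) t)) (at t)"
      using 1
      by (auto intro!: derivative_eq_intros simp: flat_def power2_eq_square)
        (cases j; simp add: field_simps)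
    then show ?thesis
      by (rule has_field_derivative_transform_within_open[of _ _ _ "{0<..}"]) (use 1 in \<open>auto simp: flat_def\<close>)
  next
    case 2
    have "((\<lambda>t. 0) has_real_derivative (flat (j + 2) t - real j * flat (Suc j) t)) (at t)"
      using 2 by (auto simp: flat_def)
    then show ?thesis
      by (rule has_field_derivative_transform_within_open[of _ _ _ "{..<0}"]) (use 2 in \<open>auto simp: flat_def\<close>)
  next
    case 3
    \<comment> \<open>Away from zero the difference quotient of \<open>flat j\<close> at the origin
      is exactly \<open>flat (Suc j)\<close>.\<close>
    have "((\<lambda>h. (flat j (0 + h) - flat j 0) / h) \<longlongrightarrow> 0) (at 0)"
      by (rule Lim_transform_eventually[OF flat_tendsto_0[of "Suc j"]])
        (auto simp: flat_def eventually_at_filter)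
    then show ?thesis using 3 by (simp add: DERIV_def flat_def)
  qed
qed

lemma smooth_flat: "smooth (flat j)"
proof -
  have "C_k k (flat j)" for k j
  proof (induction k arbitrary: j)
    case 0
    have "isCont (flat j) t" for t using flat_has_derivative DERIV_isCont by blast
    then show ?case by (simp add: continuous_at_imp_continuous_on)
  next
    case (Suc k)
    have "partial 1 (flat j) = (\<lambda>t. flat (j + 2) t + (- real j) * flat (Suc j) t)"
      by (rule ext, subst partial_real[OF flat_has_derivative]) simp
    moreover have "C_k k \<dots>" by (intro C_k_add C_k_mult C_k_const Suc)
    moreover have "flat j differentiable (at t)" for t
      using flat_has_derivative[of j t] real_differentiable_def by blast
    ultimately show ?case by simp
  qed
  then show ?thesis by (simp add: smooth_def)
qed

lemma flat_pos: "t > 0 \<Longrightarrow> flat j t > 0" by (simp add: flat_def)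
lemma flat_nonneg: "flat j t \<ge> 0" by (simp add: flat_def)
lemma flat_zero: "t \<le> 0 \<Longrightarrow> flat j t = 0" by (simp add: flat_def)

lemma smooth_step:
  obtains h :: "real \<Rightarrow> real" where "smooth h" "\<And>t. t \<le> 1 \<Longrightarrow> h t = 0" "\<And>t. t \<ge> 2 \<Longrightarrow> h t = 1"
proof
  define g where "g t = flat 0 (t + (-1))" for t
  define g2 where "g2 t = flat 0 (2 + (-1) * t)" for t
  have id: "smooth (\<lambda>t::real. t)" by (rule smooth_linear) simp
  have s: "smooth g" "smooth g2" unfolding g_def g2_def
    by (intro smooth_compose[OF smooth_flat] smooth_add smooth_mult smooth_const id)+
  \<comment> \<open>The first summand is positive for t > 1 and the second for t < 2, so their sum
    never vanishes.\<close>
  have nz: "g t + g2 t \<noteq> 0" for t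
    using flat_pos[of "t + (-1)" 0] flat_pos[of "2 + (-1) * t" 0] flat_nonneg[of 0 "t + (-1)"] flat_nonneg[of 0 "2 + (-1) * t"] 
    unfolding g_def g2_def by (cases "t > 1") linarith+
  show "smooth (\<lambda>t. g t * inverse (g t + g2 t))"
    using nz by (intro smooth_mult s smooth_inverse smooth_add) auto
  show "g t * inverse (g t + g2 t) = 0" if "t \<le> 1" for t using that by (simp add: g_def flat_zero)
  show "g t * inverse (g t + g2 t) = 1" if "t \<ge> 2" for t
  proof -
    have "g2 t = 0" using that by (simp add: g2_def flat_zero)
    then show ?thesis using nz[of t] by simp
  qed
qed

section \<open>Differentiation under the integral sign and locally bounded functions\<close>

text \<open>Dominated convergence for the difference quotients along an arbitrary sequence, with
  majorant \<open>2 * C * \<bar>v w\<bar>\<close> from the mean value inequality. The bounds on the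
  kernel are asked only where \<open>v\<close> is nonzero, so a truncated \<open>v\<close> permits
  kernels that are unbounded on the whole space.\<close>

lemma has_derivative_lint:
  fixes k :: "'p::{real_normed_vector, perfect_space} \<Rightarrow> 'b \<Rightarrow> real" and v :: "'b \<Rightarrow> real"
  assumes v: "integrable M v" and "r > 0"
    and meas: "\<And>t. k t \<in> borel_measurable M"
    and measD: "\<And>h. (\<lambda>w. D t0 w h) \<in> borel_measurable M"
    and der: "\<And>t w. t \<in> ball t0 r \<Longrightarrow> ((\<lambda>t. k t w) has_derivative D t w) (at t)"
    and bd: "\<And>t w h. t \<in> ball t0 r \<Longrightarrow> v w \<noteq> 0 \<Longrightarrow> \<bar>D t w h\<bar> \<le> C * norm h"
    and k0: "\<And>t w. t \<in> ball t0 r \<Longrightarrow> v w \<noteq> 0 \<Longrightarrow> \<bar>k t w\<bar> \<le> B"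
  shows "((\<lambda>t. LINT w|M. v w * k t w) has_derivative (\<lambda>h. LINT w|M. v w * D t0 w h)) (at t0)"
proof -
  have vm [measurable]: "v \<in> borel_measurable M" using v by auto
  note [measurable] = meas measD
  have t0: "t0 \<in> ball t0 r" using \<open>r > 0\<close> by simp
  have ik: "integrable M (\<lambda>w. v w * k t w)" if "t \<in> ball t0 r" for t
  proof (rule Bochner_Integration.integrable_bound[OF integrable_mult_right[OF v, of B]])
    show "AE w in M. norm (v w * k t w) \<le> norm (B * v w)"
    proof (rule AE_I2)
      fix w show "norm (v w * k t w) \<le> norm (B * v w)"
      proof (cases "v w = 0")
        case False
        then have "\<bar>k t w\<bar> \<le> \<bar>B\<bar>" using k0[OF that] by force
        then have "\<bar>v w\<bar> * \<bar>k t w\<bar> \<le> \<bar>v w\<bar> * \<bar>B\<bar>" by (rule mult_left_mono) simp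
        then show ?thesis by (simp add: abs_mult mult.commute)
      qed simp
    qed
  qed simp
  have iD: "integrable M (\<lambda>w. v w * D t0 w h)" for h
  proof (rule Bochner_Integration.integrable_bound[OF integrable_mult_right[OF v, of "C * norm h"]])
    show "AE w in M. norm (v w * D t0 w h) \<le> norm (C * norm h * v w)"
    proof (rule AE_I2)
      fix w show "norm (v w * D t0 w h) \<le> norm (C * norm h * v w)"
      proof (cases "v w = 0")
        case False
        then have "\<bar>D t0 w h\<bar> \<le> \<bar>C * norm h\<bar>" using bd[OF t0, of w h] by force
        then have "\<bar>v w\<bar> * \<bar>D t0 w h\<bar> \<le> \<bar>v w\<bar> * \<bar>C * norm h\<bar>" by (rule mult_left_mono) simp
        then show ?thesis by (simp add: abs_mult mult_ac)
      qed simp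
    qed
  qed simp
  have lin: "linear (D t0 w)" for w using der[OF t0] has_derivative_linear by blast
  have bl: "bounded_linear (\<lambda>h. LINT w|M. v w * D t0 w h)"
  proof (rule bounded_linear_intro[where K = "C * (LINT w|M. \<bar>v w\<bar>)"])
    fix x y show "(LINT w|M. v w * D t0 w (x + y)) = (LINT w|M. v w * D t0 w x) + (LINT w|M. v w * D t0 w y)"
      by (simp add: linear_add[OF lin] distrib_left iD)
  next
    fix s x show "(LINT w|M. v w * D t0 w (s *\<^sub>R x)) = s *\<^sub>R (LINT w|M. v w * D t0 w x)"
      by (simp add: linear_scale[OF lin] mult.left_commute)
  next
    fix x
    have "norm (LINT w|M. v w * D t0 w x) \<le> (LINT w|M. norm (v w * D t0 w x))"
      by (rule integral_norm_bound)
    also have "\<dots> \<le> (LINT w|M. (C * norm x) * \<bar>v w\<bar>)"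
    proof (rule integral_mono)
      show "integrable M (\<lambda>w. norm (v w * D t0 w x))" using iD by (rule integrable_norm)
      show "integrable M (\<lambda>w. C * norm x * \<bar>v w\<bar>)" using v by auto
      fix w show "norm (v w * D t0 w x) \<le> C * norm x * \<bar>v w\<bar>"
        using bd[OF t0, of w x] by (cases "v w = 0") (auto simp: abs_mult mult.commute intro: mult_left_mono)
    qed
    also have "\<dots> = norm x * (C * (LINT w|M. \<bar>v w\<bar>))" by simp
    finally show "norm (LINT w|M. v w * D t0 w x) \<le> norm x * (C * (LINT w|M. \<bar>v w\<bar>))" .
  qed
  have lim: "(\<lambda>h. norm ((LINT w|M. v w * k (t0 + h) w) - (LINT w|M. v w * k t0 w) - (LINT w|M. v w * D t0 w h)) / norm h) \<midarrow>0\<rightarrow> 0"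
    unfolding tendsto_at_iff_sequentially
  proof (intro allI impI)
    fix X :: "nat \<Rightarrow> 'p" assume X0: "\<forall>i. X i \<in> UNIV - {0}" and X: "X \<longlonglongrightarrow> 0"
    \<comment> \<open>Cutting to zero while \<open>X i\<close> is outside the ball makes the
      majorant valid for every \<open>i\<close>; the limit sees only large \<open>i\<close>.\<close>
    define g where "g i w = (if X i \<in> ball 0 r then v w * ((k (t0 + X i) w - k t0 w - D t0 w (X i)) / norm (X i)) else 0)" for i w
    have gb: "\<bar>g i w\<bar> \<le> 2 * C * \<bar>v w\<bar>" for i w
    proof (cases "X i \<in> ball 0 r \<and> v w \<noteq> 0")
      case True
      have nX: "norm (X i) > 0" using X0 by auto
      have inb: "t0 + X i \<in> ball t0 r" using True by (simp add: dist_norm)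
      have "norm (k (t0 + X i) w - k t0 w) \<le> C * norm (t0 + X i - t0)"
      proof (rule differentiable_bound[of "ball t0 r" "\<lambda>t. k t w" "\<lambda>t. D t w"])
        fix t assume t: "t \<in> ball t0 r"
        show "((\<lambda>t. k t w) has_derivative D t w) (at t within ball t0 r)"
          using der[OF t] has_derivative_at_withinI by blast
        show "onorm (D t w) \<le> C" by (rule onorm_le) (use bd[OF t, of w] True in auto)
      qed (use t0 inb in auto)
      then have "\<bar>k (t0 + X i) w - k t0 w\<bar> \<le> C * norm (X i)" by simp
      moreover have "\<bar>D t0 w (X i)\<bar> \<le> C * norm (X i)" using bd[OF t0] True by blast
      ultimately have "\<bar>k (t0 + X i) w - k t0 w - D t0 w (X i)\<bar> \<le> (2 * C) * norm (X i)" by linarith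
      then have "\<bar>(k (t0 + X i) w - k t0 w - D t0 w (X i)) / norm (X i)\<bar> \<le> 2 * C"
        using nX by (simp add: field_simps)
      then have "\<bar>v w\<bar> * \<bar>(k (t0 + X i) w - k t0 w - D t0 w (X i)) / norm (X i)\<bar> \<le> \<bar>v w\<bar> * (2 * C)"
        by (rule mult_left_mono) simp
      moreover have "\<bar>g i w\<bar> = \<bar>v w\<bar> * \<bar>(k (t0 + X i) w - k t0 w - D t0 w (X i)) / norm (X i)\<bar>"
        using True unfolding g_def by (simp only: abs_mult if_True)
      ultimately show ?thesis by (simp add: mult_ac)
    next
      case False
      have "C \<ge> 0 \<or> v w = 0"
      proof (cases "v w = 0")
        case False
        have "\<bar>D t0 w (X 0)\<bar> \<le> C * norm (X 0)" using bd[OF t0 False] .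
        moreover have "norm (X 0) > 0" using X0 by auto
        ultimately have "0 \<le> C * norm (X 0)" by linarith
        then show ?thesis using \<open>norm (X 0) > 0\<close> by (simp add: zero_le_mult_iff)
      qed simp
      then show ?thesis using False by (auto simp: g_def)
    qed
    have ev: "\<forall>\<^sub>F i in sequentially. X i \<in> ball 0 r"
      using X \<open>r > 0\<close> by (metis centre_in_ball open_ball topological_tendstoD)
    have "(\<lambda>i. LINT w|M. g i w) \<longlonglongrightarrow> (LINT w|M. 0)"
    proof (rule integral_dominated_convergence[where w = "\<lambda>w. 2 * C * \<bar>v w\<bar>"])
      show "integrable M (\<lambda>w. 2 * C * \<bar>v w\<bar>)" using v by auto
      show "g i \<in> borel_measurable M" for i unfolding g_def by (cases "X i \<in> ball 0 r") simp_all
      show "AE w in M. (\<lambda>i. g i w) \<longlonglongrightarrow> 0"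
      proof (rule AE_I2)
        fix w
        have "((\<lambda>h. norm (k (t0 + h) w - k t0 w - D t0 w h) / norm h) \<longlongrightarrow> 0) (at 0)"
          using der[OF t0, of w] unfolding has_derivative_at by simp
        then have "(\<lambda>i. norm (k (t0 + X i) w - k t0 w - D t0 w (X i)) / norm (X i)) \<longlonglongrightarrow> 0"
          using X0 X unfolding tendsto_at_iff_sequentially comp_def by blast
        then have "(\<lambda>i. (k (t0 + X i) w - k t0 w - D t0 w (X i)) / norm (X i)) \<longlonglongrightarrow> 0"
          by (subst tendsto_rabs_zero_iff[symmetric]) simp
        then have "(\<lambda>i. v w * ((k (t0 + X i) w - k t0 w - D t0 w (X i)) / norm (X i))) \<longlonglongrightarrow> 0"
          by (rule tendsto_mult_right_zero)
        then show "(\<lambda>i. g i w) \<longlonglongrightarrow> 0"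
          by (rule Lim_transform_eventually) (use ev in \<open>auto elim!: eventually_mono simp: g_def\<close>)
      qed
      show "AE w in M. norm (g i w) \<le> 2 * C * \<bar>v w\<bar>" for i using gb by auto
    qed simp
    then have "(\<lambda>i. \<bar>LINT w|M. g i w\<bar>) \<longlonglongrightarrow> 0" by (simp add: tendsto_rabs_zero)
    then show "((\<lambda>h. norm ((LINT w|M. v w * k (t0 + h) w) - (LINT w|M. v w * k t0 w) - (LINT w|M. v w * D t0 w h)) / norm h) \<circ> X) \<longlonglongrightarrow> 0"
    proof (rule Lim_transform_eventually)
      show "\<forall>\<^sub>F i in sequentially. \<bar>LINT w|M. g i w\<bar> = ((\<lambda>h. norm ((LINT w|M. v w * k (t0 + h) w) - (LINT w|M. v w * k t0 w) - (LINT w|M. v w * D t0 w h)) / norm h) \<circ> X) i"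
        using ev
      proof eventually_elim
        case (elim i)
        then have inb: "t0 + X i \<in> ball t0 r" by (simp add: dist_norm)
        have "(LINT w|M. g i w) = (LINT w|M. (v w * k (t0 + X i) w - v w * k t0 w - v w * D t0 w (X i)) / norm (X i))"
          using elim by (simp add: g_def algebra_simps diff_divide_distrib)
        also have "\<dots> = ((LINT w|M. v w * k (t0 + X i) w) - (LINT w|M. v w * k t0 w) - (LINT w|M. v w * D t0 w (X i))) / norm (X i)"
          using ik[OF inb] ik[OF t0] iD by simp
        finally show ?case by (simp add: abs_div_pos)
      qed
    qed
  qed
  show ?thesis unfolding has_derivative_at using bl lim by simp
qed

text \<open>Continuity would be too narrow: the half-space indicator occurs as a factor, and the
  limit \<open>Q\<close> is at first known only as a pointwise limit.\<close>

definition locbdd :: "('a::euclidean_space \<Rightarrow> real) \<Rightarrow> bool" where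
  "locbdd v \<longleftrightarrow> v \<in> borel_measurable borel \<and> (\<forall>R. \<exists>B. \<forall>x. norm x \<le> R \<longrightarrow> \<bar>v x\<bar> \<le> B)"

lemma locbdd_measurable [measurable_dest]: "locbdd v \<Longrightarrow> v \<in> borel_measurable borel"
  by (simp add: locbdd_def)

lemma locbdd_continuous:
  assumes "continuous_on UNIV v" shows "locbdd v"
proof -
  have "\<exists>B. \<forall>x. norm x \<le> R \<longrightarrow> \<bar>v x\<bar> \<le> B" for R
  proof -
    have "compact (v ` cball 0 R)"
      by (rule compact_continuous_image[OF continuous_on_subset[OF assms]]) auto
    then obtain B where "\<forall>y \<in> v ` cball 0 R. norm y \<le> B" using compact_imp_bounded bounded_iff by blast
    then show ?thesis by (intro exI[of _ B]) auto
  qed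
  then show ?thesis unfolding locbdd_def using borel_measurable_continuous_onI[OF assms] by auto
qed

lemma locbdd_mult:
  assumes "locbdd u" "locbdd v" shows "locbdd (\<lambda>x. u x * v x)"
proof -
  have "\<exists>B. \<forall>x. norm x \<le> R \<longrightarrow> \<bar>u x * v x\<bar> \<le> B" for R
  proof -
    obtain A B where "\<forall>x. norm x \<le> R \<longrightarrow> \<bar>u x\<bar> \<le> A" "\<forall>x. norm x \<le> R \<longrightarrow> \<bar>v x\<bar> \<le> B"
      using assms unfolding locbdd_def by metis
    then have "\<forall>x. norm x \<le> R \<longrightarrow> \<bar>u x * v x\<bar> \<le> A * B"
      unfolding abs_mult by (metis abs_ge_zero mult_mono order_trans)
    then show ?thesis by blast
  qed
  then show ?thesis using assms unfolding locbdd_def by auto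
qed

lemma locbdd_indicator:
  assumes "S \<in> sets borel" shows "locbdd (indicator S :: _ \<Rightarrow> real)"
  unfolding locbdd_def using assms by (auto intro!: exI[of _ 1] split: split_indicator)

lemma locbdd_integrable_ball:
  assumes "locbdd v" shows "integrable lborel (\<lambda>w. indicator (cball a R) w * v w)"
proof -
  obtain B where B: "\<forall>x. norm x \<le> norm a + R \<longrightarrow> \<bar>v x\<bar> \<le> B" using assms unfolding locbdd_def by metis
  have "integrable lborel (\<lambda>w. indicator (cball a R) w *\<^sub>R v w)"
  proof (rule integrableI_bounded_set_indicator[where B = B])
    show "v \<in> borel_measurable lborel" using assms by (simp add: locbdd_def)
    show "emeasure lborel (cball a R) < \<infinity>" using emeasure_bounded_finite[OF bounded_cball] by blast
    have "norm x \<le> norm a + R" if "x \<in> cball a R" for x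
      using that norm_triangle_sub[of x a] by (auto simp: dist_norm norm_minus_commute)
    then show "AE x in lborel. x \<in> cball a R \<longrightarrow> norm (v x) \<le> B" using B by auto
  qed simp
  then show ?thesis by simp
qed

lemma locbdd_integrable:
  assumes "locbdd v" "\<And>x. x \<notin> cball a R \<Longrightarrow> v x = 0" shows "integrable lborel v"
proof -
  have "(\<lambda>w. indicator (cball a R) w * v w) = v" using assms(2) by (auto split: split_indicator)
  with locbdd_integrable_ball[OF assms(1), of a R] show ?thesis by simp
qed

lemma lint_affine:
  fixes g :: "'a::euclidean_space \<Rightarrow> real"
  assumes "c \<noteq> 0" "g \<in> borel_measurable borel"
  shows "(LINT w|lborel. g w) = \<bar>c\<bar> ^ DIM('a) * (LINT z|lborel. g (x + c *\<^sub>R z))"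
proof -
  have "(LINT w|lborel. g w) = (LINT w|density (distr lborel borel (\<lambda>z. x + c *\<^sub>R z)) (\<lambda>_. \<bar>c\<bar> ^ DIM('a)). g w)"
    using lborel_affine[OF assms(1), of x] by simp
  also have "\<dots> = (LINT w|distr lborel borel (\<lambda>z. x + c *\<^sub>R z). \<bar>c\<bar> ^ DIM('a) * g w)"
    using assms(2) by (subst integral_density) (auto simp: ennreal_power[symmetric])
  also have "\<dots> = (LINT z|lborel. \<bar>c\<bar> ^ DIM('a) * g (x + c *\<^sub>R z))"
    using assms(2) by (subst integral_distr) auto
  finally show ?thesis by simp
qed

lemma continuous_bounded_support:
  fixes f :: "'a::euclidean_space \<Rightarrow> real"
  assumes "continuous_on UNIV f" "\<And>x. x \<notin> cball a R \<Longrightarrow> f x = 0"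
  obtains B where "B \<ge> 0" "\<And>x. \<bar>f x\<bar> \<le> B"
proof -
  have "compact (f ` cball a R)"
    by (rule compact_continuous_image[OF continuous_on_subset[OF assms(1)]]) auto
  then obtain B where B: "\<forall>y \<in> f ` cball a R. norm y \<le> B" using compact_imp_bounded bounded_iff by blast
  have "\<bar>f x\<bar> \<le> \<bar>B\<bar>" for x
  proof (cases "x \<in> cball a R")
    case True
    then have "norm (f x) \<le> B" using B by blast
    then show ?thesis by simp
  next
    case False
    then show ?thesis using assms(2)[of x] by simp
  qed
  then show ?thesis using that[of "\<bar>B\<bar>"] by simp
qed

lemma partial_zero_outside:
  fixes f :: "'a::euclidean_space \<Rightarrow> real"
  assumes "closed S" "\<And>x. x \<notin> S \<Longrightarrow> f x = 0" "x \<notin> S"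
  shows "partial b f x = 0"
proof (rule partial_eqI)
  have "((\<lambda>x. 0) has_derivative (\<lambda>_. 0)) (at x)" by simp
  then show "(f has_derivative (\<lambda>_. 0)) (at x)"
    by (rule has_derivative_transform_within_open[of _ _ _ _ "- S"]) (use assms in auto)
qed

lemma laplacian_zero_outside:
  fixes f :: "'a::euclidean_space \<Rightarrow> real"
  assumes "closed S" "\<And>x. x \<notin> S \<Longrightarrow> f x = 0" "x \<notin> S"
  shows "laplacian f x = 0"
proof -
  have "partial b (partial b f) x = 0" for b
    by (rule partial_zero_outside[OF assms(1) partial_zero_outside[OF assms(1,2)] assms(3)])
  then show ?thesis by (simp add: laplacian_def)
qed

section \<open>Bump functions and mean values\<close>

definition bump :: "real \<Rightarrow> 'a::euclidean_space \<Rightarrow> 'a \<Rightarrow> real" where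
  "bump r a x = flat 0 (1 - sqd r a x)"

definition ker :: "real \<Rightarrow> 'a::euclidean_space \<Rightarrow> 'a \<Rightarrow> real" where
  "ker r a x = flat 2 (1 - sqd r a x)"

definition dflat2 :: "real \<Rightarrow> real" where
  "dflat2 t = flat 4 t - 2 * flat 3 t"

lemma flat0_derivative: "(flat 0 has_real_derivative flat 2 t) (at t)"
  using flat_has_derivative[of 0 t] by (simp add: numeral_2_eq_2)

lemma flat2_derivative: "(flat 2 has_real_derivative dflat2 t) (at t)"
  using flat_has_derivative[of 2 t] by (simp add: dflat2_def eval_nat_numeral)

lemma smooth_bump: "smooth (bump r a)"
  unfolding bump_def[abs_def] by (intro smooth_compose[OF smooth_flat] smooth_diff smooth_const smooth_sqd)

lemma smooth_ker: "smooth (ker r a)"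
  unfolding ker_def[abs_def] by (intro smooth_compose[OF smooth_flat] smooth_diff smooth_const smooth_sqd)

lemma sqd_less_1: "r > 0 \<Longrightarrow> sqd r a x < 1 \<longleftrightarrow> dist a x < r"
  using power_strict_mono[of "norm (x - a)" r 2] power2_less_imp_less[of "norm (x - a)" r]
  by (auto simp: sqd_norm dist_norm norm_minus_commute)

lemma bump_zero: "r > 0 \<Longrightarrow> x \<notin> ball a r \<Longrightarrow> bump r a x = 0"
  using sqd_less_1[of r a x] by (simp add: bump_def flat_zero)
lemma ker_zero: "r > 0 \<Longrightarrow> x \<notin> ball a r \<Longrightarrow> ker r a x = 0"
  using sqd_less_1[of r a x] by (simp add: ker_def flat_zero)
lemma ker_pos: "r > 0 \<Longrightarrow> x \<in> ball a r \<Longrightarrow> ker r a x > 0"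
  using sqd_less_1[of r a x] by (simp add: ker_def flat_pos)
lemma bump_pos: "r > 0 \<Longrightarrow> x \<in> ball a r \<Longrightarrow> bump r a x > 0"
  using sqd_less_1[of r a x] by (simp add: bump_def flat_pos)
lemma ker_nonneg: "ker r a x \<ge> 0" by (simp add: ker_def flat_nonneg)
lemma bump_nonneg: "bump r a x \<ge> 0" by (simp add: bump_def flat_nonneg)

lemma test_functionI:
  fixes f :: "'a::euclidean_space \<Rightarrow> real"
  assumes "smooth f" "compact S" "S \<subseteq> \<Omega>" "\<And>x. x \<notin> S \<Longrightarrow> f x = 0"
  shows "test_function \<Omega> f"
proof -
  have "{x. f x \<noteq> 0} \<subseteq> S" using assms(4) by auto
  then have c: "closure {x. f x \<noteq> 0} \<subseteq> S" using assms(2) by (simp add: closure_minimal compact_imp_closed)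
  moreover have "compact (closure {x. f x \<noteq> 0})"
    using c assms(2) by (metis bounded_subset closed_closure compact_eq_bounded_closed)
  ultimately show ?thesis using assms unfolding test_function_def smooth_def by auto
qed

lemma test_function_bump:
  assumes "r > 0" "cball a r \<subseteq> \<Omega>" shows "test_function \<Omega> (bump r a)"
  by (rule test_functionI[OF smooth_bump compact_cball assms(2)]) (use assms(1) in \<open>auto simp: bump_zero\<close>)

lemma laplacian_bump:
  fixes a :: "'a::euclidean_space"
  assumes "r \<noteq> 0"
  shows "laplacian (bump r a) x
    = (4 * sqd r a x * dflat2 (1 - sqd r a x) - 2 * real DIM('a) * ker r a x) / r\<^sup>2"
proof -
  have "smooth (\<lambda>t::real. t)" by (rule smooth_linear) simp
  then have 1: "smooth (\<lambda>t. flat 0 (1 - t))" by (intro smooth_compose[OF smooth_flat] smooth_diff smooth_const)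
  have d: "((\<lambda>t::real. 1 - t) has_real_derivative -1) (at t)" for t
    by (auto intro!: derivative_eq_intros)
  have 2: "((\<lambda>t. flat 0 (1 - t)) has_real_derivative - flat 2 (1 - t)) (at t)" for t
    using DERIV_chain2[OF flat0_derivative d] by simp
  have 3: "((\<lambda>t. - flat 2 (1 - t)) has_real_derivative dflat2 (1 - t)) (at t)" for t
    using DERIV_minus[OF DERIV_chain2[OF flat2_derivative d]] by simp
  show ?thesis unfolding bump_def[abs_def] by (subst laplacian_radial[OF 1 2 3 assms]) (simp add: ker_def)
qed

lemma laplacian_bump_zero: "r > 0 \<Longrightarrow> x \<notin> cball a r \<Longrightarrow> laplacian (bump r a) x = 0"
  by (rule laplacian_zero_outside[of "cball a r"]) (auto simp: bump_zero)

lemma integrable_smooth_mult: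
  assumes "locbdd v" "smooth f" "\<And>x. x \<notin> cball a R \<Longrightarrow> f x = 0"
  shows "integrable lborel (\<lambda>x. v x * f x)"
  by (rule locbdd_integrable[OF locbdd_mult[OF assms(1) locbdd_continuous[OF smooth_continuous[OF assms(2)]]], where a = a and R = R])
    (use assms(3) in auto)

lemma integrable_ker: "locbdd v \<Longrightarrow> r > 0 \<Longrightarrow> integrable lborel (\<lambda>x. v x * ker r a x)"
  by (rule integrable_smooth_mult[OF _ smooth_ker, where a = a and R = r]) (auto simp: ker_zero)

lemma DERIV_ker:
  assumes "r > 0"
  shows "((\<lambda>r. ker r a x) has_real_derivative dflat2 (1 - sqd r a x) * (2 * sqd r a x / r)) (at r)"
proof -
  have "((\<lambda>r. 1 - sqd r a x) has_real_derivative 2 * sqd r a x / r) (at r)"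
    unfolding sqd_def using assms
    by (auto intro!: derivative_eq_intros simp: field_simps power2_eq_square)
  from DERIV_chain2[OF flat2_derivative this] show ?thesis unfolding ker_def .
qed

lemma dflat2_bounded: obtains C where "C \<ge> 0" "\<And>t. t \<le> 1 \<Longrightarrow> \<bar>dflat2 t\<bar> \<le> C"
proof -
  have "continuous_on UNIV dflat2"
    unfolding dflat2_def[abs_def] by (intro smooth_continuous smooth_diff smooth_mult smooth_const smooth_flat)
  then have "compact (dflat2 ` {0..1})" using compact_continuous_image continuous_on_subset by blast
  then obtain B where B: "\<forall>y \<in> dflat2 ` {0..1}. norm y \<le> B" using compact_imp_bounded bounded_iff by blast
  have "\<bar>dflat2 t\<bar> \<le> \<bar>B\<bar>" if "t \<le> 1" for t
  proof (cases "t \<ge> 0")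
    case True
    then have "norm (dflat2 t) \<le> B" using B that by auto
    then show ?thesis by simp
  qed (simp add: dflat2_def flat_zero)
  then show ?thesis using that[of "\<bar>B\<bar>"] by simp
qed

text \<open>
  The profile of \<open>ker\<close> is minus the derivative of the profile of \<open>bump\<close>. This makes the \<open>r\<close>-derivative
  of the normalized kernel the Laplacian of a test function, so that one identity serves for
  mean values, for monotonicity of averages and for the scaling argument in the Green identity.
\<close>

lemma DERIV_mean:
  fixes v :: "'a::euclidean_space \<Rightarrow> real"
  assumes "locbdd v" "r > 0"
  shows "((\<lambda>r. (LINT w|lborel. v w * ker r a w) / r ^ DIM('a)) has_real_derivative
    (r / (2 * r ^ DIM('a))) * (LINT w|lborel. v w * laplacian (bump r a) w)) (at r)"
proof -
  define S where "S = cball a (2 * r)"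
  \<comment> \<open>The truncation makes \<open>v\<close> integrable, and kernels with radius below
    \<open>2 * r\<close> do not see it.\<close>
  define v' where "v' w = indicator S w * v w" for w
  define D where "D r w = dflat2 (1 - sqd r a w) * (2 * sqd r a w / r)" for r w
  have iv': "integrable lborel v'" unfolding v'_def S_def by (rule locbdd_integrable_ball[OF assms(1)])
  have cflat: "continuous_on UNIV (flat j)" for j by (intro smooth_continuous smooth_flat)
  have cd: "continuous_on UNIV dflat2"
    unfolding dflat2_def[abs_def] by (intro smooth_continuous smooth_diff smooth_mult smooth_const smooth_flat)
  have mk [measurable]: "ker t a \<in> borel_measurable lborel" for t
    using smooth_continuous[OF smooth_ker] borel_measurable_continuous_onI by auto
  have "continuous_on UNIV (D t)" for t
    unfolding D_def
    by (cases "t = 0") (auto intro!: continuous_intros continuous_on_compose2[OF cd] continuous_on_subset[OF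
      smooth_continuous[OF smooth_sqd]])
  then have mD [measurable]: "D t \<in> borel_measurable lborel" for t
    using borel_measurable_continuous_onI by auto
  obtain C where C: "C \<ge> 0" "\<And>t. t \<le> 1 \<Longrightarrow> \<bar>dflat2 t\<bar> \<le> C" using dflat2_bounded by blast
  have Db: "\<bar>D t w\<bar> \<le> 4 * C / r" if "t > r / 2" for t w
  proof (cases "sqd t a w \<le> 1")
    case True
    have t: "t > 0" using that assms by simp
    have "\<bar>D t w\<bar> = \<bar>dflat2 (1 - sqd t a w)\<bar> * (2 * sqd t a w / t)"
      using t sqd_nonneg[of t a w] by (simp add: D_def abs_mult)
    also have "\<dots> \<le> C * (2 * 1 / (r / 2))"
      using True C that assms t sqd_nonneg[of t a w]
      by (intro mult_mono frac_le) auto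
    finally show ?thesis by (simp add: mult.commute)
  next
    case False
    then show ?thesis using C assms by (simp add: D_def dflat2_def flat_zero)
  qed
  obtain B where B: "\<And>s. s \<in> {0..1} \<Longrightarrow> flat 2 s \<le> B"
  proof -
    have "compact (flat 2 ` {0..1})"
      by (rule compact_continuous_image[OF continuous_on_subset[OF cflat]]) auto
    then obtain B where B: "\<forall>y \<in> flat 2 ` {0..1}. norm y \<le> B" using compact_imp_bounded bounded_iff by blast
    have "flat 2 s \<le> B" if "s \<in> {0..1}" for s
      using bspec[OF B imageI[OF that]] by simp
    then show ?thesis using that by blast
  qed
  have kb: "\<bar>ker t a w\<bar> \<le> max B 0" for t w
    using B[of "1 - sqd t a w"] sqd_nonneg[of t a w] flat_nonneg[of 2 "1 - sqd t a w"] flat_zero[of "1 - sqd t a w" 2]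
    by (cases "sqd t a w \<le> 1") (auto simp: ker_def)
  have der: "((\<lambda>t. LINT w|lborel. v' w * ker t a w) has_derivative (\<lambda>h. LINT w|lborel. v' w * (D r w * h))) (at r)"
  proof (rule has_derivative_lint[OF iv', where r = "r / 2" and C = "4 * C / r" and B = "max B 0" and D = "\<lambda>t w h. D t w * h"])
    fix t w assume "t \<in> ball r (r / 2)"
    then have t: "t > r / 2" by (auto simp: dist_real_def abs_if split: if_splits)
    then have "((\<lambda>t. ker t a w) has_real_derivative D t w) (at t)"
      unfolding D_def using assms(2) by (intro DERIV_ker) simp
    then show "((\<lambda>t. ker t a w) has_derivative (*) (D t w)) (at t)" by (simp add: has_field_derivative_def)
    show "\<bar>D t w * h\<bar> \<le> 4 * C / r * norm h" for h
      unfolding abs_mult real_norm_def by (rule mult_right_mono[OF Db[OF t]]) simp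
    show "\<bar>ker t a w\<bar> \<le> max B 0" by (rule kb)
  qed (use assms in auto)
  have "(\<lambda>h. LINT w|lborel. v' w * (D r w * h)) = (*) (LINT w|lborel. v' w * D r w)"
    by (rule ext) (simp add: mult.assoc[symmetric])
  with der have d1: "((\<lambda>t. LINT w|lborel. v' w * ker t a w) has_real_derivative (LINT w|lborel. v' w * D r w)) (at r)"
    by (simp add: has_field_derivative_def)
  have d2: "((\<lambda>t. LINT w|lborel. v w * ker t a w) has_real_derivative (LINT w|lborel. v' w * D r w)) (at r)"
  proof (rule has_field_derivative_transform_within_open[OF d1, of "{0<..<2*r}"])
    fix t assume t: "t \<in> {0<..<2*r}"
    have "v' w * ker t a w = v w * ker t a w" for w
      using ker_zero[of t w a] t by (cases "w \<in> ball a t") (auto simp: v'_def S_def)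
    then show "(LINT w|lborel. v' w * ker t a w) = (LINT w|lborel. v w * ker t a w)"
      by (rule Bochner_Integration.integral_cong[OF refl])
  qed (use assms in auto)
  have il: "integrable lborel (\<lambda>w. v w * laplacian (bump r a) w)"
    by (rule integrable_smooth_mult[OF assms(1) smooth_laplacian[OF smooth_bump], where a = a and R = r])
      (use laplacian_bump_zero assms in blast)
  note ik = integrable_ker[OF assms, of a]
  \<comment> \<open>By \<open>laplacian_bump\<close>, the radius derivative of the kernel is a
    multiple of the Laplacian of the bump plus N/r times the kernel, N being the dimension. The
    second term cancels against the derivative of the normalizing power of \<open>r\<close>.\<close>
  have eq: "v' w * D r w = (r / 2) * (v w * laplacian (bump r a) w) + (real DIM('a) / r) * (v w * ker r a w)" for w
  proof (cases "w \<in> S")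
    case True
    then show ?thesis using assms(2)
      by (simp add: v'_def laplacian_bump D_def field_simps power2_eq_square)
  next
    case False
    then have "laplacian (bump r a) w = 0" "ker r a w = 0"
      using laplacian_bump_zero[of r w a] ker_zero[of r w a] assms(2) by (auto simp: S_def)
    then show ?thesis using False by (simp add: v'_def)
  qed
  have e2: "(LINT w|lborel. v' w * D r w) = (r / 2) * (LINT w|lborel. v w * laplacian (bump r a) w)
      + (real DIM('a) / r) * (LINT w|lborel. v w * ker r a w)"
    unfolding eq using il ik by simp
  have "((\<lambda>r. (LINT w|lborel. v w * ker r a w) / r ^ DIM('a)) has_real_derivative
      ((LINT w|lborel. v' w * D r w) * r ^ DIM('a) - (LINT w|lborel. v w * ker r a w) * (real DIM('a) * r ^ (DIM('a) - 1)))
        / (r ^ DIM('a) * r ^ DIM('a))) (at r)"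
    using assms(2) by (auto intro!: derivative_eq_intros d2)
  moreover have "((LINT w|lborel. v' w * D r w) * r ^ DIM('a) - (LINT w|lborel. v w * ker r a w) * (real DIM('a) * r ^ (DIM('a) - 1)))
        / (r ^ DIM('a) * r ^ DIM('a)) = (r / (2 * r ^ DIM('a))) * (LINT w|lborel. v w * laplacian (bump r a) w)"
  proof -
    have "r ^ (DIM('a) - 1) = r ^ DIM('a) / r" using assms(2) by (simp add: power_diff)
    then show ?thesis unfolding e2 using assms(2) by (simp add: field_simps)
  qed
  ultimately show ?thesis by simp
qed

lemma mean_rescale:
  fixes v :: "'a::euclidean_space \<Rightarrow> real"
  assumes "locbdd v" "r > 0"
  shows "(LINT w|lborel. v w * ker r a w) / r ^ DIM('a) = (LINT z|lborel. v (a + r *\<^sub>R z) * ker 1 0 z)"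
proof -
  have m: "(\<lambda>w. v w * ker r a w) \<in> borel_measurable borel"
    by (rule locbdd_measurable[OF locbdd_mult[OF assms(1) locbdd_continuous[OF smooth_continuous[OF smooth_ker]]]])
  have "ker r a (a + r *\<^sub>R z) = ker 1 0 z" for z using assms(2) by (simp add: ker_def sqd_def power2_eq_square)
  then show ?thesis using assms(2) by (subst lint_affine[OF _ m, of r a]) auto
qed

definition kmass :: "'a::euclidean_space itself \<Rightarrow> real" where
  "kmass _ = (LINT z::'a|lborel. ker 1 0 z)"

lemma integrable_ker1: "r > 0 \<Longrightarrow> integrable lborel (ker r a)"
  using integrable_ker[OF locbdd_continuous[of "\<lambda>_. 1"], of r a] by simp

text \<open>A nonnegative function with zero integral vanishes almost everywhere, but a nonempty
  open set is not null.\<close>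

lemma lint_pos_open:
  fixes f :: "'a::euclidean_space \<Rightarrow> real"
  assumes "integrable lborel f" "\<And>x. f x \<ge> 0" "open S" "S \<noteq> {}" "\<And>x. x \<in> S \<Longrightarrow> f x > 0"
  shows "(LINT x|lborel. f x) > 0"
proof (rule ccontr)
  assume "\<not> ?thesis"
  moreover have "(LINT x|lborel. f x) \<ge> 0"
    by (rule Bochner_Integration.integral_nonneg) (rule assms(2))
  ultimately have "(LINT x|lborel. f x) = 0" by linarith
  then have "AE x in lborel. f x = 0"
    using integral_nonneg_eq_0_iff_AE[OF assms(1)] assms(2) by auto
  then have "AE x in lborel. x \<notin> S" by (rule AE_mp) (use assms(5) in \<open>force intro!: AE_I2\<close>)
  then have "emeasure lborel S = 0"
    by (subst (asm) AE_iff_measurable[OF _ refl]) (use assms(3) in auto)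
  then have "S \<in> null_sets lborel" using assms(3) by (simp add: null_sets_def)
  then have "negligible S" by (simp add: negligible_iff_null_sets null_sets_completionI)
  then show False using open_not_negligible[OF assms(3,4)] by simp
qed

lemma lint_pos:
  fixes f :: "'a::euclidean_space \<Rightarrow> real"
  assumes "continuous_on UNIV f" "integrable lborel f" "\<And>x. f x \<ge> 0" "f x0 > 0"
  shows "(LINT x|lborel. f x) > 0"
proof (rule lint_pos_open[OF assms(2,3), where S = "{x. f x > 0}"])
  show "open {x. f x > 0}" using assms(1) by (intro open_Collect_less) auto
qed (use assms(4) in auto)

lemma kmass_pos: "kmass TYPE('a::euclidean_space) > 0"
  unfolding kmass_def
  by (rule lint_pos[where ?x0.0 = 0]) (auto intro: smooth_continuous smooth_ker integrable_ker1 ker_nonneg ker_pos)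

text \<open>After rescaling, the kernel no longer depends on the radius and only the argument of
  \<open>v\<close> moves, so continuity at \<open>a\<close> and dominated convergence
  suffice.\<close>

lemma mean_tendsto:
  fixes v :: "'a::euclidean_space \<Rightarrow> real"
  assumes "continuous_on UNIV v" "r \<longlonglongrightarrow> 0" "\<And>i. r i > 0"
  shows "(\<lambda>i. (LINT w|lborel. v w * ker (r i) a w) / (r i) ^ DIM('a)) \<longlonglongrightarrow> kmass TYPE('a) * v a"
proof -
  have lb: "locbdd v" using locbdd_continuous[OF assms(1)] .
  obtain R where R: "\<And>i. \<bar>r i\<bar> \<le> R" using convergent_imp_Bseq[of r] assms(2) unfolding Bseq_def convergent_def by auto
  obtain B where B: "\<forall>x. norm x \<le> norm a + R \<longrightarrow> \<bar>v x\<bar> \<le> B" using lb unfolding locbdd_def by metis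
  have "(\<lambda>i. (LINT z|lborel. v (a + r i *\<^sub>R z) * ker 1 0 z)) \<longlonglongrightarrow> (LINT z|lborel. v a * ker 1 (0::'a) z)"
  proof (rule integral_dominated_convergence[where w = "\<lambda>z. B * ker 1 0 z"])
    have c: "continuous_on UNIV (\<lambda>z. v (a + t *\<^sub>R z) * ker 1 0 z)" for t
      by (intro continuous_intros continuous_on_compose2[OF assms(1)] smooth_continuous smooth_ker) auto
    show "(\<lambda>z. v (a + r i *\<^sub>R z) * ker 1 0 z) \<in> borel_measurable lborel" for i
      using borel_measurable_continuous_onI[OF c] by simp
    show "(\<lambda>z::'a. v a * ker 1 0 z) \<in> borel_measurable lborel"
      using borel_measurable_continuous_onI[OF c[of 0]] by simp
    show "integrable lborel (\<lambda>z::'a. B * ker 1 0 z)" by (intro integrable_mult_right integrable_ker1) simp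
    show "AE z in lborel. (\<lambda>i. v (a + r i *\<^sub>R z) * ker 1 0 z) \<longlonglongrightarrow> v a * ker 1 0 z"
    proof (rule AE_I2)
      fix z
      have "(\<lambda>i. a + r i *\<^sub>R z) \<longlonglongrightarrow> a + 0 *\<^sub>R z" by (intro tendsto_intros assms)
      then have "(\<lambda>i. a + r i *\<^sub>R z) \<longlonglongrightarrow> a" by simp
      then have "(\<lambda>i. v (a + r i *\<^sub>R z)) \<longlonglongrightarrow> v a"
        by (rule isCont_tendsto_compose[rotated]) (use assms(1) continuous_on_eq_continuous_at in blast)
      then show "(\<lambda>i. v (a + r i *\<^sub>R z) * ker 1 0 z) \<longlonglongrightarrow> v a * ker 1 0 z" by (intro tendsto_intros)
    qed
    show "AE z in lborel. norm (v (a + r i *\<^sub>R z) * ker 1 0 z) \<le> B * ker 1 0 z" for i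
    proof (rule AE_I2)
      fix z :: 'a
      show "norm (v (a + r i *\<^sub>R z) * ker 1 0 z) \<le> B * ker 1 0 z"
      proof (cases "z \<in> ball 0 1")
        case True
        have "norm (a + r i *\<^sub>R z) \<le> norm a + \<bar>r i\<bar> * norm z" by (metis norm_scaleR norm_triangle_ineq)
        also have "\<bar>r i\<bar> * norm z \<le> \<bar>r i\<bar> * 1" using True by (intro mult_left_mono) auto
        also have "\<dots> \<le> R" using R by simp
        finally have "\<bar>v (a + r i *\<^sub>R z)\<bar> \<le> B" using B by simp
        then show ?thesis using ker_nonneg[of 1 0 z] by (simp add: abs_mult mult_right_mono)
      qed (simp add: ker_zero)
    qed
  qed
  then show ?thesis using mean_rescale[OF lb assms(3)] by (simp add: kmass_def mult.commute)
qed

lemma set_lint_support: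
  fixes u f :: "'a::euclidean_space \<Rightarrow> real"
  assumes "\<And>x. x \<notin> \<Omega> \<Longrightarrow> f x = 0"
  shows "(LINT x:\<Omega>|lborel. u x * f x) = (LINT x|lborel. u x * f x)"
  unfolding set_lebesgue_integral_def
  by (rule Bochner_Integration.integral_cong) (use assms in \<open>auto split: split_indicator\<close>)

text \<open>By \<open>DERIV_mean\<close> the radius derivative of the average is a positive multiple
  of \<open>u\<close> paired with the Laplacian of a nonnegative test function. The averages
  therefore decrease with the radius, and their limit at radius zero is the value at the centre
  times \<open>kmass\<close>.\<close>

lemma super_mean_value:
  fixes u :: "'a::euclidean_space \<Rightarrow> real"
  assumes "continuous_on UNIV u" "distr_laplacian_le_0_on \<Omega> u" "cball a r \<subseteq> \<Omega>" "r > 0"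
  shows "(LINT w|lborel. u w * ker r a w) / r ^ DIM('a) \<le> kmass TYPE('a) * u a"
proof -
  define A where "A r = (LINT w|lborel. u w * ker r a w) / r ^ DIM('a)" for r
  have lb: "locbdd u" using locbdd_continuous[OF assms(1)] .
  have der: "\<exists>y. (A has_real_derivative y) (at s) \<and> y \<le> 0" if "0 < s" "s \<le> r" for s
  proof (intro exI conjI)
    show "(A has_real_derivative (s / (2 * s ^ DIM('a))) * (LINT w|lborel. u w * laplacian (bump s a) w)) (at s)"
      unfolding A_def by (rule DERIV_mean[OF lb that(1)])
    have sub: "cball a s \<subseteq> \<Omega>" using assms(3) that by auto
    have "test_function \<Omega> (bump s a)" by (rule test_function_bump[OF that(1) sub])
    then have "(LINT x:\<Omega>|lborel. u x * laplacian (bump s a) x) \<le> 0"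
      using assms(2) bump_nonneg unfolding distr_laplacian_le_0_on_def by blast
    moreover have "(LINT x:\<Omega>|lborel. u x * laplacian (bump s a) x) = (LINT x|lborel. u x * laplacian (bump s a) x)"
      by (rule set_lint_support) (use laplacian_bump_zero[OF that(1)] sub in blast)
    ultimately show "(s / (2 * s ^ DIM('a))) * (LINT w|lborel. u w * laplacian (bump s a) w) \<le> 0"
      using that(1) by (intro mult_nonneg_nonpos) auto
  qed
  have mono: "A r \<le> A s" if "0 < s" "s \<le> r" for s
    by (rule DERIV_nonpos_imp_nonincreasing[OF that(2)]) (use der that in auto)
  have "(\<lambda>i. A (r / real (Suc i))) \<longlonglongrightarrow> kmass TYPE('a) * u a"
    unfolding A_def
  proof (rule mean_tendsto[OF assms(1)])
    have "(\<lambda>i. r * inverse (real (Suc i))) \<longlonglongrightarrow> r * 0" by (intro tendsto_intros LIMSEQ_inverse_real_of_nat)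
    then show "(\<lambda>i. r / real (Suc i)) \<longlonglongrightarrow> 0" by (simp add: divide_inverse)
  qed (use assms in auto)
  moreover have "A r \<le> A (r / real (Suc i))" for i
    by (rule mono) (use assms(4) in \<open>auto simp: field_simps\<close>)
  ultimately have "A r \<le> kmass TYPE('a) * u a" by (intro LIMSEQ_le_const) auto
  then show ?thesis by (simp add: A_def)
qed

lemma mean_value:
  fixes u :: "'a::euclidean_space \<Rightarrow> real"
  assumes "continuous_on UNIV u" "distr_laplacian_eq_0_on \<Omega> u" "cball a r \<subseteq> \<Omega>" "r > 0"
  shows "(LINT w|lborel. u w * ker r a w) / r ^ DIM('a) = kmass TYPE('a) * u a"
proof -
  have 1: "distr_laplacian_le_0_on \<Omega> u"
    using assms(2) unfolding distr_laplacian_le_0_on_def distr_laplacian_eq_0_on_def by auto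
  have 2: "distr_laplacian_le_0_on \<Omega> (\<lambda>x. - u x)"
    using assms(2) unfolding distr_laplacian_le_0_on_def distr_laplacian_eq_0_on_def
    by (auto simp: set_lebesgue_integral_def)
  have "continuous_on UNIV (\<lambda>x. - u x)" by (intro continuous_intros assms)
  from super_mean_value[OF this 2 assms(3,4)] super_mean_value[OF assms(1) 1 assms(3,4)]
  show ?thesis by simp
qed

section \<open>Green's identity in the half-space\<close>

abbreviation ey :: "'b::euclidean_space \<times> real" where "ey \<equiv> (0, 1)"

abbreviation upper :: "('b::euclidean_space \<times> real) set" where "upper \<equiv> {x. snd x > 0}"

lemma sum_Basis_times_real:
  fixes f :: "'b::euclidean_space \<times> real \<Rightarrow> 'c::comm_monoid_add"
  shows "sum f Basis = (\<Sum>i\<in>Basis. f (i, 0)) + f ey"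
proof -
  have "inj_on (\<lambda>u. (u::'b, 0::real)) Basis" "inj_on (\<lambda>u. (0::'b, u::real)) Basis"
    by (auto intro!: inj_onI Pair_inject)
  then show ?thesis
    unfolding Basis_prod_def by (subst sum.union_disjoint) (auto simp: Basis_prod_def sum.reindex)
qed

lemma ey_Basis: "ey \<in> Basis" by (simp add: Basis_prod_def)

text \<open>Scaling the last variable alone is what resolves the boundary layer in Green's identity;
  the factor -1 gives reflection in the thin space.\<close>

lemma lint_scale_snd:
  fixes g :: "'b::euclidean_space \<times> real \<Rightarrow> real"
  assumes "c \<noteq> 0" "g \<in> borel_measurable borel"
  shows "(LINT w|lborel. g w) = \<bar>c\<bar> * (LINT z|lborel. g (fst z, c * snd z))"
proof -
  define k where "k j = (if j = (ey :: 'b \<times> real) then c else 1)" for j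
  have T: "0 + (\<Sum>j\<in>Basis. (k j * (x \<bullet> j)) *\<^sub>R j) = (fst x, c * snd x)" for x :: "'b \<times> real"
  proof -
    have "(\<Sum>j\<in>Basis. (k j * (x \<bullet> j)) *\<^sub>R j) = (\<Sum>i\<in>Basis. (fst x \<bullet> i) *\<^sub>R (i, 0)) + (c * snd x) *\<^sub>R (0, 1)"
      unfolding sum_Basis_times_real by (simp add: k_def inner_prod_def)
    also have "\<dots> = (fst x, c * snd x)"
      by (rule prod_eqI) (simp_all add: fst_sum snd_sum euclidean_representation)
    finally show ?thesis by simp
  qed
  have P: "(\<Prod>j\<in>Basis. \<bar>k j\<bar>) = \<bar>c\<bar>"
  proof -
    have "(\<Prod>j\<in>Basis. \<bar>k j\<bar>) = \<bar>k ey\<bar> * (\<Prod>j\<in>Basis - {ey}. \<bar>k j\<bar>)"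
      by (rule prod.remove) (auto simp: ey_Basis)
    also have "(\<Prod>j\<in>Basis - {ey}. \<bar>k j\<bar>) = 1" by (rule prod.neutral) (auto simp: k_def)
    finally show ?thesis by (simp add: k_def)
  qed
  have "k j \<noteq> 0" if "j \<in> Basis" for j using assms(1) by (simp add: k_def)
  from lborel_affine_euclidean[of k 0, OF this, unfolded T P]
  have eq: "lborel = density (distr lborel borel (\<lambda>x::'b \<times> real. (fst x, c * snd x))) (\<lambda>_. ennreal \<bar>c\<bar>)" .
  have m: "(\<lambda>x::'b \<times> real. (fst x, c * snd x)) \<in> borel_measurable borel"
    by (intro borel_measurable_continuous_onI continuous_intros)
  have "(LINT w|lborel. g w) = (LINT w|density (distr lborel borel (\<lambda>x. (fst x, c * snd x))) (\<lambda>_. ennreal \<bar>c\<bar>). g w)"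
    using eq by simp
  also have "\<dots> = (LINT w|distr lborel borel (\<lambda>x. (fst x, c * snd x)). \<bar>c\<bar> * g w)"
    using assms(2) by (subst integral_density) auto
  also have "\<dots> = (LINT z|lborel. \<bar>c\<bar> * g (fst z, c * snd z))"
    using assms(2) m by (subst integral_distr) auto
  finally show ?thesis by simp
qed

lemma lint_product:
  fixes f :: "'b::euclidean_space \<Rightarrow> real" and g :: "real \<Rightarrow> real"
  assumes "integrable lborel (\<lambda>z. f (fst z) * g (snd z))"
  shows "(LINT z|lborel. f (fst z) * g (snd z)) = (LINT x|lborel. f x) * (LINT s|lborel. g s)"
proof -
  have "integrable (lborel \<Otimes>\<^sub>M lborel) (\<lambda>z. f (fst z) * g (snd z))" using assms by (simp add: lborel_prod)
  from lborel_pair.integral_fst'[OF this] show ?thesis by (simp add: lborel_prod)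
qed

lemma has_derivative_snd_compose:
  assumes "(g has_real_derivative d) (at (snd x / c))"
  shows "((\<lambda>x::'b::euclidean_space \<times> real. g (snd x / c)) has_derivative (\<lambda>h. d * (snd h / c))) (at x)"
proof -
  have "((\<lambda>x::'b \<times> real. snd x / c) has_derivative (\<lambda>h. snd h / c)) (at x)"
    by (intro bounded_linear_imp_has_derivative bounded_linear_compose[OF bounded_linear_divide bounded_linear_snd])
  from has_derivative_compose[OF this, of g "(*) d"] assms show ?thesis
    by (simp add: has_field_derivative_def)
qed

lemma smooth_snd: "smooth (\<lambda>x::'b::euclidean_space \<times> real. snd x / c)"
  by (intro smooth_linear bounded_linear_compose[OF bounded_linear_divide bounded_linear_snd])

lemma continuous_thin:
  assumes "continuous_on UNIV f" shows "continuous_on UNIV (\<lambda>x'. f (x', 0::real))"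
  by (rule continuous_on_compose2[OF assms]) (auto intro!: continuous_intros)

lemma norm_thin_le: "norm (x'::'b::euclidean_space) \<le> norm (x', y::real)"
  by (simp add: norm_Pair real_le_rsqrt)

lemma norm_snd_le: "\<bar>y\<bar> \<le> norm (x'::'b::euclidean_space, y::real)"
  by (metis norm_ge_zero norm_snd_le real_norm_def snd_conv)

lemma has_derivative_last:
  fixes \<psi> :: "'b::euclidean_space \<times> real \<Rightarrow> real"
  assumes "smooth \<psi>"
  shows "((\<lambda>y. \<psi> (x', y)) has_real_derivative partial ey \<psi> (x', y)) (at y)"
proof -
  have l: "((\<lambda>y. (x', y)) has_derivative (\<lambda>h. (0, h))) (at y)"
    by (auto intro!: derivative_eq_intros)
  from has_derivative_compose[OF l frechet_derivative_worksI[OF smooth_differentiable[OF assms]]]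
  have "((\<lambda>y. \<psi> (x', y)) has_derivative (\<lambda>h. frechet_derivative \<psi> (at (x', y)) (0, h))) (at y)" .
  moreover have "frechet_derivative \<psi> (at (x', y)) (0, h) = partial ey \<psi> (x', y) * h" for h
  proof -
    have "linear (frechet_derivative \<psi> (at (x', y)))"
      using frechet_derivative_worksI[OF smooth_differentiable[OF assms]] has_derivative_linear by blast
    from linear_scale[OF this, of h ey] show ?thesis by (simp add: partial_def mult.commute)
  qed
  ultimately show ?thesis by (simp add: has_field_derivative_def)
qed

lemma laplacian_cutoff:
  fixes \<psi> :: "'b::euclidean_space \<times> real \<Rightarrow> real"
  assumes "smooth \<psi>" "smooth h" "c \<noteq> 0"
  shows "laplacian (\<lambda>x. h (snd x / c) * \<psi> x) x = h (snd x / c) * laplacian \<psi> x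
    + (2 * partial 1 h (snd x / c) / c * partial ey \<psi> x + partial 1 (partial 1 h) (snd x / c) / c\<^sup>2 * \<psi> x)"
proof -
  define g where "g = partial 1 h"
  have sg: "smooth g" unfolding g_def using smooth_partial[OF assms(2), of 1] by simp
  define H where "H x = h (snd x / c)" for x :: "'b \<times> real"
  have sH: "smooth H" unfolding H_def[abs_def] by (rule smooth_compose[OF assms(2) smooth_snd])
  have pH: "partial b H = (\<lambda>x. g (snd x / c) * (snd b / c))" for b
    unfolding H_def[abs_def] g_def
    by (rule ext, rule partial_eqI[OF has_derivative_snd_compose[OF smooth_real_differentiable[OF assms(2)]]])
  have ppH: "partial b (partial b H) x = partial 1 g (snd x / c) * (snd b / c) * (snd b / c)" for b
  proof -
    have "((\<lambda>x. g (snd x / c) * (snd b / c)) has_derivative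
        (\<lambda>h. (partial 1 g (snd x / c) * (snd h / c)) * (snd b / c))) (at x)"
      by (rule has_derivative_mult_left[OF has_derivative_snd_compose[OF smooth_real_differentiable[OF sg]]])
    from partial_eqI[OF this] show ?thesis unfolding pH .
  qed
  have "laplacian H x = partial 1 g (snd x / c) / c\<^sup>2"
    unfolding laplacian_def ppH sum_Basis_times_real by (simp add: power2_eq_square)
  moreover have "(\<Sum>b\<in>Basis. partial b H x * partial b \<psi> x) = g (snd x / c) / c * partial ey \<psi> x"
    unfolding pH sum_Basis_times_real by simp
  ultimately show ?thesis
    using laplacian_mult[OF sH assms(1), of x] unfolding H_def[symmetric] g_def by simp
qed

text \<open>
  The test function is \<open>h(y/\<epsilon>) \<psi>\<close> with a cutoff \<open>h\<close> that is zero near the thin space, so only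
  harmonicity in the open half-space enters. In the variable \<open>s = y/\<epsilon>\<close> the terms with derivatives of
  \<open>h\<close> converge to the trace integral times \<open>\<integral>(2h' + sh'') ds = 1\<close>.
\<close>

lemma green_half_space:
  fixes u :: "'b::euclidean_space \<times> real \<Rightarrow> real"
  assumes u: "continuous_on UNIV u" "distr_laplacian_eq_0_on \<Omega> u" "upper \<subseteq> \<Omega>"
    and \<psi>: "smooth \<psi>" "\<And>x. x \<notin> cball 0 R \<Longrightarrow> \<psi> x = 0" "\<And>x'. \<psi> (x', 0) = 0"
  shows "(LINT x|lborel. indicator upper x * u x * laplacian \<psi> x)
    = - (LINT x'|lborel. u (x', 0) * partial ey \<psi> (x', 0))"
proof -
  obtain h :: "real \<Rightarrow> real" where h: "smooth h" "\<And>t. t \<le> 1 \<Longrightarrow> h t = 0" "\<And>t. t \<ge> 2 \<Longrightarrow> h t = 1"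
    using smooth_step by blast
  define h1 where "h1 = partial 1 h"
  define h2 where "h2 = partial 1 h1"
  have sh1: "smooth h1" unfolding h1_def using smooth_partial[OF h(1), of 1] by simp
  have sh2: "smooth h2" unfolding h2_def using smooth_partial[OF sh1, of 1] by simp
  have dh: "(h has_real_derivative h1 t) (at t)" for t
    unfolding h1_def by (rule smooth_real_differentiable[OF h(1)])
  have dh1: "(h1 has_real_derivative h2 t) (at t)" for t
    unfolding h2_def by (rule smooth_real_differentiable[OF sh1])
  have h1_lo: "h1 t = 0" if "t < 1" for t
  proof -
    have "(h has_real_derivative 0) (at t)"
      by (rule has_field_derivative_transform_within_open[of "\<lambda>_. 0" _ _ "{..<1}"]) (use that h in auto)
    then show ?thesis unfolding h1_def by (rule partial_real)
  qed
  have h1_hi: "h1 t = 0" if "t > 2" for t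
  proof -
    have "(h has_real_derivative 0) (at t)"
      by (rule has_field_derivative_transform_within_open[of "\<lambda>_. 1" _ _ "{2<..}"]) (use that h in auto)
    then show ?thesis unfolding h1_def by (rule partial_real)
  qed
  have h2_lo: "h2 t = 0" if "t < 1" for t
  proof -
    have "(h1 has_real_derivative 0) (at t)"
      by (rule has_field_derivative_transform_within_open[of "\<lambda>_. 0" _ _ "{..<1}"]) (use that h1_lo in auto)
    then show ?thesis unfolding h2_def by (rule partial_real)
  qed
  have h2_hi: "h2 t = 0" if "t > 2" for t
  proof -
    have "(h1 has_real_derivative 0) (at t)"
      by (rule has_field_derivative_transform_within_open[of "\<lambda>_. 0" _ _ "{2<..}"]) (use that h1_hi in auto)
    then show ?thesis unfolding h2_def by (rule partial_real)
  qed
  have cpt: "\<exists>B\<ge>0. \<forall>t. \<bar>f t\<bar> \<le> B" if "smooth f" "\<And>t::real. t < 1 \<Longrightarrow> f t = 0" "\<And>t. t > 2 \<Longrightarrow> f t = 0" for f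
    by (rule continuous_bounded_support[OF smooth_continuous[OF that(1)], of 0 2]) (use that in \<open>auto simp: dist_real_def\<close>, smt (verit))
  obtain B1 where B1: "B1 \<ge> 0" "\<And>t. \<bar>h1 t\<bar> \<le> B1" using cpt[OF sh1 h1_lo h1_hi] by blast
  obtain B2 where B2: "B2 \<ge> 0" "\<And>t. \<bar>h2 t\<bar> \<le> B2" using cpt[OF sh2 h2_lo h2_hi] by blast
  obtain B0 where B0: "B0 \<ge> 0" "\<And>t. \<bar>h t\<bar> \<le> B0"
  proof -
    have "compact (h ` {0..3})"
      by (rule compact_continuous_image[OF continuous_on_subset[OF smooth_continuous[OF h(1)]]]) auto
    then obtain B where B: "\<forall>y \<in> h ` {0..3}. norm y \<le> B" using compact_imp_bounded bounded_iff by blast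
    have "\<bar>h t\<bar> \<le> max B 1" for t
    proof (cases "t \<in> {0..3}")
      case True
      from bspec[OF B imageI[OF this]] show ?thesis by simp
    next
      case False
      then have "t \<le> 1 \<or> t \<ge> 2" by auto
      then show ?thesis using h(2,3)[of t] by auto
    qed
    then show ?thesis using that[of "max B 1"] by simp
  qed
  define p where "p = partial ey \<psi>"
  have sp: "smooth p" unfolding p_def by (rule smooth_partial[OF \<psi>(1) ey_Basis])
  have p0: "p x = 0" if "x \<notin> cball 0 R" for x
    unfolding p_def by (rule partial_zero_outside[of "cball 0 R"]) (use \<psi>(2) that in auto)
  obtain Bp where Bp: "Bp \<ge> 0" "\<And>x. \<bar>p x\<bar> \<le> Bp"
    using continuous_bounded_support[OF smooth_continuous[OF sp] p0] by blast
  \<comment> \<open>Since \<psi> vanishes on the thin space, it is O(|y|). This absorbs one of the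
    two factors \<open>1 / e i\<close> in front of \<open>h2\<close>; the substitution y =
    \<open>e i\<close> s absorbs the other.\<close>
  have \<psi>b: "\<bar>\<psi> (x', y)\<bar> \<le> Bp * \<bar>y\<bar>" for x' y
  proof -
    have "norm (\<psi> (x', y) - \<psi> (x', 0)) \<le> Bp * norm (y - 0)"
    proof (rule differentiable_bound[of UNIV "\<lambda>y. \<psi> (x', y)" "\<lambda>y. (*) (p (x', y))"])
      show "((\<lambda>y. \<psi> (x', y)) has_derivative (*) (p (x', t))) (at t within UNIV)" for t
        using has_derivative_last[OF \<psi>(1)] by (simp add: p_def has_field_derivative_def)
      show "onorm ((*) (p (x', t))) \<le> Bp" for t
        by (rule onorm_le) (auto simp: abs_mult intro: mult_right_mono Bp)
    qed auto
    then show ?thesis using \<psi>(3) by simp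
  qed
  have lu: "locbdd u" by (rule locbdd_continuous[OF u(1)])
  obtain Bu where Bu: "\<And>x. norm x \<le> \<bar>R\<bar> + 2 \<Longrightarrow> \<bar>u x\<bar> \<le> Bu" using lu unfolding locbdd_def by metis
  have Bu0: "Bu \<ge> 0" using Bu[of 0] by auto
  define e where "e i = inverse (real (Suc i))" for i
  have e: "e i > 0" "e i \<le> 1" for i by (auto simp: e_def field_simps)
  have e0: "e \<longlonglongrightarrow> 0" unfolding e_def by (rule LIMSEQ_inverse_real_of_nat)
  define G where "G i x = 2 * h1 (snd x / e i) / e i * p x + h2 (snd x / e i) / (e i)\<^sup>2 * \<psi> x" for i x
  have sG: "smooth (G i)" for i
    unfolding G_def[abs_def] divide_inverse[of "2 * _"] divide_inverse[of "h2 _"]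
    by (intro smooth_add smooth_mult smooth_const sp \<psi>(1) smooth_compose[OF sh1] smooth_compose[OF sh2] smooth_snd)
  have sL: "smooth (laplacian \<psi>)" by (rule smooth_laplacian[OF \<psi>(1)])
  have L0: "laplacian \<psi> x = 0" if "x \<notin> cball 0 R" for x
    by (rule laplacian_zero_outside[of "cball 0 R"]) (use \<psi>(2) that in auto)
  have sh: "smooth (\<lambda>x. h (snd x / e i))" for i by (rule smooth_compose[OF h(1) smooth_snd])
  have zero: "(LINT x|lborel. u x * (h (snd x / e i) * laplacian \<psi> x)) + (LINT x|lborel. u x * G i x) = 0" for i
  proof -
    define \<tau> where "\<tau> x = h (snd x / e i) * \<psi> x" for x
    have s\<tau>: "smooth \<tau>" unfolding \<tau>_def[abs_def] by (rule smooth_mult[OF sh \<psi>(1)])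
    have \<tau>0: "\<tau> x = 0" if "x \<notin> cball 0 R \<inter> {x. snd x \<ge> e i}" for x
      using that \<psi>(2)[of x] h(2)[of "snd x / e i"] e(1)[of i] by (auto simp: \<tau>_def field_simps not_le less_imp_le)
    have cS: "closed {x :: 'b \<times> real. snd x \<ge> e i}"
      by (intro closed_Collect_le continuous_intros)
    have sub: "cball 0 R \<inter> {x. snd x \<ge> e i} \<subseteq> \<Omega>"
    proof
      fix x :: "'b \<times> real" assume "x \<in> cball 0 R \<inter> {x. snd x \<ge> e i}"
      then have "snd x > 0" using e(1)[of i] by auto
      then show "x \<in> \<Omega>" using u(3) by auto
    qed
    have "test_function \<Omega> \<tau>"
      by (rule test_functionI[OF s\<tau> _ sub \<tau>0]) (use cS in \<open>auto intro: compact_Int_closed\<close>)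
    then have "(LINT x:\<Omega>|lborel. u x * laplacian \<tau> x) = 0" using u(2) unfolding distr_laplacian_eq_0_on_def by blast
    moreover have "(LINT x:\<Omega>|lborel. u x * laplacian \<tau> x) = (LINT x|lborel. u x * laplacian \<tau> x)"
    proof (rule set_lint_support)
      fix x assume "x \<notin> \<Omega>"
      then have "x \<notin> cball 0 R \<inter> {x. snd x \<ge> e i}" using sub by blast
      then show "laplacian \<tau> x = 0" by (rule laplacian_zero_outside[rotated 2]) (use cS \<tau>0 in auto)
    qed
    moreover have "laplacian \<tau> x = h (snd x / e i) * laplacian \<psi> x + G i x" for x
      using laplacian_cutoff[OF \<psi>(1) h(1), of "e i" x] e(1)[of i]
      unfolding \<tau>_def[abs_def] G_def h2_def h1_def p_def by simp
    moreover have "integrable lborel (\<lambda>x. u x * (h (snd x / e i) * laplacian \<psi> x))"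
      by (rule integrable_smooth_mult[OF lu smooth_mult[OF sh sL], of 0 R]) (simp add: L0)
    moreover have "integrable lborel (\<lambda>x. u x * G i x)"
      by (rule integrable_smooth_mult[OF lu sG, of 0 R]) (simp add: G_def p0 \<psi>(2))
    ultimately show ?thesis by (simp add: distrib_left)
  qed
  have oU: "open (upper :: ('b \<times> real) set)" by (intro open_Collect_less continuous_intros)
  have T1: "(\<lambda>i. LINT x|lborel. u x * (h (snd x / e i) * laplacian \<psi> x))
      \<longlonglongrightarrow> (LINT x|lborel. indicator upper x * u x * laplacian \<psi> x)"
  proof (rule integral_dominated_convergence[where w = "\<lambda>x. B0 * \<bar>u x * laplacian \<psi> x\<bar>"])
    show "integrable lborel (\<lambda>x. B0 * \<bar>u x * laplacian \<psi> x\<bar>)"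
      using integrable_smooth_mult[OF lu sL, of 0 R] L0 by (intro integrable_mult_right integrable_abs) auto
    show "AE x in lborel. (\<lambda>i. u x * (h (snd x / e i) * laplacian \<psi> x)) \<longlonglongrightarrow> indicator upper x * u x * laplacian \<psi> x"
    proof (rule AE_I2)
      fix x :: "'b \<times> real"
      have "(\<lambda>i. h (snd x / e i)) \<longlonglongrightarrow> indicator upper x"
      proof (cases "snd x > 0")
        case True
        have "\<forall>\<^sub>F i in sequentially. e i < snd x / 2" using order_tendstoD(2)[OF e0, of "snd x / 2"] True by simp
        then have "\<forall>\<^sub>F i in sequentially. h (snd x / e i) = 1"
          by eventually_elim (use e(1) in \<open>auto intro!: h(3) simp: field_simps\<close>)
        then show ?thesis using True by (simp add: tendsto_eventually)
      next
        case False
        have "h (snd x / e i) = 0" for i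
          by (rule h(2)) (use False e(1)[of i] in \<open>simp add: field_simps\<close>)
        then show ?thesis using False by simp
      qed
      then have "(\<lambda>i. u x * (h (snd x / e i) * laplacian \<psi> x)) \<longlonglongrightarrow> u x * (indicator upper x * laplacian \<psi> x)"
        by (intro tendsto_intros)
      then show "(\<lambda>i. u x * (h (snd x / e i) * laplacian \<psi> x)) \<longlonglongrightarrow> indicator upper x * u x * laplacian \<psi> x"
        by (simp add: mult_ac)
    qed
    show "AE x in lborel. norm (u x * (h (snd x / e i) * laplacian \<psi> x)) \<le> B0 * \<bar>u x * laplacian \<psi> x\<bar>" for i
    proof (rule AE_I2)
      fix x :: "'b \<times> real"
      have "\<bar>h (snd x / e i)\<bar> * \<bar>u x * laplacian \<psi> x\<bar> \<le> B0 * \<bar>u x * laplacian \<psi> x\<bar>"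
        by (rule mult_right_mono[OF B0(2)]) simp
      then show "norm (u x * (h (snd x / e i) * laplacian \<psi> x)) \<le> B0 * \<bar>u x * laplacian \<psi> x\<bar>"
        by (simp add: abs_mult mult_ac)
    qed
    have "upper \<in> sets (borel :: ('b \<times> real) measure)" using oU by (rule borel_open)
    then show "(\<lambda>x. indicator upper x * u x * laplacian \<psi> x) \<in> borel_measurable lborel"
      using locbdd_measurable[OF locbdd_mult[OF locbdd_mult[OF locbdd_indicator lu]
        locbdd_continuous[OF smooth_continuous[OF sL]]]] by simp
    have c: "continuous_on UNIV (\<lambda>x. u x * (h (snd x / e i) * laplacian \<psi> x))" for i
      by (intro continuous_on_mult u(1) smooth_continuous[OF sh] smooth_continuous[OF sL])
    show "(\<lambda>x. u x * (h (snd x / e i) * laplacian \<psi> x)) \<in> borel_measurable lborel" for i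
      using borel_measurable_continuous_onI[OF c] by simp
  qed
  define g where "g i z = u (fst z, e i * snd z) * (2 * h1 (snd z) * p (fst z, e i * snd z)
      + h2 (snd z) / e i * \<psi> (fst z, e i * snd z))" for i and z :: "'b \<times> real"
  have T2eq: "(LINT x|lborel. u x * G i x) = (LINT z|lborel. g i z)" for i
  proof -
    have "(\<lambda>x. u x * G i x) \<in> borel_measurable borel"
      by (rule borel_measurable_continuous_onI) (intro continuous_intros u(1) smooth_continuous[OF sG])
    from lint_scale_snd[OF _ this, of "e i"] e(1)[of i]
    have "(LINT x|lborel. u x * G i x) = (LINT z|lborel. e i * (u (fst z, e i * snd z) * G i (fst z, e i * snd z)))"
      by simp
    also have "\<dots> = (LINT z|lborel. g i z)"
      by (rule Bochner_Integration.integral_cong[OF refl])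
        (use e(1)[of i] in \<open>simp add: g_def G_def field_simps power2_eq_square\<close>)
    finally show ?thesis .
  qed
  define f where "f x' = u (x', 0) * p (x', 0)" for x'
  define q where "q s = 2 * h1 s + h2 s * s" for s :: real
  \<comment> \<open>The derivatives of \<open>h\<close> live on [1, 2] and \<psi> on a ball, so all
    rescaled integrands vanish outside this compact set. The absolute value is there because the
    sign of \<open>R\<close> is not assumed.\<close>
  define K where "K = (cball 0 \<bar>R\<bar> :: 'b set) \<times> {0..2::real}"
  have K: "compact K" unfolding K_def by (intro compact_Times compact_cball compact_Icc)
  have T2: "(\<lambda>i. LINT z|lborel. g i z) \<longlonglongrightarrow> (LINT z|lborel. f (fst z) * q (snd z))"
    and iT2: "integrable lborel (\<lambda>z. f (fst z) * q (snd z))"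
  proof -
    let ?w = "\<lambda>z. indicator K z * (Bu * (2 * B1 * Bp + B2 * (Bp * 2)))"
    have cg: "continuous_on UNIV (g i)" for i
      unfolding g_def using e(1)[of i]
      by (intro continuous_intros continuous_on_compose2[OF u(1)] continuous_on_compose2[OF smooth_continuous[OF sp]]
          continuous_on_compose2[OF smooth_continuous[OF \<psi>(1)]] continuous_on_compose2[OF smooth_continuous[OF sh1]]
          continuous_on_compose2[OF smooth_continuous[OF sh2]]) auto
    have m1: "g i \<in> borel_measurable lborel" for i using borel_measurable_continuous_onI[OF cg] by simp
    have cfq: "continuous_on UNIV (\<lambda>z. f (fst z) * q (snd z))"
      unfolding f_def q_def
      by (intro continuous_intros continuous_on_compose2[OF u(1)] continuous_on_compose2[OF smooth_continuous[OF sp]]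
          continuous_on_compose2[OF smooth_continuous[OF sh1]]
          continuous_on_compose2[OF smooth_continuous[OF sh2]]) auto
    have m2: "(\<lambda>z. f (fst z) * q (snd z)) \<in> borel_measurable lborel"
      using borel_measurable_continuous_onI[OF cfq] by simp
    have iw: "integrable lborel ?w"
      using borel_compact[OF K] emeasure_bounded_finite[OF compact_imp_bounded[OF K]]
      by (intro integrable_mult_left integrable_real_indicator) auto
    have lim: "AE z in lborel. (\<lambda>i. g i z) \<longlonglongrightarrow> f (fst z) * q (snd z)"
    proof (rule AE_I2)
      fix z :: "'b \<times> real"
      obtain x' s where z: "z = (x', s)" by force
      have es: "(\<lambda>i. (x', e i * s)) \<longlonglongrightarrow> (x', 0 * s)" by (intro tendsto_intros e0)
      have c: "(\<lambda>i. k (x', e i * s)) \<longlonglongrightarrow> k (x', 0)" if "continuous_on UNIV k" for k :: "_ \<Rightarrow> real"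
        by (rule isCont_tendsto_compose[rotated]) (use es that continuous_on_eq_continuous_at in \<open>auto\<close>)
      have "((\<lambda>y. \<psi> (x', y)) has_real_derivative p (x', 0)) (at 0)"
        using has_derivative_last[OF \<psi>(1)] by (simp add: p_def)
      then have d: "((\<lambda>y. \<psi> (x', y) / y) \<longlongrightarrow> p (x', 0)) (at 0)"
        unfolding DERIV_def using \<psi>(3) by simp
      have "(\<lambda>i. \<psi> (x', e i * s) / e i) \<longlonglongrightarrow> p (x', 0) * s"
      proof (cases "s = 0")
        case True then show ?thesis using \<psi>(3) by simp
      next
        case False
        have "(\<lambda>i. \<psi> (x', e i * s) / (e i * s)) \<longlonglongrightarrow> p (x', 0)"
          by (rule filterlim_compose[OF d]) (use False e(1) e0 in
            \<open>auto simp: filterlim_at less_imp_neq[symmetric] intro!: tendsto_mult_left_zero always_eventually\<close>)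
        then have "(\<lambda>i. \<psi> (x', e i * s) / (e i * s) * s) \<longlonglongrightarrow> p (x', 0) * s" by (intro tendsto_intros)
        then show ?thesis using False by simp
      qed
      then have "(\<lambda>i. u (x', e i * s) * (2 * h1 s * p (x', e i * s) + h2 s * (\<psi> (x', e i * s) / e i)))
          \<longlonglongrightarrow> u (x', 0) * (2 * h1 s * p (x', 0) + h2 s * (p (x', 0) * s))"
        by (intro tendsto_intros c u(1) smooth_continuous[OF sp])
      then show "(\<lambda>i. g i z) \<longlonglongrightarrow> f (fst z) * q (snd z)"
        unfolding g_def f_def q_def z by (simp add: algebra_simps)
    qed
    have bd: "AE z in lborel. norm (g i z) \<le> ?w z" for i
    proof (rule AE_I2)
      fix z :: "'b \<times> real"
      obtain x' s where z: "z = (x', s)" by force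
      show "norm (g i z) \<le> ?w z"
      proof (cases "z \<in> K")
        case True
        then have x': "norm x' \<le> \<bar>R\<bar>" and s: "0 \<le> s" "s \<le> 2" by (auto simp: K_def z)
        have es: "\<bar>e i * s\<bar> \<le> 2" using e[of i] s mult_mono[of "e i" 1 s 2] by (simp add: abs_mult)
        have "norm (x', e i * s) \<le> norm x' + norm (e i * s)" by (rule norm_Pair_le)
        then have "norm (x', e i * s) \<le> \<bar>R\<bar> + 2" using x' es by simp
        then have 1: "\<bar>u (x', e i * s)\<bar> \<le> Bu" by (rule Bu)
        have "\<bar>\<psi> (x', e i * s)\<bar> / e i \<le> Bp * s"
          using \<psi>b[of x' "e i * s"] e(1)[of i] s by (simp add: abs_mult field_simps)
        also have "\<dots> \<le> Bp * 2" using s Bp(1) by (intro mult_left_mono)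
        finally have 2: "\<bar>\<psi> (x', e i * s)\<bar> / e i \<le> Bp * 2" .
        have 3: "\<bar>2 * h1 s * p (x', e i * s)\<bar> \<le> 2 * B1 * Bp"
          unfolding abs_mult using B1 Bp by (intro mult_mono) auto
        have 4: "\<bar>h2 s\<bar> * (\<bar>\<psi> (x', e i * s)\<bar> / e i) \<le> B2 * (Bp * 2)"
          using B2 Bp 2 e(1)[of i] by (intro mult_mono) auto
        have 5: "\<bar>h2 s / e i * \<psi> (x', e i * s)\<bar> \<le> B2 * (Bp * 2)"
          using 4 e(1)[of i] by (simp add: abs_mult)
        have 6: "\<bar>2 * h1 s * p (x', e i * s) + h2 s / e i * \<psi> (x', e i * s)\<bar> \<le> 2 * B1 * Bp + B2 * (Bp * 2)"
          using 3 5 by linarith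
        have "\<bar>u (x', e i * s)\<bar> * \<bar>2 * h1 s * p (x', e i * s) + h2 s / e i * \<psi> (x', e i * s)\<bar>
           \<le> Bu * (2 * B1 * Bp + B2 * (Bp * 2))"
          by (rule mult_mono[OF 1 6 Bu0]) simp
        then show ?thesis using True by (simp add: g_def z abs_mult)
      next
        case False
        then consider "norm x' > \<bar>R\<bar>" | "s < 1" | "s > 2" by (force simp: K_def z)
        then have "g i z = 0"
        proof cases
          case 1
          then have "(x', e i * s) \<notin> cball 0 R" using norm_thin_le[of x' "e i * s"] by auto
          then show ?thesis by (simp add: g_def z p0 \<psi>(2))
        qed (simp_all add: g_def z h1_lo h2_lo h1_hi h2_hi)
        then show ?thesis using False by simp
      qed
    qed
    show "(\<lambda>i. LINT z|lborel. g i z) \<longlonglongrightarrow> (LINT z|lborel. f (fst z) * q (snd z))"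
      by (rule integral_dominated_convergence[OF m2 m1 iw lim bd])
    show "integrable lborel (\<lambda>z. f (fst z) * q (snd z))"
      by (rule integrable_dominated_convergence[OF m2 m1 iw lim bd])
  qed
  \<comment> \<open>\<open>q\<close> is the derivative of h + s h', which is 0 at s = 0 and 1 at s =
    3, and \<open>q\<close> vanishes outside [1, 2].\<close>
  have "(LINT s|lborel. q s) = 1"
  proof -
    have "((\<lambda>s. h s + h1 s * s) has_real_derivative q s) (at s)" for s
      unfolding q_def by (auto intro!: derivative_eq_intros dh dh1)
    moreover have "isCont q s" for s unfolding q_def
      by (intro continuous_intros smooth_isCont sh1 sh2)
    ultimately have "(LINT s|lborel. q s * indicator {0..3} s) = (h 3 + h1 3 * 3) - (h 0 + h1 0 * 0)"
      by (intro integral_FTC_Icc_real) auto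
    moreover have "q s * indicator {0..3} s = q s" for s
      by (cases "s \<in> {0..3}") (auto simp: q_def h1_lo h2_lo h1_hi h2_hi not_le)
    ultimately show ?thesis using h1_hi[of 3] h(2)[of 0] h(3)[of 3] by simp
  qed
  then have val: "(LINT z|lborel. f (fst z) * q (snd z)) = (LINT x'|lborel. f x')"
    using lint_product[OF iT2] by simp
  have L: "(\<lambda>i. (LINT x|lborel. u x * (h (snd x / e i) * laplacian \<psi> x)) + (LINT x|lborel. u x * G i x))
    \<longlonglongrightarrow> (LINT x|lborel. indicator upper x * u x * laplacian \<psi> x) + (LINT x'|lborel. f x')"
    unfolding T2eq val[symmetric] by (intro tendsto_add T1 T2)
  have "(LINT x|lborel. indicator upper x * u x * laplacian \<psi> x) + (LINT x'|lborel. f x') = 0"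
    by (rule LIMSEQ_unique[OF L[unfolded zero] tendsto_const])
  then show ?thesis unfolding f_def p_def by linarith
qed

section \<open>The frequency identity\<close>

lemma euler_identity:
  fixes P :: "'a::euclidean_space \<Rightarrow> real"
  assumes "P differentiable (at x)" "homogeneous d P"
  shows "(\<Sum>b\<in>Basis. (x \<bullet> b) * partial b P x) = d * P x"
proof -
  have l: "((\<lambda>t::real. t *\<^sub>R x) has_derivative (\<lambda>h. h *\<^sub>R x)) (at 1)"
    by (auto intro!: derivative_eq_intros)
  have "P differentiable (at (1 *\<^sub>R x))" using assms(1) by simp
  from has_derivative_compose[OF l has_derivative_partial[OF this]]
  have "((\<lambda>t. P (t *\<^sub>R x)) has_derivative (\<lambda>h. \<Sum>b\<in>Basis. (h *\<^sub>R x) \<bullet> b * partial b P x)) (at 1)" by simp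
  moreover have "(\<lambda>h. \<Sum>b\<in>Basis. (h *\<^sub>R x) \<bullet> b * partial b P x) = (*) (\<Sum>b\<in>Basis. (x \<bullet> b) * partial b P x)"
    by (rule ext) (simp add: sum_distrib_left sum_distrib_right mult_ac)
  ultimately have 1: "((\<lambda>t. P (t *\<^sub>R x)) has_real_derivative (\<Sum>b\<in>Basis. (x \<bullet> b) * partial b P x)) (at 1)"
    by (simp add: has_field_derivative_def)
  have "((\<lambda>t. t powr d * P x) has_real_derivative d * P x) (at 1)"
    by (auto intro!: derivative_eq_intros)
  then have 2: "((\<lambda>t. P (t *\<^sub>R x)) has_real_derivative d * P x) (at 1)"
    by (rule has_field_derivative_transform_within_open[of _ _ _ "{0<..}"])
      (use assms(2) in \<open>auto simp: homogeneous_def\<close>)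
  show ?thesis by (rule DERIV_unique[OF 1 2])
qed

lemma partial_bump:
  "partial b (bump r a) x = - (2 * ((x - a) \<bullet> b) / r\<^sup>2 * ker r a x)"
proof -
  have d: "((\<lambda>t. flat 0 (1 - t)) has_real_derivative - flat 2 (1 - t)) (at t)" for t
  proof -
    have "((\<lambda>t::real. 1 - t) has_real_derivative -1) (at t)" by (auto intro!: derivative_eq_intros)
    from DERIV_chain2[OF flat0_derivative this] show ?thesis by simp
  qed
  show ?thesis
    unfolding bump_def[abs_def]
    by (subst partial_compose(1)[where g = "\<lambda>t. flat 0 (1 - t)", OF d])
      (simp_all add: partial_sqd smooth_differentiable smooth_sqd ker_def)
qed

lemma frequency_identity:
  fixes u P :: "'b::euclidean_space \<times> real \<Rightarrow> real"
  assumes u: "continuous_on UNIV u" "distr_laplacian_eq_0_on \<Omega> u" "upper \<subseteq> \<Omega>" "homogeneous \<mu> u"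
    and P: "smooth P" "\<And>x. laplacian P x = 0" "homogeneous d P" "\<And>x'. P (x', 0) = 0"
    and "R > 0"
  shows "(LINT x'|lborel. u (x', 0) * (partial ey P (x', 0) * bump R 0 (x', 0 :: real)))
    = 2 / R\<^sup>2 * (d - \<mu>) * (LINT x|lborel. indicator upper x * u x * P x * ker R 0 x)"
proof -
  define v where "v x = indicator upper x * u x * P x" for x
  define \<psi> where "\<psi> x = P x * bump R 0 x" for x
  have oU: "upper \<in> sets (borel :: ('b \<times> real) measure)"
    by (intro borel_open open_Collect_less continuous_intros)
  have lu: "locbdd u" by (rule locbdd_continuous[OF u(1)])
  have lv: "locbdd v" unfolding v_def[abs_def]
    by (intro locbdd_mult locbdd_indicator oU lu locbdd_continuous smooth_continuous P)
  have hom: "v (t *\<^sub>R z) = t powr (\<mu> + d) * v z" if "t > 0" for t z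
  proof -
    have "indicator upper (t *\<^sub>R z) = (indicator upper z :: real)"
      using that by (auto simp: indicator_def zero_less_mult_iff)
    moreover have "u (t *\<^sub>R z) = t powr \<mu> * u z" "P (t *\<^sub>R z) = t powr d * P z"
      using u(4) P(3) that unfolding homogeneous_def by blast+
    ultimately show ?thesis unfolding v_def by (simp only: powr_add mult_ac)
  qed
  define J where "J r = (LINT w|lborel. v w * ker r 0 w)" for r
  define A1 where "A1 = J 1"
  have A: "J r / r ^ DIM('b \<times> real) = r powr (\<mu> + d) * A1" if "r > 0" for r
  proof -
    have "J r / r ^ DIM('b \<times> real) = (LINT z|lborel. v (0 + r *\<^sub>R z) * ker 1 0 z)"
      unfolding J_def by (rule mean_rescale[OF lv that])
    also have "\<dots> = (LINT z|lborel. r powr (\<mu> + d) * (v z * ker 1 0 z))"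
      using hom[OF that] by (simp add: mult.assoc)
    finally show ?thesis by (simp add: A1_def J_def)
  qed
  have d1: "((\<lambda>r. J r / r ^ DIM('b \<times> real)) has_real_derivative
    (R / (2 * R ^ DIM('b \<times> real))) * (LINT w|lborel. v w * laplacian (bump R 0) w)) (at R)"
    unfolding J_def by (rule DERIV_mean[OF lv \<open>R > 0\<close>])
  have "((\<lambda>r. r powr (\<mu> + d) * A1) has_real_derivative (\<mu> + d) * R powr (\<mu> + d - 1) * A1) (at R)"
    using \<open>R > 0\<close> by (auto intro!: derivative_eq_intros)
  then have d2: "((\<lambda>r. J r / r ^ DIM('b \<times> real)) has_real_derivative (\<mu> + d) * R powr (\<mu> + d - 1) * A1) (at R)"
    by (rule has_field_derivative_transform_within_open[of _ _ _ "{0<..}"]) (use A \<open>R > 0\<close> in auto)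
  have "(R / (2 * R ^ DIM('b \<times> real))) * (LINT w|lborel. v w * laplacian (bump R 0) w)
    = (\<mu> + d) * (R powr (\<mu> + d) / R) * A1"
    using DERIV_unique[OF d1 d2] \<open>R > 0\<close> by (simp only: powr_diff powr_one)
  also have "\<dots> = (\<mu> + d) / R * (J R / R ^ DIM('b \<times> real))" using A[OF \<open>R > 0\<close>] by simp
  finally have vL: "(LINT w|lborel. v w * laplacian (bump R 0) w) = 2 * (\<mu> + d) / R\<^sup>2 * J R"
    using \<open>R > 0\<close> by (simp add: field_simps power2_eq_square)
  have L\<psi>: "laplacian \<psi> x = P x * laplacian (bump R 0) x - 4 * d / R\<^sup>2 * (P x * ker R 0 x)" for x
  proof -
    have "(\<Sum>b\<in>Basis. partial b P x * partial b (bump R 0) x)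
      = (- 2 / R\<^sup>2 * ker R 0 x) * (\<Sum>b\<in>Basis. (x \<bullet> b) * partial b P x)"
      unfolding partial_bump sum_distrib_left by (rule sum.cong) auto
    also have "\<dots> = (- 2 / R\<^sup>2 * ker R 0 x) * (d * P x)"
      by (simp add: euler_identity[OF smooth_differentiable[OF P(1)] P(3)])
    finally show ?thesis unfolding \<psi>_def[abs_def] laplacian_mult[OF P(1) smooth_bump] P(2) by simp
  qed
  have i1: "integrable lborel (\<lambda>x. v x * laplacian (bump R 0) x)"
    by (rule integrable_smooth_mult[OF lv smooth_laplacian[OF smooth_bump], where a = 0 and R = R])
      (rule laplacian_bump_zero[OF \<open>R > 0\<close>])
  have i2: "integrable lborel (\<lambda>x. v x * ker R 0 x)" by (rule integrable_ker[OF lv \<open>R > 0\<close>])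
  have "(LINT x|lborel. indicator upper x * u x * laplacian \<psi> x)
     = (LINT x|lborel. v x * laplacian (bump R 0) x - 4 * d / R\<^sup>2 * (v x * ker R 0 x))"
    by (rule Bochner_Integration.integral_cong[OF refl]) (simp add: L\<psi> v_def algebra_simps)
  also have "\<dots> = 2 * (\<mu> + d) / R\<^sup>2 * J R - 4 * d / R\<^sup>2 * J R"
    using i1 i2 by (simp add: vL J_def[symmetric])
  also have "\<dots> = - (2 / R\<^sup>2 * (d - \<mu>) * J R)"
    by (simp add: divide_inverse algebra_simps)
  finally have e1: "(LINT x|lborel. indicator upper x * u x * laplacian \<psi> x) = - (2 / R\<^sup>2 * (d - \<mu>) * J R)" .
  have e2: "(LINT x|lborel. indicator upper x * u x * laplacian \<psi> x)
    = - (LINT x'|lborel. u (x', 0) * partial ey \<psi> (x', 0))"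
  proof (rule green_half_space[OF u(1-3), where R = R])
    show "smooth \<psi>" unfolding \<psi>_def[abs_def] by (intro smooth_mult P smooth_bump)
    show "\<psi> x = 0" if "x \<notin> cball 0 R" for x
    proof -
      have "x \<notin> ball 0 R" using that by auto
      then show ?thesis by (simp add: \<psi>_def bump_zero[OF \<open>R > 0\<close>])
    qed
    show "\<psi> (x', 0) = 0" for x' by (simp add: \<psi>_def P)
  qed
  have "partial ey \<psi> (x', 0) = partial ey P (x', 0) * bump R 0 (x', 0 :: real)" for x'
    unfolding \<psi>_def[abs_def] by (subst partial_mult) (simp_all add: smooth_differentiable P smooth_bump)
  with e1 e2 show ?thesis by (simp add: J_def v_def)
qed

section \<open>Mean values up to a trace error\<close>

lemma flat2_le: "flat 2 t \<le> 2"
proof (cases "t > 0")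
  case True
  have "(1/t)\<^sup>2 / 2 \<le> 1 + 1/t + (1/t)\<^sup>2 / 2" using True by simp
  also have "\<dots> \<le> exp (1/t)" using True by (intro exp_lower_Taylor_quadratic) simp
  finally show ?thesis using True by (simp add: flat_def exp_minus field_simps)
qed (simp add: flat_def)

lemma ker_le: "ker r a x \<le> 2" by (simp add: ker_def flat2_le)

text \<open>
  Subtracting the reflected kernel produces test functions that vanish on the thin space. Their
  normal derivative there is zero as long as the radius is below \<open>y0\<close>, which keeps the Poisson-type
  kernel bounded.
\<close>

lemma half_space_mean:
  fixes u :: "'b::euclidean_space \<times> real \<Rightarrow> real"
  assumes u: "continuous_on UNIV u" "distr_laplacian_eq_0_on \<Omega> u" "upper \<subseteq> \<Omega>" "\<And>x'. u (x', 0) \<ge> 0"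
    and h: "0 < h" "h \<le> 1" "h \<le> y0" and x0: "norm x0 \<le> R"
  shows "\<bar>(LINT w|lborel. indicator upper w * u w * (ker 1 (x0, y0) w - ker 1 (x0, - y0) w))
      - kmass TYPE('b \<times> real) * u (x0, y0)\<bar>
    \<le> 4 / h ^ DIM('b \<times> real) * (LINT x'|lborel. indicator (cball 0 (R + 1)) x' * u (x', 0))"
proof -
  define N where "N = DIM('b \<times> real)"
  define v where "v w = indicator upper w * u w" for w
  have oU: "upper \<in> sets (borel :: ('b \<times> real) measure)"
    by (intro borel_open open_Collect_less continuous_intros)
  have lu: "locbdd u" by (rule locbdd_continuous[OF u(1)])
  have lv: "locbdd v" unfolding v_def[abs_def]
    by (intro locbdd_mult locbdd_indicator oU lu)
  \<comment> \<open>A difference of two averages over the half-space, centred at the point and at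
    its reflection. At a small radius it is a multiple of the value of \<open>u\<close>, at radius 1
    it is the integral in the statement, and its derivative is a trace integral.\<close>
  define M where "M r = (LINT w|lborel. v w * ker r (x0, y0) w) / r ^ N - (LINT w|lborel. v w * ker r (x0, - y0) w) / r ^ N" for r
  define I where "I = (LINT x'|lborel. indicator (cball 0 (R + 1)) x' * u (x', 0))"
  define M' where "M' r = - ((r / (2 * r ^ N)) * (LINT x'|lborel. u (x', 0) * (4 * y0 / r\<^sup>2 * ker r (x0, y0) (x', 0))))" for r
  have y0: "y0 > 0" using h by simp
  have der: "(M has_real_derivative M' r) (at r)" if "r > 0" for r
  proof -
    define \<psi> where "\<psi> x = bump r (x0, y0) x - bump r (x0, - y0) x" for x
    have "(M has_real_derivative (r / (2 * r ^ N)) * (LINT w|lborel. v w * laplacian (bump r (x0, y0)) w)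
        - (r / (2 * r ^ N)) * (LINT w|lborel. v w * laplacian (bump r (x0, -y0)) w)) (at r)"
      unfolding M_def[abs_def] N_def by (intro DERIV_diff DERIV_mean lv that)
    moreover have "(r / (2 * r ^ N)) * (LINT w|lborel. v w * laplacian (bump r (x0, y0)) w)
        - (r / (2 * r ^ N)) * (LINT w|lborel. v w * laplacian (bump r (x0, -y0)) w)
      = (r / (2 * r ^ N)) * (LINT w|lborel. v w * laplacian \<psi> w)"
    proof -
      have "integrable lborel (\<lambda>w. v w * laplacian (bump r a) w)" for a
        by (rule integrable_smooth_mult[OF lv smooth_laplacian[OF smooth_bump], where a = a and R = r])
          (rule laplacian_bump_zero[OF that])
      moreover have "laplacian \<psi> w = laplacian (bump r (x0, y0)) w - laplacian (bump r (x0, - y0)) w" for w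
        unfolding \<psi>_def[abs_def] by (intro laplacian_diff smooth_bump)
      ultimately show ?thesis by (simp add: right_diff_distrib)
    qed
    moreover have "(LINT w|lborel. v w * laplacian \<psi> w) = - (LINT x'|lborel. u (x', 0) * partial ey \<psi> (x', 0))"
      unfolding v_def
    proof (rule green_half_space[OF u(1-3), where R = "norm x0 + y0 + r"])
      show "smooth \<psi>" unfolding \<psi>_def[abs_def] by (intro smooth_diff smooth_bump)
      show "\<psi> x = 0" if x: "x \<notin> cball 0 (norm x0 + y0 + r)" for x
      proof -
        have "x \<notin> ball a r" if "norm a \<le> norm x0 + y0" for a
          using that x norm_triangle_sub[of x a] by (auto simp: dist_norm norm_minus_commute)
        moreover have "norm (x0, y0) \<le> norm x0 + y0" "norm (x0, - y0) \<le> norm x0 + y0"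
          using norm_Pair_le[of x0 y0] norm_Pair_le[of x0 "-y0"] y0 by auto
        ultimately have "x \<notin> ball (x0, y0) r" "x \<notin> ball (x0, - y0) r" by blast+
        then show ?thesis unfolding \<psi>_def by (simp add: bump_zero[OF \<open>r > 0\<close>] del: mem_ball)
      qed
      show "\<psi> (x', 0) = 0" for x' by (simp add: \<psi>_def bump_def sqd_def)
    qed
    moreover have "partial ey \<psi> (x', 0) = 4 * y0 / r\<^sup>2 * ker r (x0, y0) (x', 0)" for x'
    proof -
      have "partial ey \<psi> (x', 0) = partial ey (bump r (x0, y0)) (x', 0) + partial ey (\<lambda>x. (- 1) * bump r (x0, - y0) x) (x', 0)"
        unfolding \<psi>_def[abs_def] using partial_add[of "bump r (x0, y0)" "(x', 0)" "\<lambda>x. (- 1) * bump r (x0, - y0) x" ey]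
        by (simp add: smooth_differentiable smooth_bump smooth_minus)
      also have "partial ey (\<lambda>x. (- 1) * bump r (x0, - y0) x) (x', 0) = - partial ey (bump r (x0, - y0)) (x', 0)"
        by (subst partial_mult) (simp_all add: smooth_differentiable smooth_bump partial_eqI[OF has_derivative_const])
      finally show ?thesis unfolding partial_bump by (simp add: ker_def sqd_def field_simps)
    qed
    ultimately show ?thesis by (simp add: M'_def)
  qed
  have iI: "integrable lborel (\<lambda>x'. indicator (cball 0 (R + 1)) x' * u (x', 0))"
    by (rule locbdd_integrable_ball[OF locbdd_continuous[OF continuous_thin[OF u(1)]]])
  have I0: "I \<ge> 0" unfolding I_def
    by (rule Bochner_Integration.integral_nonneg) (simp add: u(4))
  have bd: "\<bar>M' r\<bar> \<le> 4 / h ^ N * I" if r: "r > 0" "r \<le> 1" for r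
  proof (cases "r \<le> y0")
    case True
    have "ker r (x0, y0) (x', 0) = 0" for x'
      by (rule ker_zero[OF r(1)])
        (use True norm_snd_le[of y0 "x0 - x'"] in \<open>auto simp: dist_norm\<close>)
    then have "M' r = 0" by (simp add: M'_def)
    then show ?thesis using I0 h by simp
  next
    case False
    then have hr: "h \<le> r" using h by simp
    have "\<bar>LINT x'|lborel. u (x', 0) * (4 * y0 / r\<^sup>2 * ker r (x0, y0) (x', 0))\<bar> \<le>
       (LINT x'|lborel. norm (u (x', 0) * (4 * y0 / r\<^sup>2 * ker r (x0, y0) (x', 0))))"
      using integral_norm_bound[of lborel "\<lambda>x'. u (x', 0) * (4 * y0 / r\<^sup>2 * ker r (x0, y0) (x', 0))"] by simp
    also have "\<dots> \<le> (LINT x'|lborel. 8 / r * (indicator (cball 0 (R + 1)) x' * u (x', 0)))"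
    proof (rule integral_mono_AE')
      show "integrable lborel (\<lambda>x'. 8 / r * (indicator (cball 0 (R + 1)) x' * u (x', 0)))"
        using iI by (rule integrable_mult_right)
      show "AE x' in lborel. norm (u (x', 0) * (4 * y0 / r\<^sup>2 * ker r (x0, y0) (x', 0)))
          \<le> 8 / r * (indicator (cball 0 (R + 1)) x' * u (x', 0))"
      proof (rule AE_I2)
        fix x' :: 'b
        show "norm (u (x', 0) * (4 * y0 / r\<^sup>2 * ker r (x0, y0) (x', 0)))
          \<le> 8 / r * (indicator (cball 0 (R + 1)) x' * u (x', 0))"
        proof (cases "x' \<in> cball 0 (R + 1)")
          case True
          \<comment> \<open>In this case y0 < r, so the normal derivative of the test function is at
            most 8/r.\<close>
          have "4 * y0 / r\<^sup>2 * ker r (x0, y0) (x', 0) \<le> 4 * r / r\<^sup>2 * 2"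
            using False y0 r ker_le ker_nonneg by (intro mult_mono divide_right_mono) auto
          also have "\<dots> = 8 / r" using r by (simp add: power2_eq_square)
          finally have "4 * y0 / r\<^sup>2 * ker r (x0, y0) (x', 0) \<le> 8 / r" .
          moreover have "4 * y0 / r\<^sup>2 * ker r (x0, y0) (x', 0) \<ge> 0" using y0 by (simp add: ker_nonneg)
          ultimately have "u (x', 0) * (4 * y0 / r\<^sup>2 * ker r (x0, y0) (x', 0)) \<le> u (x', 0) * (8 / r)"
            "0 \<le> u (x', 0) * (4 * y0 / r\<^sup>2 * ker r (x0, y0) (x', 0))"
            using u(4)[of x'] by (blast intro: mult_left_mono mult_nonneg_nonneg)+
          then show ?thesis using True by (simp add: mult.commute[of "u (x', 0)"])
        next
          case nin: False
          have "norm x' \<le> norm x0 + norm (x' - x0)" using norm_triangle_sub[of x' x0] by simp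
          moreover have "norm x' > R + 1" using nin by auto
          ultimately have "norm (x' - x0) > 1" using x0 by linarith
          moreover have "norm (x0 - x') \<le> norm (x0 - x', y0)" by (rule norm_thin_le)
          ultimately have "(x', 0) \<notin> ball (x0, y0) r"
            using r by (auto simp: dist_norm norm_minus_commute)
          then have "ker r (x0, y0) (x', 0) = 0" by (rule ker_zero[OF r(1)])
          then show ?thesis using nin by simp
        qed
      qed
      show "AE x' in lborel. 0 \<le> 8 / r * (indicator (cball 0 (R + 1)) x' * u (x', 0))" using r u(4) by simp
    qed
    also have "\<dots> = 8 / r * I" by (simp add: I_def)
    finally have le: "\<bar>LINT x'|lborel. u (x', 0) * (4 * y0 / r\<^sup>2 * ker r (x0, y0) (x', 0))\<bar> \<le> 8 / r * I" .
    have "\<bar>r / (2 * r ^ N)\<bar> = r / (2 * r ^ N)" using r by simp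
    then have "\<bar>M' r\<bar> = (r / (2 * r ^ N)) * \<bar>LINT x'|lborel. u (x', 0) * (4 * y0 / r\<^sup>2 * ker r (x0, y0) (x', 0))\<bar>"
      unfolding M'_def abs_minus_cancel by (simp only: abs_mult)
    also have "\<dots> \<le> (r / (2 * r ^ N)) * (8 / r * I)"
      by (rule mult_left_mono[OF le]) (use r in simp)
    finally have "\<bar>M' r\<bar> \<le> (r / (2 * r ^ N)) * (8 / r * I)" .
    also have "(r / (2 * r ^ N)) * (8 / r * I) = 4 * I / r ^ N" using r by simp
    also have "\<dots> \<le> 4 * I / h ^ N" using hr h I0 by (intro divide_left_mono power_mono) auto
    finally show ?thesis by simp
  qed
  \<comment> \<open>The smaller radius is \<open>h / 2\<close> and not \<open>h\<close>, because the
    closed ball about \<open>(x0, y0)\<close> must lie in the open half-space for the mean value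
    property.\<close>
  obtain z where z: "h / 2 < z" "z < 1" "M 1 - M (h / 2) = (1 - h / 2) * M' z"
    using MVT2[of "h / 2" 1 M M'] der h by force
  have "\<bar>M 1 - M (h / 2)\<bar> = (1 - h / 2) * \<bar>M' z\<bar>" using z h by (simp add: abs_mult)
  also have "\<dots> \<le> 1 * \<bar>M' z\<bar>" using h by (intro mult_right_mono) auto
  also have "\<dots> \<le> 4 / h ^ N * I" using bd[of z] z h by simp
  finally have fin: "\<bar>M 1 - M (h / 2)\<bar> \<le> 4 / h ^ N * I" .
  have M1: "M 1 = (LINT w|lborel. v w * (ker 1 (x0, y0) w - ker 1 (x0, - y0) w))"
    unfolding M_def by (simp add: right_diff_distrib integrable_ker[OF lv])
  have up: "w \<in> upper" if "w \<in> cball (x0, y0) (h / 2)" for w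
  proof -
    have "\<bar>y0 - snd w\<bar> \<le> dist (x0, y0) w" using norm_snd_le[of "y0 - snd w" "x0 - fst w"]
      by (simp add: dist_norm prod_eq_iff minus_prod_def)
    then show ?thesis using that h by auto
  qed
  have Mh: "M (h / 2) = kmass TYPE('b \<times> real) * u (x0, y0)"
  proof -
    have e1: "v w * ker (h / 2) (x0, y0) w = u w * ker (h / 2) (x0, y0) w" for w
      using up[of w] ker_zero[of "h / 2" w "(x0, y0)"] h by (cases "w \<in> ball (x0, y0) (h / 2)") (auto simp: v_def)
    have e2: "v w * ker (h / 2) (x0, - y0) w = 0" for w
    proof (cases "w \<in> upper")
      case True
      have "\<bar>- y0 - snd w\<bar> \<le> dist (x0, - y0) w" using norm_snd_le[of "- y0 - snd w" "x0 - fst w"]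
        by (simp add: dist_norm prod_eq_iff minus_prod_def)
      then have "w \<notin> ball (x0, - y0) (h / 2)" using True h by auto
      then show ?thesis using ker_zero[of "h / 2" w "(x0, - y0)"] h by simp
    qed (simp add: v_def)
    have "M (h / 2) = (LINT w|lborel. u w * ker (h / 2) (x0, y0) w) / (h / 2) ^ N"
      unfolding M_def e1 e2 by simp
    also have "\<dots> = kmass TYPE('b \<times> real) * u (x0, y0)"
      unfolding N_def by (rule mean_value[OF u(1,2)]) (use up u(3) h in auto)
    finally show ?thesis .
  qed
  show ?thesis using fin unfolding M1 Mh I_def N_def v_def .
qed

section \<open>Convolution with a smooth kernel\<close>

definition conv :: "('a::euclidean_space \<Rightarrow> real) \<Rightarrow> ('a \<Rightarrow> real) \<Rightarrow> 'a \<Rightarrow> real" where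
  "conv v \<zeta> x = (LINT w|lborel. v w * \<zeta> (x - w))"

text \<open>Bounded support of \<open>v\<close> is all that is needed. The lemma serves twice: with
  \<open>v\<close> a truncated rough function and \<open>g\<close> the kernel, and with
  \<open>v\<close> the kernel and \<open>g\<close> a smooth function.\<close>

lemma has_derivative_shift:
  fixes v g :: "'a::euclidean_space \<Rightarrow> real"
  assumes v: "integrable lborel v" "\<And>z. z \<notin> cball 0 \<rho> \<Longrightarrow> v z = 0" and g: "smooth g"
  shows "((\<lambda>x. LINT z|lborel. v z * g (x - z)) has_derivative
    (\<lambda>h. LINT z|lborel. v z * (\<Sum>b\<in>Basis. (h \<bullet> b) * partial b g (x0 - z)))) (at x0)"
proof -
  have bdd: "\<exists>B\<ge>0. \<forall>x. norm x \<le> S \<longrightarrow> \<bar>f x\<bar> \<le> B" if c: "continuous_on UNIV f" for f :: "'a \<Rightarrow> real" and S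
  proof -
    obtain B where "\<forall>x. norm x \<le> S \<longrightarrow> \<bar>f x\<bar> \<le> B" using locbdd_continuous[OF c] unfolding locbdd_def by metis
    then show ?thesis by (intro exI[of _ "\<bar>B\<bar>"]) force
  qed
  define S where "S = norm x0 + 1 + \<bar>\<rho>\<bar>"
  obtain B0 where B0: "\<forall>x. norm x \<le> S \<longrightarrow> \<bar>g x\<bar> \<le> B0" using bdd[OF smooth_continuous[OF g]] by blast
  have "\<forall>b\<in>Basis. \<exists>B\<ge>0. \<forall>x. norm x \<le> S \<longrightarrow> \<bar>partial b g x\<bar> \<le> B"
    using bdd smooth_continuous smooth_partial[OF g] by blast
  then obtain B where B: "\<And>b. b \<in> Basis \<Longrightarrow> B b \<ge> 0 \<and> (\<forall>x. norm x \<le> S \<longrightarrow> \<bar>partial b g x\<bar> \<le> B b)" by metis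
  have inS: "norm (t - w) \<le> S" if "t \<in> ball x0 1" "v w \<noteq> 0" for t w
  proof -
    have "norm w \<le> \<rho>" using v(2)[of w] that by force
    moreover have "norm t \<le> norm x0 + 1" using that norm_triangle_sub[of t x0] by (simp add: dist_norm norm_minus_commute)
    moreover have "norm (t - w) \<le> norm t + norm w" by (rule norm_triangle_ineq4)
    ultimately show ?thesis by (simp add: S_def)
  qed
  have c: "continuous_on UNIV (\<lambda>w. f (t - w))" if "continuous_on UNIV f" for f :: "'a \<Rightarrow> real" and t
    by (rule continuous_on_compose2[OF that]) (auto intro!: continuous_intros)
  show ?thesis
  proof (rule has_derivative_lint[OF v(1) zero_less_one, where C = "\<Sum>b\<in>Basis. B b" and B = B0
        and D = "\<lambda>t w h. \<Sum>b\<in>Basis. (h \<bullet> b) * partial b g (t - w)"])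
    show "(\<lambda>z. g (t - z)) \<in> borel_measurable lborel" for t
      using borel_measurable_continuous_onI[OF c[OF smooth_continuous[OF g]]] by simp
    have cs: "continuous_on UNIV (\<lambda>w. \<Sum>b\<in>Basis. (h \<bullet> b) * partial b g (x0 - w))" for h
      by (intro continuous_intros c smooth_continuous smooth_partial g)
    show "(\<lambda>w. \<Sum>b\<in>Basis. (h \<bullet> b) * partial b g (x0 - w)) \<in> borel_measurable lborel" for h
      using borel_measurable_continuous_onI[OF cs] by simp
    fix t w :: 'a
    have "((\<lambda>t. t - w) has_derivative (\<lambda>h. h)) (at t)" by (auto intro!: derivative_eq_intros)
    from has_derivative_compose[OF this has_derivative_partial[OF smooth_differentiable[OF g]]]
    show "((\<lambda>t. g (t - w)) has_derivative (\<lambda>h. \<Sum>b\<in>Basis. (h \<bullet> b) * partial b g (t - w))) (at t)" .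
    assume t: "t \<in> ball x0 1" and w: "v w \<noteq> 0"
    show "\<bar>g (t - w)\<bar> \<le> B0" using B0 inS[OF t w] by blast
    fix h
    have "\<bar>\<Sum>b\<in>Basis. (h \<bullet> b) * partial b g (t - w)\<bar> \<le> (\<Sum>b\<in>Basis. \<bar>(h \<bullet> b) * partial b g (t - w)\<bar>)"
      by (rule sum_abs)
    also have "\<dots> \<le> (\<Sum>b\<in>Basis. norm h * B b)"
      unfolding abs_mult by (intro sum_mono mult_mono) (use B inS[OF t w] Basis_le_norm in auto)
    finally show "\<bar>\<Sum>b\<in>Basis. (h \<bullet> b) * partial b g (t - w)\<bar> \<le> (\<Sum>b\<in>Basis. B b) * norm h"
      by (simp add: sum_distrib_left mult.commute)
  qed
qed

lemma sum_Basis_inner: "b \<in> Basis \<Longrightarrow> (\<Sum>b'\<in>Basis. (b \<bullet> b') * f b') = (f b :: real)"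
  by (simp add: inner_Basis if_distrib[of "\<lambda>t. t * _"] cong: if_cong)

lemma conv_partial:
  fixes v \<zeta> :: "'a::euclidean_space \<Rightarrow> real"
  assumes v: "locbdd v" and \<zeta>: "smooth \<zeta>" "\<And>x. x \<notin> cball 0 R \<Longrightarrow> \<zeta> x = 0"
  shows "conv v \<zeta> differentiable (at x0)"
    and "b \<in> Basis \<Longrightarrow> partial b (conv v \<zeta>) x0 = conv v (partial b \<zeta>) x0"
proof -
  \<comment> \<open>The extra 1 in the radius leaves room for x to move in the unit ball about
    \<open>x0\<close>: the truncation does not change the convolution there.\<close>
  define S where "S = cball x0 (R + 1)"
  define v' where "v' w = indicator S w * v w" for w
  have iv: "integrable lborel v'" unfolding v'_def S_def by (rule locbdd_integrable_ball[OF v])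
  have v0: "v' z = 0" if "z \<notin> cball 0 (norm x0 + R + 1)" for z
  proof -
    have "z \<notin> S" using that norm_triangle_sub[of z x0] by (auto simp: S_def dist_norm norm_minus_commute)
    then show ?thesis by (simp add: v'_def)
  qed
  have p0: "partial b \<zeta> x = 0" if "x \<notin> cball 0 R" for x b
    by (rule partial_zero_outside[of "cball 0 R"]) (use \<zeta>(2) that in auto)
  have out: "x - w \<notin> cball 0 R" if "w \<notin> S" "x \<in> ball x0 1" for x w
    using that norm_triangle_ineq[of "x - w" "x0 - x"] by (auto simp: S_def dist_norm norm_minus_commute)
  have "((\<lambda>x. LINT z|lborel. v' z * \<zeta> (x - z)) has_derivative
    (\<lambda>h. LINT z|lborel. v' z * (\<Sum>b\<in>Basis. (h \<bullet> b) * partial b \<zeta> (x0 - z)))) (at x0)"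
    by (rule has_derivative_shift[OF iv v0 \<zeta>(1)])
  then have d: "(conv v \<zeta> has_derivative
    (\<lambda>h. LINT z|lborel. v' z * (\<Sum>b\<in>Basis. (h \<bullet> b) * partial b \<zeta> (x0 - z)))) (at x0)"
  proof (rule has_derivative_transform_within_open[of _ _ _ _ "ball x0 1"])
    fix x assume x: "x \<in> ball x0 1"
    have "v' z * \<zeta> (x - z) = v z * \<zeta> (x - z)" for z
      using \<zeta>(2)[OF out[OF _ x, of z]] by (cases "z \<in> S") (auto simp: v'_def)
    then show "(LINT z|lborel. v' z * \<zeta> (x - z)) = conv v \<zeta> x"
      unfolding conv_def by (intro Bochner_Integration.integral_cong[OF refl])
  qed auto
  then show "conv v \<zeta> differentiable (at x0)" by (rule differentiableI)
  assume b: "b \<in> Basis"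
  have "partial b (conv v \<zeta>) x0 = (LINT z|lborel. v' z * partial b \<zeta> (x0 - z))"
    unfolding partial_eqI[OF d] sum_Basis_inner[OF b] ..
  also have "\<dots> = conv v (partial b \<zeta>) x0"
  proof -
    have "v' z * partial b \<zeta> (x0 - z) = v z * partial b \<zeta> (x0 - z)" for z
      using p0[OF out[of z x0]] by (cases "z \<in> S") (auto simp: v'_def)
    then show ?thesis unfolding conv_def by (intro Bochner_Integration.integral_cong[OF refl])
  qed
  finally show "partial b (conv v \<zeta>) x0 = conv v (partial b \<zeta>) x0" .
qed

lemma conv_smooth:
  fixes v \<zeta> :: "'a::euclidean_space \<Rightarrow> real"
  assumes v: "locbdd v" and \<zeta>: "smooth \<zeta>" "\<And>x. x \<notin> cball 0 R \<Longrightarrow> \<zeta> x = 0"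
  shows "smooth (conv v \<zeta>)"
proof (rule smoothI[where S = "\<lambda>f. \<exists>\<zeta>. smooth \<zeta> \<and> (\<forall>x. x \<notin> cball 0 R \<longrightarrow> \<zeta> x = 0) \<and> f = conv v \<zeta>"])
  show "\<exists>\<zeta>'. smooth \<zeta>' \<and> (\<forall>x. x \<notin> cball 0 R \<longrightarrow> \<zeta>' x = 0) \<and> conv v \<zeta> = conv v \<zeta>'" using \<zeta> by blast
next
  fix f x assume "\<exists>\<zeta>. smooth \<zeta> \<and> (\<forall>x. x \<notin> cball 0 R \<longrightarrow> \<zeta> x = 0) \<and> f = conv v \<zeta>"
  then show "f differentiable (at x)" using conv_partial(1)[OF v] by blast
next
  fix f and b :: 'a assume "\<exists>\<zeta>. smooth \<zeta> \<and> (\<forall>x. x \<notin> cball 0 R \<longrightarrow> \<zeta> x = 0) \<and> f = conv v \<zeta>" and b: "b \<in> Basis"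
  then obtain \<zeta> where z: "smooth \<zeta>" "\<And>x. x \<notin> cball 0 R \<Longrightarrow> \<zeta> x = 0" "f = conv v \<zeta>" by blast
  have "partial b f = conv v (partial b \<zeta>)" unfolding z(3) by (rule ext) (rule conv_partial(2)[OF v z(1,2) b])
  moreover have "\<forall>x. x \<notin> cball 0 R \<longrightarrow> partial b \<zeta> x = 0"
    by (intro allI impI partial_zero_outside[of "cball 0 R"]) (use z(2) in auto)
  ultimately show "\<exists>\<zeta>. smooth \<zeta> \<and> (\<forall>x. x \<notin> cball 0 R \<longrightarrow> \<zeta> x = 0) \<and> partial b f = conv v \<zeta>"
    using smooth_partial[OF z(1) b] by blast
qed

lemma conv_commute:
  assumes "locbdd f" "locbdd \<zeta>"
  shows "conv f \<zeta> x = conv \<zeta> f x"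
proof -
  have "(\<lambda>w. \<zeta> (x - w)) \<in> borel_measurable borel"
    by (rule measurable_compose[OF _ locbdd_measurable[OF assms(2)]])
      (intro borel_measurable_continuous_onI continuous_intros)
  then have m: "(\<lambda>w. f w * \<zeta> (x - w)) \<in> borel_measurable borel" using locbdd_measurable[OF assms(1)] by simp
  show ?thesis unfolding conv_def by (subst lint_affine[OF _ m, of "-1" x]) (simp_all add: mult.commute)
qed

text \<open>After commuting the factors, the derivative falls on \<open>f\<close>. Together with
  \<open>conv_partial\<close>, where it falls on the kernel, this is integration by parts without
  boundary terms.\<close>

lemma conv_partial_left:
  fixes f \<zeta> :: "'a::euclidean_space \<Rightarrow> real"
  assumes f: "smooth f" and \<zeta>: "smooth \<zeta>" "\<And>x. x \<notin> cball 0 R \<Longrightarrow> \<zeta> x = 0" and b: "b \<in> Basis"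
  shows "partial b (conv f \<zeta>) x0 = conv (partial b f) \<zeta> x0"
proof -
  have lf: "locbdd g" if "smooth g" for g :: "'a \<Rightarrow> real" using that by (intro locbdd_continuous smooth_continuous)
  have "integrable lborel \<zeta>" by (rule locbdd_integrable[OF lf[OF \<zeta>(1)] \<zeta>(2)])
  from has_derivative_shift[OF this \<zeta>(2) f]
  have "(conv \<zeta> f has_derivative (\<lambda>h. LINT z|lborel. \<zeta> z * (\<Sum>b\<in>Basis. (h \<bullet> b) * partial b f (x0 - z)))) (at x0)"
    unfolding conv_def[abs_def] .
  then have "partial b (conv \<zeta> f) x0 = conv \<zeta> (partial b f) x0"
    unfolding conv_def using partial_eqI sum_Basis_inner[OF b] by (simp add: partial_eqI)
  moreover have "conv \<zeta> f = conv f \<zeta>" by (rule ext) (intro conv_commute lf f \<zeta>(1))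
  moreover have "conv \<zeta> (partial b f) x0 = conv (partial b f) \<zeta> x0"
    by (intro conv_commute lf smooth_partial f \<zeta>(1) b)
  ultimately show ?thesis by simp
qed

lemma smooth_reflect:
  fixes g :: "'a::euclidean_space \<Rightarrow> real"
  assumes "smooth g"
  shows "smooth (\<lambda>w. g (x - w))"
proof (rule smoothI[where S = "\<lambda>f. \<exists>g. smooth g \<and> f = (\<lambda>w. g (x - w))"])
  have d: "((\<lambda>w. g (x - w)) has_derivative (\<lambda>h. \<Sum>b\<in>Basis. ((- h) \<bullet> b) * partial b g (x - w))) (at w)"
    if "smooth g" for g :: "'a \<Rightarrow> real" and w
  proof -
    have "((\<lambda>w. x - w) has_derivative (\<lambda>h. - h)) (at w)" by (auto intro!: derivative_eq_intros)
    from has_derivative_compose[OF this has_derivative_partial[OF smooth_differentiable[OF that]]]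
    show ?thesis .
  qed
  show "\<exists>g'. smooth g' \<and> (\<lambda>w. g (x - w)) = (\<lambda>w. g' (x - w))" using assms by blast
  show "f differentiable (at w)" if "\<exists>g. smooth g \<and> f = (\<lambda>w. g (x - w))" for f w
    using that d differentiableI by blast
  fix f and b :: 'a assume "\<exists>g. smooth g \<and> f = (\<lambda>w. g (x - w))" and b: "b \<in> Basis"
  then obtain g where g: "smooth g" "f = (\<lambda>w. g (x - w))" by blast
  have "partial b f = (\<lambda>w. - partial b g (x - w))"
    unfolding g(2) by (rule ext, subst partial_eqI[OF d[OF g(1)]]) (simp add: sum_negf sum_Basis_inner[OF b])
  then show "\<exists>g. smooth g \<and> partial b f = (\<lambda>w. g (x - w))"
    using smooth_minus[OF smooth_partial[OF g(1) b]] by (intro exI[of _ "\<lambda>w. - partial b g w"]) simp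
qed

text \<open>Each second derivative is moved across the convolution one order at a time:
  \<open>conv_partial\<close> pulls it out of the kernel and \<open>conv_partial_left\<close> puts
  it on \<open>f\<close>.\<close>

lemma conv_laplacian:
  fixes f \<zeta> :: "'a::euclidean_space \<Rightarrow> real"
  assumes f: "smooth f" and \<zeta>: "smooth \<zeta>" "\<And>x. x \<notin> cball 0 R \<Longrightarrow> \<zeta> x = 0"
  shows "conv f (laplacian \<zeta>) x = conv (laplacian f) \<zeta> x"
proof -
  have lf: "locbdd g" if "smooth g" for g :: "'a \<Rightarrow> real" using that by (intro locbdd_continuous smooth_continuous)
  have p0: "partial b \<zeta> x = 0" if "x \<notin> cball 0 R" for x b
    by (rule partial_zero_outside[of "cball 0 R"]) (use \<zeta>(2) that in auto)
  have pp0: "partial b (partial b \<zeta>) x = 0" if "x \<notin> cball 0 R" for x b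
    by (rule partial_zero_outside[of "cball 0 R"]) (use p0 that in auto)
  have i1: "integrable lborel (\<lambda>w. f w * partial b (partial b \<zeta>) (x - w))" if "b \<in> Basis" for b
  proof (rule integrable_smooth_mult[OF lf[OF f] smooth_reflect[OF smooth_partial[OF smooth_partial[OF \<zeta>(1)]]], where a = x and R = R])
    fix w assume "w \<notin> cball x R"
    then have "x - w \<notin> cball 0 R" by (simp add: dist_norm norm_minus_commute)
    then show "partial b (partial b \<zeta>) (x - w) = 0" by (rule pp0)
  qed (use that in auto)
  have i2: "integrable lborel (\<lambda>w. partial b (partial b f) w * \<zeta> (x - w))" if "b \<in> Basis" for b
  proof (rule integrable_smooth_mult[OF lf[OF smooth_partial[OF smooth_partial[OF f]]] smooth_reflect[OF \<zeta>(1)], where a = x and R = R])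
    fix w assume "w \<notin> cball x R"
    then have "x - w \<notin> cball 0 R" by (simp add: dist_norm norm_minus_commute)
    then show "\<zeta> (x - w) = 0" by (rule \<zeta>(2))
  qed (use that in auto)
  have "conv f (laplacian \<zeta>) x = (\<Sum>b\<in>Basis. conv f (partial b (partial b \<zeta>)) x)"
    unfolding conv_def laplacian_def sum_distrib_left using i1 by simp
  also have "\<dots> = (\<Sum>b\<in>Basis. conv (partial b (partial b f)) \<zeta> x)"
  proof (rule sum.cong[OF refl])
    fix b :: 'a assume b: "b \<in> Basis"
    have "conv f (partial b (partial b \<zeta>)) x = partial b (conv f (partial b \<zeta>)) x"
      by (rule conv_partial(2)[OF lf[OF f] smooth_partial[OF \<zeta>(1) b] p0 b, symmetric])
    also have "conv f (partial b \<zeta>) = conv (partial b f) \<zeta>"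
      using conv_partial(2)[OF lf[OF f] \<zeta> b] conv_partial_left[OF f \<zeta> b] by (intro ext) simp
    also have "partial b (conv (partial b f) \<zeta>) x = conv (partial b (partial b f)) \<zeta> x"
      by (rule conv_partial_left[OF smooth_partial[OF f b] \<zeta> b])
    finally show "conv f (partial b (partial b \<zeta>)) x = conv (partial b (partial b f)) \<zeta> x" .
  qed
  also have "\<dots> = conv (laplacian f) \<zeta> x"
    unfolding conv_def laplacian_def sum_distrib_right using i2 by simp
  finally show ?thesis .
qed

text \<open>Averages that do not depend on the radius have zero radius derivative, so
  \<open>Q\<close> is orthogonal to the Laplacian of every bump about \<open>a\<close>. By
  integration by parts the Laplacian of \<open>Q\<close> is orthogonal to the bumps themselves,
  which is impossible if it has a sign near \<open>a\<close>.\<close>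

lemma mean_value_imp_harmonic:
  fixes Q :: "'a::euclidean_space \<Rightarrow> real"
  assumes Q: "smooth Q"
    and mean: "\<And>a r. r > 0 \<Longrightarrow> (LINT w|lborel. Q w * ker r a w) / r ^ DIM('a) = kmass TYPE('a) * Q a"
  shows "laplacian Q a = 0"
proof -
  have lQ: "locbdd Q" by (intro locbdd_continuous smooth_continuous Q)
  have z: "(LINT w|lborel. laplacian Q w * bump r a w) = 0" if r: "r > 0" for r
  proof -
    have "((\<lambda>r. (LINT w|lborel. Q w * ker r a w) / r ^ DIM('a)) has_real_derivative 0) (at r)"
      by (rule has_field_derivative_transform_within_open[of "\<lambda>_. kmass TYPE('a) * Q a" _ _ "{0<..}"])
        (use mean r in auto)
    from DERIV_unique[OF DERIV_mean[OF lQ r, of a] this]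
    have "(LINT w|lborel. Q w * laplacian (bump r a) w) = 0" using r by simp
    moreover have "laplacian (bump r a) w = laplacian (bump r 0) (a - w)" for w
    proof -
      have "sqd r a w = sqd r 0 (a - w)" by (simp add: sqd_norm norm_minus_commute)
      then show ?thesis using r by (simp add: laplacian_bump ker_def)
    qed
    ultimately have "conv Q (laplacian (bump r 0)) a = 0" by (simp add: conv_def)
    moreover have "conv Q (laplacian (bump r 0)) a = conv (laplacian Q) (bump r 0) a"
    proof (rule conv_laplacian[OF Q smooth_bump, of r])
      fix x :: 'a assume "x \<notin> cball 0 r"
      then have "x \<notin> ball 0 r" by auto
      then show "bump r 0 x = 0" by (rule bump_zero[OF r])
    qed
    moreover have "bump r 0 (a - w) = bump r a w" for w
      by (simp add: bump_def sqd_norm norm_minus_commute)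
    ultimately show ?thesis by (simp add: conv_def)
  qed
  \<comment> \<open>The factor \<open>s\<close> will be 1 and -1, so that one argument excludes both
    signs.\<close>
  have pos: "\<not> s * laplacian Q a > 0" for s :: real
  proof
    assume p: "s * laplacian Q a > 0"
    have c: "continuous_on UNIV (\<lambda>x. s * laplacian Q x)" by (intro continuous_intros smooth_continuous smooth_laplacian Q)
    then have "open {x. s * laplacian Q x > 0}" by (intro open_Collect_less) auto
    then obtain e where e: "e > 0" "ball a e \<subseteq> {x. s * laplacian Q x > 0}" using p openE by blast
    have "(LINT w|lborel. s * laplacian Q w * bump e a w) > 0"
    proof (rule lint_pos[where ?x0.0 = a])
      show "continuous_on UNIV (\<lambda>w. s * laplacian Q w * bump e a w)" by (intro continuous_on_mult c smooth_continuous smooth_bump)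
      show "integrable lborel (\<lambda>w. s * laplacian Q w * bump e a w)"
        by (rule integrable_smooth_mult[OF locbdd_continuous[OF c] smooth_bump, where a = a and R = e])
          (auto simp: bump_zero[OF e(1)])
      show "s * laplacian Q a * bump e a a > 0" using p bump_pos[of e a a] e by simp
      show "0 \<le> s * laplacian Q w * bump e a w" for w
      proof (cases "w \<in> ball a e")
        case True
        then have "s * laplacian Q w > 0" using e by blast
        then show ?thesis using bump_nonneg[of e a w] by simp
      qed (simp add: bump_zero[OF e(1)])
    qed
    moreover have "(LINT w|lborel. s * laplacian Q w * bump e a w) = 0"
      using z[OF e(1)] by (simp add: mult.assoc)
    ultimately show False by simp
  qed
  from pos[of 1] pos[of "-1"] show ?thesis by simp
qed

section \<open>A barrier\<close>

definition saddle :: "real \<Rightarrow> 'b::euclidean_space \<Rightarrow> 'b \<times> real \<Rightarrow> real" where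
  "saddle K a z = (fst z - a) \<bullet> (fst z - a) - K * (snd z)\<^sup>2"

lemma continuous_saddle: "continuous_on S (saddle K a)"
  unfolding saddle_def by (intro continuous_intros)

lemma integrable_mult_ker:
  fixes f :: "'a::euclidean_space \<Rightarrow> real"
  assumes "continuous_on UNIV f" "r > 0" shows "integrable lborel (\<lambda>z. f z * ker r a z)"
  by (rule integrable_ker[OF locbdd_continuous[OF assms(1)] assms(2)])

text \<open>
  \<open>K\<close> is only chosen large enough for the averages of the saddle to be negative, which replaces a
  maximum principle for the barrier itself.
\<close>

lemma saddle_constant_exists:
  obtains K where "K > 0" "(LINT z|lborel. saddle K (0::'b::euclidean_space) z * ker 1 0 z) < 0"
proof -
  define p where "p = (LINT z|lborel. (fst z \<bullet> fst z) * ker 1 (0::'b \<times> real) z)"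
  define q where "q = (LINT z|lborel. (snd z)\<^sup>2 * ker 1 (0::'b \<times> real) z)"
  have i1: "integrable lborel (\<lambda>z. (fst z \<bullet> fst z) * ker 1 (0::'b \<times> real) z)"
    by (rule integrable_mult_ker) (auto intro!: continuous_intros)
  have i2: "integrable lborel (\<lambda>z. (snd z)\<^sup>2 * ker 1 (0::'b \<times> real) z)"
    by (rule integrable_mult_ker) (auto intro!: continuous_intros)
  have p: "p \<ge> 0" unfolding p_def by (rule Bochner_Integration.integral_nonneg) (simp add: ker_nonneg)
  have q: "q > 0" unfolding q_def
  proof (rule lint_pos[OF _ i2, where ?x0.0 = "(0, 1/2)"])
    show "continuous_on UNIV (\<lambda>z. (snd z)\<^sup>2 * ker 1 (0::'b \<times> real) z)"
      by (intro continuous_intros smooth_continuous smooth_ker)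
    have "(0, 1/2) \<in> ball (0::'b \<times> real) 1" by (simp add: norm_Pair)
    from ker_pos[OF zero_less_one this]
    show "0 < (snd (0::'b, 1/2::real))\<^sup>2 * ker 1 (0::'b \<times> real) (0, 1/2)" by simp
  qed (simp add: ker_nonneg)
  have "(LINT z|lborel. saddle ((p + 1) / q) (0::'b) z * ker 1 0 z)
    = (LINT z|lborel. (fst z \<bullet> fst z) * ker 1 (0::'b \<times> real) z - ((p + 1) / q) * ((snd z)\<^sup>2 * ker 1 (0::'b \<times> real) z))"
    by (rule Bochner_Integration.integral_cong[OF refl]) (simp add: saddle_def left_diff_distrib mult.assoc)
  also have "\<dots> = p - ((p + 1) / q) * q" using i1 i2 by (simp add: p_def q_def)
  also have "\<dots> < 0" using q by simp
  finally show ?thesis using that[of "(p + 1) / q"] p q by simp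
qed

lemma lint_linear_ker: "(LINT z|lborel. (l \<bullet> z) * ker 1 (0::'a::euclidean_space) z) = 0"
proof -
  have m: "(\<lambda>z. (l \<bullet> z) * ker 1 (0::'a) z) \<in> borel_measurable borel"
    by (intro borel_measurable_continuous_onI continuous_intros smooth_continuous smooth_ker)
  have "ker 1 (0::'a) (- z) = ker 1 0 z" for z by (simp add: ker_def sqd_def)
  then show ?thesis using lint_affine[OF _ m, of "-1" 0] by simp
qed

text \<open>At such a maximum \<open>u\<close> lies below a quadratic that touches it at
  \<open>x\<close>. On averaging, the linear part of the quadratic drops out by symmetry and its
  second-order part contributes a negative amount, so the average of \<open>u\<close> would be less
  than its value at the centre.\<close>

lemma no_interior_max:
  fixes u :: "'b::euclidean_space \<times> real \<Rightarrow> real"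
  assumes u: "continuous_on UNIV u" "distr_laplacian_eq_0_on \<Omega> u" "cball x r \<subseteq> \<Omega>" "r > 0"
    and K: "(LINT z|lborel. saddle K (0::'b) z * ker 1 0 z) < 0" and "A > 0"
    and max: "\<And>z. z \<in> cball x r \<Longrightarrow> u z - A * saddle K a z \<le> u x - A * saddle K a x"
  shows False
proof -
  define g where "g z = u x - A * saddle K a x + A * saddle K a z" for z
  have cg: "continuous_on UNIV g" unfolding g_def[abs_def] by (intro continuous_intros continuous_saddle)
  let ?N = "DIM('b \<times> real)"
  \<comment> \<open>\<open>l\<close> is \<open>r\<close> times the gradient of the saddle at
    \<open>x\<close>. The expansion below is exact, and its second-order part is the saddle centred
    at the origin, whatever \<open>a\<close> is.\<close>
  define l where "l = (2 * r) *\<^sub>R (fst x - a, - K * snd x)"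
  have gz: "g (x + r *\<^sub>R z) = u x + A * (l \<bullet> z) + A * r\<^sup>2 * saddle K 0 z" for z
    unfolding g_def saddle_def l_def
    by (simp add: inner_prod_def power2_eq_square inner_diff_left inner_diff_right inner_add_left inner_add_right
        inner_commute algebra_simps)
  have "(LINT z|lborel. u z * ker r x z) \<le> (LINT z|lborel. g z * ker r x z)"
  proof (rule integral_mono)
    show "integrable lborel (\<lambda>z. u z * ker r x z)" by (rule integrable_mult_ker[OF u(1,4)])
    show "integrable lborel (\<lambda>z. g z * ker r x z)" by (rule integrable_mult_ker[OF cg u(4)])
    show "u z * ker r x z \<le> g z * ker r x z" for z
    proof (cases "z \<in> ball x r")
      case True
      then have "u z \<le> g z" using max[of z] by (simp add: g_def)
      then show ?thesis by (rule mult_right_mono) (rule ker_nonneg)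
    qed (simp add: ker_zero[OF u(4)])
  qed
  then have "(LINT z|lborel. u z * ker r x z) / r ^ ?N \<le> (LINT z|lborel. g z * ker r x z) / r ^ ?N"
    using u(4) by (intro divide_right_mono) auto
  then have "kmass TYPE('b \<times> real) * u x \<le> (LINT z|lborel. g (x + r *\<^sub>R z) * ker 1 0 z)"
    unfolding mean_value[OF u] mean_rescale[OF locbdd_continuous[OF cg] u(4)] .
  also have "\<dots> = (LINT z|lborel. u x * ker 1 0 z + (A * ((l \<bullet> z) * ker 1 0 z) + A * r\<^sup>2 * (saddle K 0 z * ker 1 0 z)))"
    by (rule Bochner_Integration.integral_cong[OF refl]) (simp add: gz algebra_simps)
  also have "\<dots> = u x * kmass TYPE('b \<times> real) + A * r\<^sup>2 * (LINT z|lborel. saddle K (0::'b) z * ker 1 0 z)"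
  proof -
    have "integrable lborel (\<lambda>z. u x * ker 1 (0::'b \<times> real) z)" by (intro integrable_mult_right integrable_ker1) simp
    moreover have "integrable lborel (\<lambda>z. A * ((l \<bullet> z) * ker 1 (0::'b \<times> real) z))"
      by (intro integrable_mult_right integrable_mult_ker continuous_intros) simp
    moreover have "integrable lborel (\<lambda>z. A * r\<^sup>2 * (saddle K (0::'b) z * ker 1 0 z))"
      by (intro integrable_mult_right integrable_mult_ker continuous_saddle) simp
    ultimately show ?thesis by (simp add: lint_linear_ker kmass_def)
  qed
  finally have "0 \<le> A * r\<^sup>2 * (LINT z|lborel. saddle K (0::'b) z * ker 1 0 z)" by (simp add: mult.commute)
  moreover have "A * r\<^sup>2 * (LINT z|lborel. saddle K (0::'b) z * ker 1 0 z) < 0"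
    using \<open>A > 0\<close> u(4) K by (intro mult_pos_neg) auto
  ultimately show False by simp
qed

text \<open>The difference of \<open>u\<close> and the barrier attains its maximum on the closed
  cylinder. A maximum above \<open>B\<close> cannot lie on the boundary by hypothesis, nor outside
  \<Omega>, where \<open>u\<close> is nonpositive and the saddle is nonnegative because the point is
  on the thin space. In the remaining interior case \<open>no_interior_max\<close> applies.\<close>

lemma cylinder_comparison:
  fixes u :: "'b::euclidean_space \<times> real \<Rightarrow> real"
  assumes u: "continuous_on UNIV u" "distr_laplacian_eq_0_on \<Omega> u" "open \<Omega>"
    and out: "\<And>z. z \<notin> \<Omega> \<Longrightarrow> snd z = 0 \<and> u z \<le> 0"
    and K: "(LINT z|lborel. saddle K (0::'b) z * ker 1 0 z) < 0" and "A > 0" "B \<ge> 0"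
    and lat: "\<And>z. norm (fst z - a) = \<rho> \<Longrightarrow> \<bar>snd z\<bar> \<le> h \<Longrightarrow> u z \<le> A * saddle K a z + B"
    and top: "\<And>z. norm (fst z - a) \<le> \<rho> \<Longrightarrow> \<bar>snd z\<bar> = h \<Longrightarrow> u z \<le> A * saddle K a z + B"
    and z: "norm (fst z - a) \<le> \<rho>" "\<bar>snd z\<bar> \<le> h"
  shows "u z \<le> A * saddle K a z + B"
proof (rule ccontr)
  assume neg: "\<not> ?thesis"
  define C where "C = cball a \<rho> \<times> {-h..h}"
  have memC: "z \<in> C \<longleftrightarrow> norm (fst z - a) \<le> \<rho> \<and> \<bar>snd z\<bar> \<le> h" for z
    by (cases z) (auto simp: C_def dist_norm norm_minus_commute)
  have "compact C" unfolding C_def by (intro compact_Times compact_cball compact_Icc)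
  moreover have "C \<noteq> {}" using z memC by blast
  moreover have "continuous_on C (\<lambda>z. u z - A * saddle K a z)"
    by (intro continuous_intros continuous_saddle continuous_on_subset[OF u(1)]) auto
  ultimately obtain x where x: "x \<in> C" "\<And>y. y \<in> C \<Longrightarrow> u y - A * saddle K a y \<le> u x - A * saddle K a x"
    using continuous_attains_sup[of C "\<lambda>z. u z - A * saddle K a z"] by blast
  have gt: "u x - A * saddle K a x > B" using x(2)[of z] neg memC[of z] z by auto
  have "x \<in> \<Omega>"
  proof (rule ccontr)
    assume "x \<notin> \<Omega>"
    then have "snd x = 0" "u x \<le> 0" using out by auto
    then have "u x - A * saddle K a x \<le> 0" using \<open>A > 0\<close> by (auto simp: saddle_def intro: order_trans)
    then show False using gt \<open>B \<ge> 0\<close> by simp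
  qed
  moreover have "norm (fst x - a) < \<rho>" using lat[of x] gt x(1) memC[of x] by force
  moreover have "\<bar>snd x\<bar> < h" using top[of x] gt x(1) memC[of x] by force
  ultimately have "x \<in> \<Omega> \<inter> (ball a \<rho> \<times> {-h<..<h})"
    by (cases x) (auto simp: dist_norm norm_minus_commute)
  moreover have "open (\<Omega> \<inter> (ball a \<rho> \<times> {-h<..<h}))" using u(3) by (intro open_Int open_Times) auto
  ultimately obtain r where r: "r > 0" "cball x r \<subseteq> \<Omega> \<inter> (ball a \<rho> \<times> {-h<..<h})"
    using open_contains_cball by blast
  have "cball x r \<subseteq> C"
  proof
    fix y assume "y \<in> cball x r"
    then have "y \<in> ball a \<rho> \<times> {-h<..<h}" using r by blast
    then show "y \<in> C" by (auto simp: C_def)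
  qed
  then show False
    using no_interior_max[OF u(1,2) _ r(1) K \<open>A > 0\<close>, of x a] r(2) x(2) by blast
qed

section \<open>A harmonic polynomial\<close>

definition cplx :: "'b::euclidean_space \<Rightarrow> 'b \<times> real \<Rightarrow> complex" where
  "cplx b x = Complex (fst x \<bullet> b) (snd x)"

text \<open>The complex coefficient \<open>c\<close> absorbs the factors produced by
  differentiation, so all partials are again of this form.\<close>

definition hmono :: "'b::euclidean_space \<Rightarrow> complex \<Rightarrow> nat \<Rightarrow> 'b \<times> real \<Rightarrow> real" where
  "hmono b c d x = Im (c * cplx b x ^ d)"

lemma bounded_linear_cplx: "bounded_linear (cplx b)"
proof -
  have "cplx b = (\<lambda>x. complex_of_real (fst x \<bullet> b) + \<i> * complex_of_real (snd x))"
    by (rule ext) (simp add: cplx_def complex_eq_iff)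
  moreover have "bounded_linear (\<lambda>x. complex_of_real (fst x \<bullet> b) + \<i> * complex_of_real (snd x))"
    by (intro bounded_linear_add bounded_linear_compose[OF bounded_linear_of_real]
        bounded_linear_compose[OF bounded_linear_inner_left] bounded_linear_fst bounded_linear_snd
        bounded_linear_const_mult)
  ultimately show ?thesis by simp
qed

lemma hmono_has_derivative:
  "(hmono b c d has_derivative (\<lambda>h. Im (c * of_nat d * cplx b h * cplx b x ^ (d - 1)))) (at x)"
proof -
  have "(cplx b has_derivative cplx b) (at x)"
    by (rule bounded_linear_imp_has_derivative[OF bounded_linear_cplx])
  then have "((\<lambda>x. cplx b x ^ d) has_derivative (\<lambda>h. of_nat d * cplx b h * cplx b x ^ (d - 1))) (at x)"
    by (rule has_derivative_power)
  then have "((\<lambda>x. c * cplx b x ^ d) has_derivative (\<lambda>h. c * (of_nat d * cplx b h * cplx b x ^ (d - 1)))) (at x)"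
    by (rule has_derivative_mult_right)
  from bounded_linear.has_derivative[OF bounded_linear_Im this] show ?thesis
    unfolding hmono_def[abs_def] by (simp add: mult.assoc)
qed

lemma partial_hmono: "partial e (hmono b c d) = hmono b (c * of_nat d * cplx b e) (d - 1)"
  by (rule ext, subst partial_eqI[OF hmono_has_derivative]) (simp add: hmono_def)

lemma smooth_hmono: "smooth (hmono b c d)"
proof (rule smoothI[where S = "\<lambda>f. \<exists>c d. f = hmono b c d"])
  show "\<exists>c' d'. hmono b c d = hmono b c' d'" by blast
next
  fix f x assume "\<exists>c d. f = hmono b c d"
  then show "f differentiable (at x)" using hmono_has_derivative differentiableI by blast
next
  fix f and e assume "\<exists>c d. f = hmono b c d"
  then show "\<exists>c d. partial e f = hmono b c d" using partial_hmono by blast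
qed

text \<open>The squares of \<open>cplx b e\<close> over the basis are 1 in direction
  \<open>b\<close>, -1 in the last direction and 0 otherwise, so they sum to zero.\<close>

lemma laplacian_hmono:
  assumes "b \<in> Basis" shows "laplacian (hmono b c d) x = 0"
proof -
  define k where "k = c * of_nat d * of_nat (d - 1) * cplx b x ^ (d - 1 - 1)"
  have "laplacian (hmono b c d) x = (\<Sum>e\<in>Basis. Im (k * (cplx b e)\<^sup>2))"
    unfolding laplacian_def partial_hmono hmono_def k_def by (simp add: mult_ac power2_eq_square)
  also have "\<dots> = Im (k * (\<Sum>e\<in>Basis. (cplx b e)\<^sup>2))" by (simp only: sum_distrib_left Im_sum)
  also have "(\<Sum>e\<in>Basis. (cplx b e)\<^sup>2) = (\<Sum>i\<in>Basis. if i = b then 1 else 0) + (- 1 :: complex)"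
    unfolding sum_Basis_times_real
    by (intro arg_cong2[of _ _ _ _ "(+)"] sum.cong refl)
      (use assms in \<open>auto simp: cplx_def inner_Basis complex_eq_iff power2_eq_square\<close>)
  also have "\<dots> = 0" using assms by simp
  finally show ?thesis by simp
qed

text \<open>The sum over all directions prevents degeneration: for degree above one, the normal
  derivative of a single \<open>hmono b 1 d\<close> vanishes on a whole hyperplane of the thin
  space.\<close>

definition hpoly :: "nat \<Rightarrow> 'b::euclidean_space \<times> real \<Rightarrow> real" where
  "hpoly d x = (\<Sum>b\<in>Basis. hmono b 1 d x)"

lemma smooth_hpoly: "smooth (hpoly d)"
  unfolding hpoly_def[abs_def] by (intro smooth_sum smooth_hmono)

lemma partial_sum:
  assumes "\<And>i. i \<in> I \<Longrightarrow> smooth (f i)"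
  shows "partial b (\<lambda>x. \<Sum>i\<in>I. f i x) x = (\<Sum>i\<in>I. partial b (f i) x)"
proof -
  have "((\<lambda>x. \<Sum>i\<in>I. f i x) has_derivative (\<lambda>h. \<Sum>i\<in>I. frechet_derivative (f i) (at x) h)) (at x)"
    by (intro has_derivative_sum frechet_derivative_worksI smooth_differentiable assms)
  from partial_eqI[OF this] show ?thesis by (simp add: partial_def)
qed

lemma laplacian_hpoly: "laplacian (hpoly d) x = 0"
proof -
  have 1: "partial e (hpoly d) = (\<lambda>x. \<Sum>b\<in>Basis. partial e (hmono b 1 d) x)" for e :: "'a \<times> real"
    unfolding hpoly_def[abs_def] by (intro ext partial_sum smooth_hmono)
  have "laplacian (hpoly d) x = (\<Sum>e\<in>Basis. \<Sum>b\<in>Basis. partial e (partial e (hmono b 1 d)) x)"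
    unfolding laplacian_def 1
    by (intro sum.cong refl partial_sum smooth_partial smooth_hmono)
  also have "\<dots> = (\<Sum>b\<in>Basis. laplacian (hmono b 1 d) x)"
    unfolding laplacian_def by (rule sum.swap)
  finally show ?thesis by (simp add: laplacian_hmono)
qed

lemma homogeneous_hpoly: "homogeneous (real d) (hpoly d)"
proof -
  have "cplx b (t *\<^sub>R x) = of_real t * cplx b x" for t b and x :: "'a \<times> real"
    by (simp add: scaleR_conv_of_real linear_scale[OF bounded_linear.linear[OF bounded_linear_cplx]])
  then have "hmono b 1 d (t *\<^sub>R x) = t ^ d * hmono b 1 d x" for t b and x :: "'a \<times> real"
    unfolding hmono_def by (simp add: power_mult_distrib of_real_power[symmetric] Im_complex_of_real del: of_real_power)
  then show ?thesis unfolding homogeneous_def hpoly_def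
    by (simp add: powr_realpow sum_distrib_left)
qed

lemma cplx_thin: "cplx b (x', 0) = complex_of_real (x' \<bullet> b)"
  by (simp add: cplx_def complex_eq_iff)

lemma hpoly_thin: "hpoly d (x', 0) = 0"
  unfolding hpoly_def hmono_def cplx_thin by (simp add: of_real_power[symmetric] del: of_real_power)

lemma partial_hpoly_thin: "partial ey (hpoly d) (x', 0) = (\<Sum>b\<in>Basis. real d * (x' \<bullet> b) ^ (d - 1))"
proof -
  have "partial ey (hpoly d) (x', 0) = (\<Sum>b\<in>Basis. partial ey (hmono b 1 d) (x', 0))"
    unfolding hpoly_def[abs_def] by (intro partial_sum smooth_hmono)
  also have "\<dots> = (\<Sum>b\<in>Basis. real d * (x' \<bullet> b) ^ (d - 1))"
  proof (rule sum.cong[OF refl])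
    fix b :: 'a
    have "partial ey (hmono b 1 d) (x', 0) = Im (\<i> * complex_of_real (real d * (x' \<bullet> b) ^ (d - 1)))"
      unfolding partial_hmono hmono_def cplx_thin by (simp add: cplx_def complex_eq_iff Complex_eq)
    then show "partial ey (hmono b 1 d) (x', 0) = real d * (x' \<bullet> b) ^ (d - 1)" by simp
  qed
  finally show ?thesis .
qed

text \<open>Because the degree is odd, the exponent in the normal derivative is even. No term is
  negative, and one with nonzero \<open>x' \<bullet> b\<close> is positive.\<close>

lemma partial_hpoly_thin_pos:
  assumes "x' \<noteq> 0" shows "partial ey (hpoly (2 * m + 1)) (x', 0) > 0"
proof -
  have "x' \<noteq> 0 \<Longrightarrow> \<exists>b\<in>Basis. x' \<bullet> b \<noteq> 0" using euclidean_all_zero_iff by blast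
  with assms obtain b where b: "b \<in> Basis" "x' \<bullet> b \<noteq> 0" by blast
  show ?thesis unfolding partial_hpoly_thin
  proof (rule sum_pos2[OF finite_Basis b(1)])
    show "0 < real (2 * m + 1) * (x' \<bullet> b) ^ (2 * m + 1 - 1)" using b(2) by (simp add: zero_less_power_eq)
    show "0 \<le> real (2 * m + 1) * (x' \<bullet> i) ^ (2 * m + 1 - 1)" for i
      by (simp add: zero_le_even_power)
  qed
qed

lemma partial_hpoly_thin_nonneg: "partial ey (hpoly (2 * m + 1)) (x', 0) \<ge> 0"
  unfolding partial_hpoly_thin by (intro sum_nonneg) (simp add: zero_le_even_power)

section \<open>Compactness of normalized solutions\<close>

definition contact_complement :: "('b::euclidean_space \<times> real \<Rightarrow> real) \<Rightarrow> ('b \<times> real) set" where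
  "contact_complement u = UNIV - {(x', 0) | x'. u (x', 0) = 0}"

lemma smooth_lipschitz:
  fixes f :: "'a::euclidean_space \<Rightarrow> real"
  assumes f: "smooth f" "\<And>x. x \<notin> cball a R \<Longrightarrow> f x = 0"
  obtains L where "L \<ge> 0" "\<And>x y. \<bar>f x - f y\<bar> \<le> L * norm (x - y)"
proof -
  have "\<exists>B\<ge>0. \<forall>x. \<bar>partial b f x\<bar> \<le> B" if "b \<in> Basis" for b
  proof -
    have "partial b f x = 0" if "x \<notin> cball a R" for x
      by (rule partial_zero_outside[of "cball a R"]) (use f(2) that in auto)
    then show ?thesis
      using continuous_bounded_support[OF smooth_continuous[OF smooth_partial[OF f(1) that]], of a R] by metis
  qed
  then obtain B where B: "\<And>b. b \<in> Basis \<Longrightarrow> B b \<ge> 0 \<and> (\<forall>x. \<bar>partial b f x\<bar> \<le> B b)" by metis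
  have "norm (f x - f y) \<le> (\<Sum>b\<in>Basis. B b) * norm (x - y)" for x y
  proof (rule differentiable_bound[of UNIV f "\<lambda>x h. \<Sum>b\<in>Basis. (h \<bullet> b) * partial b f x"])
    show "(f has_derivative (\<lambda>h. \<Sum>b\<in>Basis. (h \<bullet> b) * partial b f x)) (at x within UNIV)" for x
      using has_derivative_partial[OF smooth_differentiable[OF f(1)]] by simp
    show "onorm (\<lambda>h. \<Sum>b\<in>Basis. (h \<bullet> b) * partial b f x) \<le> (\<Sum>b\<in>Basis. B b)" for x
    proof (rule onorm_le)
      fix h :: 'a
      have "\<bar>\<Sum>b\<in>Basis. (h \<bullet> b) * partial b f x\<bar> \<le> (\<Sum>b\<in>Basis. \<bar>(h \<bullet> b) * partial b f x\<bar>)" by (rule sum_abs)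
      also have "\<dots> \<le> (\<Sum>b\<in>Basis. norm h * B b)"
        unfolding abs_mult by (intro sum_mono mult_mono) (use B Basis_le_norm in auto)
      finally show "norm (\<Sum>b\<in>Basis. (h \<bullet> b) * partial b f x) \<le> (\<Sum>b\<in>Basis. B b) * norm h"
        by (simp add: sum_distrib_left mult.commute)
    qed
  qed auto
  moreover have "(\<Sum>b\<in>Basis. B b) \<ge> 0" using B by (simp add: sum_nonneg)
  ultimately show ?thesis using that by simp
qed

text \<open>The sequence assumed in the contradiction argument. The maximum of |u| over the unit
  ball is exactly 1: \<open>le_1\<close> gives compactness, and \<open>attained\<close> keeps the
  limit from being trivial.\<close>

locale blow_up =
  fixes u :: "nat \<Rightarrow> 'b::euclidean_space \<times> real \<Rightarrow> real" and \<mu> :: "nat \<Rightarrow> real" and m :: nat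
  assumes cont: "continuous_on UNIV (u k)"
    and harm: "distr_laplacian_eq_0_on (contact_complement (u k)) (u k)"
    and super: "distr_laplacian_le_0_on UNIV (u k)"
    and nonneg: "u k (x', 0) \<ge> 0"
    and even: "u k (x', - y) = u k (x', y)"
    and hom: "homogeneous (\<mu> k) (u k)"
    and \<mu>_pos: "\<mu> k > 0"
    and \<mu>_lim: "\<mu> \<longlonglongrightarrow> real (2 * m + 1)"
    and \<mu>_le: "\<mu> k \<le> real (2 * m + 2)"
    and \<mu>_ne: "\<mu> k \<noteq> real (2 * m + 1)"
    and le_1: "norm x \<le> 1 \<Longrightarrow> \<bar>u k x\<bar> \<le> 1"
    and attained: "\<exists>x. norm x \<le> 1 \<and> \<bar>u k x\<bar> = 1"
begin

definition d :: real where "d = real (2 * m + 1)"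

lemma upper_sub: "upper \<subseteq> contact_complement (u k)"
  by (auto simp: contact_complement_def)

lemma contact_complement_outside: "z \<notin> contact_complement (u k) \<Longrightarrow> snd z = 0 \<and> u k z = 0"
  by (auto simp: contact_complement_def)

lemma open_contact_complement: "open (contact_complement (u k))"
proof -
  have "closed ({z. snd z = 0} \<inter> {z. u k z = 0})"
    by (intro closed_Int closed_Collect_eq cont continuous_intros)
  moreover have "contact_complement (u k) = - ({z. snd z = 0} \<inter> {z. u k z = 0})"
    by (auto simp: contact_complement_def)
  ultimately show ?thesis by (metis open_Compl)
qed

lemma locbdd_u: "locbdd (u k)" by (rule locbdd_continuous[OF cont])

lemma homog: "t > 0 \<Longrightarrow> u k (t *\<^sub>R x) = t powr \<mu> k * u k x"
  using hom unfolding homogeneous_def by blast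

definition bnd :: "real \<Rightarrow> real" where "bnd R = max 1 R ^ (2 * m + 2)"

lemma bnd_ge: "bnd R \<ge> 1" unfolding bnd_def by (rule one_le_power) simp

text \<open>Homogeneity scales the point into the unit ball. The scale is taken at least 1, so that
  its power is monotone in the exponent and \<open>\<mu>_le\<close> removes the dependence on
  \<open>k\<close>.\<close>

lemma u_bound: assumes "norm x \<le> R" shows "\<bar>u k x\<bar> \<le> bnd R"
proof -
  define S where "S = max 1 R"
  have S: "S \<ge> 1" "norm x \<le> S" using assms by (auto simp: S_def)
  have "u k x = u k (S *\<^sub>R ((1 / S) *\<^sub>R x))" using S by simp
  also have "\<dots> = S powr \<mu> k * u k ((1 / S) *\<^sub>R x)" by (rule homog) (use S in simp)
  finally have "\<bar>u k x\<bar> = S powr \<mu> k * \<bar>u k ((1 / S) *\<^sub>R x)\<bar>" by (simp add: abs_mult)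
  also have "\<dots> \<le> S powr \<mu> k * 1" by (intro mult_left_mono le_1) (use S in \<open>auto simp: field_simps\<close>)
  also have "\<dots> \<le> S powr (real (2 * m + 2))" using S \<mu>_le[of k] by (simp add: powr_mono del: of_nat_add of_nat_mult of_nat_Suc)
  also have "\<dots> = bnd R" using S by (simp add: bnd_def S_def powr_realpow del: of_nat_add of_nat_mult of_nat_Suc)
  finally show ?thesis .
qed

lemma locbdd_upper: "locbdd (indicator (upper :: ('b \<times> real) set) :: _ \<Rightarrow> real)"
  by (intro locbdd_indicator borel_open open_Collect_less continuous_intros)

lemma weight_bounded:
  assumes "R > 0" "smooth P"
  obtains C where "C \<ge> 0" "\<And>k. \<bar>LINT x|lborel. indicator upper x * u k x * P x * ker R 0 x\<bar> \<le> C"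
proof
  have lP: "locbdd P" by (intro locbdd_continuous smooth_continuous assms)
  let ?C = "LINT x|lborel. bnd R * \<bar>P x * ker R 0 x\<bar>"
  have i: "integrable lborel (\<lambda>x. bnd R * \<bar>P x * ker R 0 x\<bar>)"
    by (intro integrable_mult_right integrable_abs integrable_ker lP assms)
  show "?C \<ge> 0" by (rule Bochner_Integration.integral_nonneg) (use bnd_ge[of R] in simp)
  fix k
  have "norm (LINT x|lborel. indicator upper x * u k x * P x * ker R 0 x)
     \<le> (LINT x|lborel. norm (indicator upper x * u k x * P x * ker R 0 x))" by (rule integral_norm_bound)
  also have "\<dots> \<le> ?C"
  proof (rule integral_mono[OF _ i])
    show "integrable lborel (\<lambda>x. norm (indicator upper x * u k x * P x * ker R 0 x))"
      by (intro integrable_norm integrable_ker locbdd_mult locbdd_upper locbdd_u lP assms)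
    fix x
    show "norm (indicator upper x * u k x * P x * ker R 0 x) \<le> bnd R * \<bar>P x * ker R 0 x\<bar>"
    proof (cases "x \<in> ball 0 R")
      case True
      then have "\<bar>indicator upper x * u k x\<bar> \<le> bnd R"
        using u_bound[of x R k] bnd_ge[of R] by (auto simp: indicator_def)
      then have "\<bar>indicator upper x * u k x\<bar> * \<bar>P x * ker R 0 x\<bar> \<le> bnd R * \<bar>P x * ker R 0 x\<bar>"
        by (rule mult_right_mono) simp
      then show ?thesis by (simp add: abs_mult mult.assoc)
    qed (simp add: ker_zero[OF assms(1)])
  qed
  finally show "\<bar>LINT x|lborel. indicator upper x * u k x * P x * ker R 0 x\<bar> \<le> ?C" by simp
qed

lemma hpoly_identity:
  assumes "R > 0"
  shows "(LINT x'|lborel. u k (x', 0) * (partial ey (hpoly (2 * m + 1)) (x', 0) * bump R 0 (x', 0 :: real)))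
    = 2 / R\<^sup>2 * (d - \<mu> k) * (LINT x|lborel. indicator upper x * u k x * hpoly (2 * m + 1) x * ker R 0 x)"
  unfolding d_def
  by (rule frequency_identity[OF cont harm upper_sub hom smooth_hpoly laplacian_hpoly homogeneous_hpoly hpoly_thin assms])

text \<open>\<open>hpoly_identity\<close> bounds the integral of the trace against \<open>G\<close>
  by a constant times |d - \<open>\<mu> k\<close>|. Where \<open>G\<close> is positive this controls
  the trace itself, and the region near the origin contributes little because the traces are
  uniformly bounded.\<close>

lemma trace_tendsto_0:
  assumes "R > 0"
  shows "(\<lambda>k. LINT x'|lborel. indicator (cball 0 R) x' * u k (x', 0)) \<longlonglongrightarrow> 0"
proof -
  \<comment> \<open>The bump has radius \<open>2 * R\<close>, so it is positive on the whole closed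
    ball of radius \<open>R\<close>.\<close>
  define G where "G x' = partial ey (hpoly (2 * m + 1)) (x', 0) * bump (2 * R) 0 (x', 0 :: real)" for x' :: 'b
  define M where "M = bnd R"
  have cG: "continuous_on UNIV G" unfolding G_def
    by (intro continuous_on_mult continuous_thin smooth_continuous smooth_partial smooth_hpoly ey_Basis smooth_bump)
  have G0: "G x' \<ge> 0" for x' unfolding G_def using partial_hpoly_thin_nonneg bump_nonneg by (metis mult_nonneg_nonneg)
  have Gpos: "G x' > 0" if "x' \<noteq> 0" "x' \<in> cball 0 R" for x'
  proof -
    have "norm (x', 0::real) = norm x'" by (simp add: norm_Pair)
    then have "(x', 0::real) \<in> ball 0 (2 * R)" using that assms by auto
    then have "bump (2 * R) 0 (x', 0 :: real) > 0" by (intro bump_pos) (use assms in auto)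
    then show ?thesis unfolding G_def using partial_hpoly_thin_pos[OF that(1)] by simp
  qed
  have cu: "continuous_on UNIV (\<lambda>x'. u k (x', 0))" for k by (rule continuous_thin[OF cont])
  have iG: "integrable lborel (\<lambda>x'. u k (x', 0) * G x')" for k
  proof (rule locbdd_integrable[of _ 0 "2 * R"])
    show "locbdd (\<lambda>x'. u k (x', 0) * G x')" by (intro locbdd_mult locbdd_continuous cu cG)
    fix x' :: 'b assume "x' \<notin> cball 0 (2 * R)"
    then have "(x', 0::real) \<notin> ball 0 (2 * R)" by (auto simp: norm_Pair)
    then show "u k (x', 0) * G x' = 0" using assms by (simp add: G_def bump_zero)
  qed
  obtain C where C: "C \<ge> 0" "\<And>k. \<bar>LINT x|lborel. indicator upper x * u k x * hpoly (2 * m + 1) x * ker (2 * R) 0 x\<bar> \<le> C"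
  proof -
    have "2 * R > 0" using assms by simp
    from weight_bounded[OF this smooth_hpoly] show ?thesis using that by blast
  qed
  have GI: "(\<lambda>k. LINT x'|lborel. u k (x', 0) * G x') \<longlonglongrightarrow> 0"
  proof (rule Lim_null_comparison)
    show "\<forall>\<^sub>F k in sequentially. norm (LINT x'|lborel. u k (x', 0) * G x') \<le> 2 / (2 * R)\<^sup>2 * \<bar>d - \<mu> k\<bar> * C"
    proof (rule always_eventually, rule allI)
      fix k
      have "2 / (2 * R)\<^sup>2 * \<bar>d - \<mu> k\<bar> * \<bar>LINT x|lborel. indicator upper x * u k x * hpoly (2 * m + 1) x * ker (2 * R) 0 x\<bar>
        \<le> 2 / (2 * R)\<^sup>2 * \<bar>d - \<mu> k\<bar> * C"
        by (intro mult_left_mono C) (use assms in auto)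
      then show "norm (LINT x'|lborel. u k (x', 0) * G x') \<le> 2 / (2 * R)\<^sup>2 * \<bar>d - \<mu> k\<bar> * C"
        unfolding G_def using assms by (subst hpoly_identity) (auto simp: abs_mult)
    qed
    have "(\<lambda>k. 2 / (2 * R)\<^sup>2 * \<bar>d - \<mu> k\<bar> * C) \<longlonglongrightarrow> 2 / (2 * R)\<^sup>2 * \<bar>d - d\<bar> * C"
      using \<mu>_lim unfolding d_def by (intro tendsto_intros)
    then show "(\<lambda>k. 2 / (2 * R)\<^sup>2 * \<bar>d - \<mu> k\<bar> * C) \<longlonglongrightarrow> 0" by simp
  qed
  \<comment> \<open>\<open>G\<close> vanishes at the origin, so \<open>u = u (1 - j G) + j u G\<close> is used with \<open>j\<close> large before \<open>k\<close>.\<close>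
  define E where "E j x' = indicator (cball 0 R) x' * (M * max 0 (1 - real j * G x'))" for j and x' :: 'b
  have iE: "integrable lborel (E j)" for j unfolding E_def
    by (intro locbdd_integrable_ball locbdd_continuous continuous_intros cG)
  have Elim: "(\<lambda>j. LINT x'|lborel. E j x') \<longlonglongrightarrow> (LINT x'::'b|lborel. 0)"
  proof (rule integral_dominated_convergence[where w = "\<lambda>x'. indicator (cball 0 R) x' * M"])
    show "integrable lborel (\<lambda>x'::'b. indicator (cball 0 R) x' * M)"
      by (intro locbdd_integrable_ball locbdd_continuous continuous_intros)
    show "E j \<in> borel_measurable lborel" for j using iE by auto
    show "AE x' in lborel. norm (E j x') \<le> indicator (cball 0 R) x' * M" for j
    proof (rule AE_I2)
      fix x' :: 'b
      have "max 0 (1 - real j * G x') \<le> 1" using G0[of x'] by simp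
      then have "M * max 0 (1 - real j * G x') \<le> M * 1"
        using bnd_ge[of R] by (intro mult_left_mono) (auto simp: M_def)
      then show "norm (E j x') \<le> indicator (cball 0 R) x' * M"
        using bnd_ge[of R] by (auto simp: E_def M_def indicator_def abs_mult)
    qed
    show "AE x' in lborel. (\<lambda>j. E j x') \<longlonglongrightarrow> 0"
    \<comment> \<open>The origin, where \<open>G\<close> may vanish, is a null set of the thin
      space.\<close>
    proof (rule AE_mp[OF AE_lborel_singleton[of 0]], rule AE_I2, rule impI)
      fix x' :: 'b assume "x' \<noteq> 0"
      show "(\<lambda>j. E j x') \<longlonglongrightarrow> 0"
      proof (cases "x' \<in> cball 0 R")
        case True
        then have g: "G x' > 0" using Gpos \<open>x' \<noteq> 0\<close> by blast
        obtain j0 :: nat where j0: "real j0 > 1 / G x'" using reals_Archimedean2 by blast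
        have "E j x' = 0" if "j \<ge> j0" for j
        proof -
          have "real j > 1 / G x'" using that j0 by linarith
          then have "1 - real j * G x' \<le> 0" using g by (simp add: field_simps)
          then show ?thesis by (simp add: E_def)
        qed
        then show ?thesis by (intro tendsto_eventually eventually_sequentiallyI[of j0])
      qed (simp add: E_def)
    qed
  qed simp
  have le: "(LINT x'|lborel. indicator (cball 0 R) x' * u k (x', 0))
      \<le> (LINT x'|lborel. E j x') + real j * (LINT x'|lborel. u k (x', 0) * G x')" for j k
  proof -
    have "(LINT x'|lborel. indicator (cball 0 R) x' * u k (x', 0))
      \<le> (LINT x'|lborel. E j x' + real j * (u k (x', 0) * G x'))"
    proof (rule integral_mono)
      show "integrable lborel (\<lambda>x'. indicator (cball 0 R) x' * u k (x', 0))"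
        by (intro locbdd_integrable_ball locbdd_continuous cu)
      show "integrable lborel (\<lambda>x'. E j x' + real j * (u k (x', 0) * G x'))" using iE iG by auto
      fix x' :: 'b
      show "indicator (cball 0 R) x' * u k (x', 0) \<le> E j x' + real j * (u k (x', 0) * G x')"
      proof (cases "x' \<in> cball 0 R")
        case True
        then have "norm (x', 0::real) \<le> R" by (simp add: norm_Pair)
        then have "u k (x', 0) \<le> M" using u_bound[of "(x', 0)" R k] by (simp add: M_def)
        then have "u k (x', 0) * max 0 (1 - real j * G x') \<le> M * max 0 (1 - real j * G x')"
          by (rule mult_right_mono) simp
        moreover have "u k (x', 0) * (1 - real j * G x') \<le> u k (x', 0) * max 0 (1 - real j * G x')"
          by (rule mult_left_mono) (auto simp: nonneg)
        ultimately show ?thesis using True by (simp add: E_def algebra_simps)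
      qed (use G0[of x'] nonneg[of k x'] in \<open>simp add: E_def\<close>)
    qed
    also have "\<dots> = (LINT x'|lborel. E j x') + real j * (LINT x'|lborel. u k (x', 0) * G x')"
      using iE iG by simp
    finally show ?thesis .
  qed
  show ?thesis
  proof (rule LIMSEQ_I)
    fix e :: real assume "e > 0"
    obtain j where j: "norm ((LINT x'|lborel. E j x') - 0) < e / 2"
      using LIMSEQ_D[OF Elim, of "e / 2"] \<open>e > 0\<close> by auto
    have "(\<lambda>k. real j * (LINT x'|lborel. u k (x', 0) * G x')) \<longlonglongrightarrow> 0" by (rule tendsto_mult_right_zero[OF GI])
    then obtain k0 where k0: "\<And>k. k \<ge> k0 \<Longrightarrow> norm (real j * (LINT x'|lborel. u k (x', 0) * G x') - 0) < e / 2"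
      using LIMSEQ_D[of _ 0 "e / 2"] \<open>e > 0\<close> by (meson half_gt_zero)
    have "norm ((LINT x'|lborel. indicator (cball 0 R) x' * u k (x', 0)) - 0) < e" if "k \<ge> k0" for k
    proof -
      have "(LINT x'|lborel. indicator (cball 0 R) x' * u k (x', 0)) \<ge> 0"
        by (rule Bochner_Integration.integral_nonneg) (simp add: nonneg)
      then show ?thesis using le[of k j] j k0[OF that] by simp
    qed
    then show "\<exists>k0. \<forall>k\<ge>k0. norm ((LINT x'|lborel. indicator (cball 0 R) x' * u k (x', 0)) - 0) < e" by blast
  qed
qed

text \<open>A regularized copy of \<open>u k\<close>: it agrees with \<open>kmass\<close> times
  \<open>u k\<close> up to a trace error, while its dependence on \<open>x\<close> sits in the
  smooth kernel alone. The pair \<open>(fst x, snd x)\<close> is spelled out to match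
  \<open>half_space_mean\<close>.\<close>

definition smear :: "nat \<Rightarrow> 'b \<times> real \<Rightarrow> real" where
  "smear k x = (LINT w|lborel. indicator upper w * u k w * (ker 1 (fst x, snd x) w - ker 1 (fst x, - snd x) w))"

lemma smear_estimate:
  assumes "0 < h" "h \<le> 1" "h \<le> snd x" "norm (fst x) \<le> R"
  shows "\<bar>smear k x - kmass TYPE('b \<times> real) * u k x\<bar>
    \<le> 4 / h ^ DIM('b \<times> real) * (LINT x'|lborel. indicator (cball 0 (R + 1)) x' * u k (x', 0))"
  unfolding smear_def
  using half_space_mean[OF cont harm upper_sub nonneg assms(1,2,3,4), of k] by simp

text \<open>Only the kernel depends on \<open>x\<close>, so its Lipschitz constant carries over. For
  centres of norm at most 2 the kernels live in the ball of radius 3, where \<open>u k\<close> is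
  bounded by \<open>bnd 3\<close> for every \<open>k\<close>.\<close>

lemma smear_bounds:
  obtains M L where "\<And>k x. norm x \<le> 2 \<Longrightarrow> \<bar>smear k x\<bar> \<le> M" "L \<ge> 0"
    "\<And>k x y. norm x \<le> 2 \<Longrightarrow> norm y \<le> 2 \<Longrightarrow> \<bar>smear k x - smear k y\<bar> \<le> L * norm (x - y)"
proof -
  obtain L where L: "L \<ge> 0" "\<And>x y. \<bar>ker 1 (0::'b \<times> real) x - ker 1 0 y\<bar> \<le> L * norm (x - y)"
  proof (rule smooth_lipschitz[OF smooth_ker[of 1 "0::'b \<times> real"], of 0 1])
    show "ker 1 0 x = 0" if "x \<notin> cball 0 1" for x :: "'b \<times> real"
    proof -
      have "x \<notin> ball 0 1" using that by auto
      then show ?thesis by (rule ker_zero[OF zero_less_one])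
    qed
  qed (use that in blast)
  define V where "V = (LINT w::'b \<times> real|lborel. indicator (cball 0 3) w * bnd 3)"
  have iV: "integrable lborel (\<lambda>w::'b \<times> real. indicator (cball 0 3) w * bnd 3)"
    by (intro locbdd_integrable_ball locbdd_continuous continuous_intros)
  have V0: "V \<ge> 0" unfolding V_def by (rule Bochner_Integration.integral_nonneg) (use bnd_ge[of 3] in simp)
  define K where "K x w = ker 1 (fst x, snd x) w - ker 1 (fst x, - snd x) w" for x w :: "'b \<times> real"
  have refl_norm: "norm (fst x, - snd x) = norm x" for x :: "'b \<times> real" by (cases x) (simp add: norm_Pair)
  have K0: "K x w = 0" if "norm x \<le> 2" "w \<notin> cball 0 3" for x w
  proof -
    have "w \<notin> ball a 1" if "norm a \<le> 2" for a
      using that \<open>w \<notin> cball 0 3\<close> norm_triangle_sub[of w a] by (auto simp: dist_norm norm_minus_commute)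
    then have "w \<notin> ball (fst x, snd x) 1" "w \<notin> ball (fst x, - snd x) 1"
      using that(1) refl_norm[of x] by auto
    then show ?thesis unfolding K_def by (simp add: ker_zero del: mem_ball)
  qed
  have kshift: "ker 1 a w = ker 1 0 (w - a)" for a w :: "'b \<times> real" by (simp add: ker_def sqd_def)
  have Kd: "\<bar>K x w - K y w\<bar> \<le> 2 * L * norm (x - y)" for x y w
  proof -
    have "\<bar>ker 1 a w - ker 1 b w\<bar> \<le> L * norm (a - b)" for a b
      unfolding kshift[of a] kshift[of b] using L(2)[of "w - a" "w - b"] by (simp add: norm_minus_commute)
    from this[of x y] this[of "(fst x, - snd x)" "(fst y, - snd y)"]
    have "\<bar>K x w - K y w\<bar> \<le> L * norm (x - y) + L * norm ((fst x, - snd x) - (fst y, - snd y))"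
      unfolding K_def by simp
    also have "(fst x, - snd x) - (fst y, - snd y) = (fst (x - y), - snd (x - y))" by simp
    finally show ?thesis unfolding refl_norm by simp
  qed
  have Kb: "\<bar>K x w\<bar> \<le> 2" for x w
    using ker_le[of 1 "(fst x, snd x)" w] ker_le[of 1 "(fst x, - snd x)" w]
      ker_nonneg[of 1 "(fst x, snd x)" w] ker_nonneg[of 1 "(fst x, - snd x)" w] unfolding K_def by linarith
  have ub: "\<bar>indicator upper w * u k w\<bar> \<le> bnd 3" if "w \<in> cball 0 3" for w k
    using u_bound[of w 3 k] that bnd_ge[of 3] by (auto simp: indicator_def)
  have iK: "integrable lborel (\<lambda>w. indicator upper w * u k w * K x w)" for k x
    unfolding K_def right_diff_distrib
    by (intro Bochner_Integration.integrable_diff integrable_ker locbdd_mult locbdd_upper locbdd_u) auto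
  have gen: "\<bar>LINT w|lborel. indicator upper w * u k w * D w\<bar> \<le> c * V"
    if "integrable lborel (\<lambda>w. indicator upper w * u k w * D w)" "\<And>w. \<bar>D w\<bar> \<le> c" "\<And>w. w \<notin> cball 0 3 \<Longrightarrow> D w = 0" for D c k
  proof -
    have "norm (LINT w|lborel. indicator upper w * u k w * D w) \<le> (LINT w|lborel. norm (indicator upper w * u k w * D w))"
      by (rule integral_norm_bound)
    also have "\<dots> \<le> (LINT w::'b \<times> real|lborel. c * (indicator (cball 0 3) w * bnd 3))"
    proof (rule integral_mono)
      show "integrable lborel (\<lambda>w. norm (indicator upper w * u k w * D w))" using that(1) by (rule integrable_norm)
      show "integrable lborel (\<lambda>w::'b \<times> real. c * (indicator (cball 0 3) w * bnd 3))" by (rule integrable_mult_right[OF iV])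
      fix w :: "'b \<times> real"
      show "norm (indicator upper w * u k w * D w) \<le> c * (indicator (cball 0 3) w * bnd 3)"
      proof (cases "w \<in> cball 0 3")
        case True
        have "\<bar>indicator upper w * u k w\<bar> * \<bar>D w\<bar> \<le> bnd 3 * c"
          by (intro mult_mono ub that(2)) (use True bnd_ge[of 3] in auto)
        then show ?thesis using True by (simp add: abs_mult mult.commute)
      qed (simp add: that(3))
    qed
    also have "\<dots> = c * V" by (simp add: V_def)
    finally show ?thesis by simp
  qed
  show ?thesis
  proof (rule that[of "2 * V" "2 * L * V"])
    show "\<bar>smear k x\<bar> \<le> 2 * V" if "norm x \<le> 2" for k x
      unfolding smear_def K_def[symmetric] by (rule gen[OF iK Kb K0[OF that]])
    show "2 * L * V \<ge> 0" using L V0 by simp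
    show "\<bar>smear k x - smear k y\<bar> \<le> 2 * L * V * norm (x - y)" if "norm x \<le> 2" "norm y \<le> 2" for k x y
    proof -
      have eq: "smear k x - smear k y = (LINT w|lborel. indicator upper w * u k w * (K x w - K y w))"
        unfolding smear_def K_def[symmetric] right_diff_distrib[of _ "K x _"] using iK by simp
      have "\<bar>smear k x - smear k y\<bar> \<le> (2 * L * norm (x - y)) * V"
        unfolding eq
      proof (rule gen)
        show "integrable lborel (\<lambda>w. indicator upper w * u k w * (K x w - K y w))"
          unfolding right_diff_distrib using iK by auto
      qed (use Kd K0 that in auto)
      then show ?thesis by (simp add: mult_ac)
    qed
  qed
qed

text \<open>Arzela-Ascoli is applied to \<open>smear\<close>, since equicontinuity of
  \<open>u\<close> near the thin space has not been established. At height at least \<open>h\<close>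
  the difference between the two is a constant depending on \<open>h\<close> times the trace
  integral, which tends to zero.\<close>

lemma subsequence_converges:
  obtains g r where "strict_mono (r :: nat \<Rightarrow> nat)"
    "\<And>h e. h > 0 \<Longrightarrow> e > 0 \<Longrightarrow> \<exists>k0. \<forall>k\<ge>k0. \<forall>x. norm x \<le> 2 \<longrightarrow> snd x \<ge> h \<longrightarrow> \<bar>u (r k) x - g x\<bar> < e"
proof -
  let ?c = "kmass TYPE('b \<times> real)"
  note c = kmass_pos[where 'a = "'b \<times> real"]
  obtain M L where bds: "\<And>k x. norm x \<le> 2 \<Longrightarrow> \<bar>smear k x\<bar> \<le> M" "L \<ge> 0"
    "\<And>k x y. norm x \<le> 2 \<Longrightarrow> norm y \<le> 2 \<Longrightarrow> \<bar>smear k x - smear k y\<bar> \<le> L * norm (x - y)"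
    using smear_bounds by blast
  obtain g r where r: "strict_mono (r :: nat \<Rightarrow> nat)" 
    and conv: "\<And>e. 0 < e \<Longrightarrow> \<exists>N. \<forall>n x. n \<ge> N \<and> x \<in> cball 0 2 \<longrightarrow> norm (smear (r n) x - g x) < e"
  proof (rule Arzela_Ascoli[of "cball (0::'b \<times> real) 2" smear M])
    show "norm (smear n x) \<le> M" if "x \<in> cball 0 2" for n x using bds(1) that by simp
    show "\<exists>d>0. \<forall>n y. y \<in> cball 0 2 \<and> norm (x - y) < d \<longrightarrow> norm (smear n x - smear n y) < e"
      if x: "x \<in> cball 0 2" "0 < e" for x e
    proof (intro exI[of _ "e / (L + 1)"] conjI allI impI)
      show "e / (L + 1) > 0" using bds(2) x by simp
      fix n y assume y: "y \<in> cball 0 2 \<and> norm (x - y) < e / (L + 1)"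
      have "norm (smear n x - smear n y) \<le> L * norm (x - y)" using bds(3) x y by simp
      also have "\<dots> \<le> (L + 1) * norm (x - y)" by (intro mult_right_mono) auto
      also have "\<dots> < e" using y bds(2) by (simp add: field_simps)
      finally show "norm (smear n x - smear n y) < e" .
    qed
  qed (use that in auto)
  show ?thesis
  proof (rule that[OF r, of "\<lambda>x. g x / ?c"])
    fix h e :: real assume h: "h > 0" and e: "e > 0"
    define h' where "h' = min h 1"
    have h': "0 < h'" "h' \<le> 1" "h' \<le> h" using h by (auto simp: h'_def)
    obtain N1 where N1: "\<And>n x. n \<ge> N1 \<Longrightarrow> norm x \<le> 2 \<Longrightarrow> norm (smear (r n) x - g x) < e * ?c / 2"
      using conv[of "e * ?c / 2"] e c by auto
    have "(\<lambda>k. LINT x'|lborel. indicator (cball 0 (2 + 1)) x' * u k (x', 0)) \<longlonglongrightarrow> 0"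
      by (rule trace_tendsto_0) simp
    then have "(\<lambda>k. LINT x'|lborel. indicator (cball 0 (2 + 1)) x' * u (r k) (x', 0)) \<longlonglongrightarrow> 0"
      using LIMSEQ_subseq_LIMSEQ[OF _ r] unfolding comp_def by blast
    then have "(\<lambda>k. 4 / h' ^ DIM('b \<times> real) * (LINT x'|lborel. indicator (cball 0 (2 + 1)) x' * u (r k) (x', 0))) \<longlonglongrightarrow> 0"
      by (rule tendsto_mult_right_zero)
    moreover have "e * ?c / 2 > 0" using e c by simp
    ultimately have "\<forall>\<^sub>F k in sequentially. 4 / h' ^ DIM('b \<times> real) * (LINT x'|lborel. indicator (cball 0 (2 + 1)) x' * u (r k) (x', 0)) < e * ?c / 2"
      by (rule order_tendstoD(2))
    then obtain N2 where N2: "\<And>k. k \<ge> N2 \<Longrightarrow> 4 / h' ^ DIM('b \<times> real) * (LINT x'|lborel. indicator (cball 0 (2 + 1)) x' * u (r k) (x', 0)) < e * ?c / 2"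
      unfolding eventually_sequentially by blast
    show "\<exists>k0. \<forall>k\<ge>k0. \<forall>x. norm x \<le> 2 \<longrightarrow> snd x \<ge> h \<longrightarrow> \<bar>u (r k) x - g x / ?c\<bar> < e"
    proof (intro exI[of _ "max N1 N2"] allI impI)
      fix k x assume k: "k \<ge> max N1 N2" and x: "norm (x :: 'b \<times> real) \<le> 2" "snd x \<ge> h"
      have "norm (fst x) \<le> 2" using x(1) norm_fst_le[of "fst x" "snd x"] by simp
      with smear_estimate[of h' x 2 "r k"] h' x(2)
      have 1: "\<bar>smear (r k) x - ?c * u (r k) x\<bar> < e * ?c / 2" using N2[of k] k by auto
      have 2: "\<bar>smear (r k) x - g x\<bar> < e * ?c / 2" using N1[of k x] k x by auto
      have "\<bar>?c * u (r k) x - g x\<bar> < e * ?c" using 1 2 by linarith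
      moreover have "?c * u (r k) x - g x = ?c * (u (r k) x - g x / ?c)" using c by (simp add: right_diff_distrib)
      ultimately have "?c * \<bar>u (r k) x - g x / ?c\<bar> < ?c * e" using c by (simp add: abs_mult mult.commute)
      then show "\<bar>u (r k) x - g x / ?c\<bar> < e" using c by (simp only: mult_less_cancel_left_pos)
    qed
  qed
qed

end

section \<open>The limit profile: oddness, homogeneity and harmonicity\<close>

definition mirror :: "'b::euclidean_space \<times> real \<Rightarrow> 'b \<times> real" where
  "mirror x = (fst x, - snd x)"

lemma mirror_mirror [simp]: "mirror (mirror x) = x" by (simp add: mirror_def)
lemma fst_mirror [simp]: "fst (mirror x) = fst x" by (simp add: mirror_def)
lemma snd_mirror [simp]: "snd (mirror x) = - snd x" by (simp add: mirror_def)
lemma norm_mirror [simp]: "norm (mirror x) = norm x"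
  by (cases x) (simp add: mirror_def norm_Pair)
lemma ker_mirror: "ker r (mirror a) (mirror w) = ker r a w"
proof -
  have "mirror w - mirror a = mirror (w - a)" by (simp add: mirror_def)
  then show ?thesis by (simp add: ker_def sqd_norm)
qed

lemma lint_mirror:
  fixes f :: "'b::euclidean_space \<times> real \<Rightarrow> real"
  assumes "f \<in> borel_measurable borel"
  shows "(LINT w|lborel. f (mirror w)) = (LINT w|lborel. f w)"
  using lint_scale_snd[OF _ assms, of "-1"] by (simp add: mirror_def)

lemma partial_homogeneous:
  fixes P :: "'a::euclidean_space \<Rightarrow> real"
  assumes "smooth P" "homogeneous d P" "t > 0"
  shows "partial b P (t *\<^sub>R x) = t powr (d - 1) * partial b P x"
proof -
  let ?D = "\<lambda>x. frechet_derivative P (at x)"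
  have D: "(P has_derivative ?D x) (at x)" for x
    by (intro frechet_derivative_worksI smooth_differentiable assms)
  have "((\<lambda>y. t *\<^sub>R y) has_derivative (\<lambda>h. t *\<^sub>R h)) (at x)" by (auto intro!: derivative_eq_intros)
  from has_derivative_compose[OF this D[of "t *\<^sub>R x"]]
  have "((\<lambda>y. P (t *\<^sub>R y)) has_derivative (\<lambda>h. ?D (t *\<^sub>R x) (t *\<^sub>R h))) (at x)" .
  moreover have "(\<lambda>y. P (t *\<^sub>R y)) = (\<lambda>y. t powr d * P y)"
    using assms(2,3) unfolding homogeneous_def by blast
  ultimately have 1: "((\<lambda>y. t powr d * P y) has_derivative (\<lambda>h. ?D (t *\<^sub>R x) (t *\<^sub>R h))) (at x)" by simp
  have 2: "((\<lambda>y. t powr d * P y) has_derivative (\<lambda>h. t powr d * ?D x h)) (at x)"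
    by (rule has_derivative_mult_right[OF D])
  have "?D (t *\<^sub>R x) (t *\<^sub>R b) = t powr d * ?D x b"
    using has_derivative_unique[OF 1 2] by metis
  moreover have "?D (t *\<^sub>R x) (t *\<^sub>R b) = t * ?D (t *\<^sub>R x) b"
    using linear_scale[OF has_derivative_linear[OF D]] by simp
  ultimately show ?thesis using assms(3) by (simp add: partial_def powr_diff field_simps)
qed

text \<open>The sequence has been replaced by a subsequence. The function \<open>g\<close> is
  controlled only at positive heights in the ball of radius 2.\<close>

locale blow_up_limit = blow_up +
  fixes g :: "'a \<times> real \<Rightarrow> real"
  assumes unif: "h > 0 \<Longrightarrow> e > 0 \<Longrightarrow> \<exists>k0. \<forall>k\<ge>k0. \<forall>x. norm x \<le> 2 \<longrightarrow> snd x \<ge> h \<longrightarrow> \<bar>u k x - g x\<bar> < e"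
begin

text \<open>Only values of \<open>g\<close> on the open upper half of the unit sphere matter;
  homogeneity and odd reflection supply the rest. Since \<open>sgn 0 = 0\<close>, the thin space and
  the origin get the value zero whatever \<open>g\<close> is there.\<close>

definition Q :: "'a \<times> real \<Rightarrow> real" where
  "Q x = sgn (snd x) * (norm x powr d * g ((1 / norm x) *\<^sub>R (if snd x > 0 then x else mirror x)))"

lemma u_mirror: "u k (mirror x) = u k x"
  using even[of k "fst x" "snd x"] by (simp add: mirror_def)

lemma Q_mirror: "Q (mirror x) = - Q x"
  by (cases "snd x" "0::real" rule: linorder_cases) (auto simp: Q_def)

lemma Q_thin: "Q (x', 0) = 0" by (simp add: Q_def)

lemma u_tendsto_g:
  assumes "norm x \<le> 2" "snd x > 0" shows "(\<lambda>k. u k x) \<longlonglongrightarrow> g x"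
proof (rule LIMSEQ_I)
  fix e :: real assume "e > 0"
  from unif[OF assms(2) this] obtain k0
    where "\<And>k. k \<ge> k0 \<Longrightarrow> norm x \<le> 2 \<Longrightarrow> snd x \<ge> snd x \<Longrightarrow> \<bar>u k x - g x\<bar> < e" by blast
  then show "\<exists>k0. \<forall>k\<ge>k0. norm (u k x - g x) < e" using assms(1) by auto
qed

lemma u_tendsto: assumes "snd x > 0" shows "(\<lambda>k. u k x) \<longlonglongrightarrow> Q x"
proof -
  have n: "norm x > 0" using assms by (cases "x = 0") auto
  have "(\<lambda>k. norm x powr \<mu> k * u k ((1 / norm x) *\<^sub>R x)) \<longlonglongrightarrow> norm x powr d * g ((1 / norm x) *\<^sub>R x)"
    by (intro tendsto_mult tendsto_powr tendsto_const u_tendsto_g \<mu>_lim[folded d_def]) (use n assms in auto)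
  moreover have "norm x powr \<mu> k * u k ((1 / norm x) *\<^sub>R x) = u k x" for k
    using homog[OF n, of k "(1 / norm x) *\<^sub>R x"] n by simp
  ultimately show ?thesis using assms by (simp add: Q_def)
qed

text \<open>With the sign in front, convergence holds at every point, the thin space included.
  Homogeneity, growth bound and measurability of \<open>Q\<close> can then be read off as properties
  of pointwise limits.\<close>

lemma sgn_u_tendsto: "(\<lambda>k. sgn (snd x) * u k x) \<longlonglongrightarrow> Q x"
proof (cases "snd x" "0::real" rule: linorder_cases)
  case less
  then have "(\<lambda>k. u k (mirror x)) \<longlonglongrightarrow> Q (mirror x)" by (intro u_tendsto) simp
  then have "(\<lambda>k. - u k x) \<longlonglongrightarrow> - (- Q x)" unfolding u_mirror Q_mirror by (rule tendsto_minus)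
  then show ?thesis using less by simp
next
  case equal then show ?thesis by (simp add: Q_def)
next
  case greater then show ?thesis using u_tendsto[OF greater] by simp
qed

lemma Q_homogeneous: "homogeneous d Q"
  unfolding homogeneous_def
proof (intro allI impI)
  fix t :: real and x assume t: "t > 0"
  have "(\<lambda>k. t powr \<mu> k * (sgn (snd x) * u k x)) \<longlonglongrightarrow> t powr d * Q x"
    by (intro tendsto_mult tendsto_powr tendsto_const sgn_u_tendsto \<mu>_lim[folded d_def]) (use t in auto)
  moreover have "t powr \<mu> k * (sgn (snd x) * u k x) = sgn (snd (t *\<^sub>R x)) * u k (t *\<^sub>R x)" for k
    using homog[OF t] t by (simp add: sgn_mult)
  ultimately have "(\<lambda>k. sgn (snd (t *\<^sub>R x)) * u k (t *\<^sub>R x)) \<longlonglongrightarrow> t powr d * Q x" by simp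
  then show "Q (t *\<^sub>R x) = t powr d * Q x" by (rule LIMSEQ_unique[OF sgn_u_tendsto])
qed

lemma Q_bound: assumes "norm x \<le> R" shows "\<bar>Q x\<bar> \<le> bnd R"
proof (rule LIMSEQ_le_const2)
  show "(\<lambda>k. \<bar>sgn (snd x) * u k x\<bar>) \<longlonglongrightarrow> \<bar>Q x\<bar>" by (intro tendsto_rabs sgn_u_tendsto)
  have "\<bar>sgn (snd x) * u k x\<bar> \<le> bnd R" for k
    using u_bound[OF assms, of k] bnd_ge[of R] by (simp add: abs_mult sgn_if)
  then show "\<exists>N. \<forall>n\<ge>N. \<bar>sgn (snd x) * u n x\<bar> \<le> bnd R" by blast
qed

lemma locbdd_Q: "locbdd Q"
proof -
  have "Q \<in> borel_measurable borel"
  proof (rule borel_measurable_LIMSEQ_real[OF sgn_u_tendsto])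
    have 1: "(\<lambda>x. snd x) \<in> borel_measurable (borel :: ('a \<times> real) measure)"
      by (intro borel_measurable_continuous_onI continuous_intros)
    have 2: "u k \<in> borel_measurable borel" for k using locbdd_measurable[OF locbdd_u] .
    show "(\<lambda>x. sgn (snd x) * u k x) \<in> borel_measurable borel" for k
      using 1 2[of k] unfolding sgn_if by measurable
  qed
  then show ?thesis unfolding locbdd_def using Q_bound by blast
qed

lemma unif_Q:
  assumes "h > 0" "e > 0"
  shows "\<forall>\<^sub>F k in sequentially. \<forall>x. norm x \<le> 2 \<longrightarrow> snd x \<ge> h \<longrightarrow> \<bar>u k x - Q x\<bar> < e"
proof -
  have "Q x = g x" if "norm x \<le> 2" "snd x \<ge> h" for x
  proof (rule LIMSEQ_unique)
    show "(\<lambda>k. u k x) \<longlonglongrightarrow> Q x" by (rule u_tendsto) (use that assms in simp)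
    show "(\<lambda>k. u k x) \<longlonglongrightarrow> g x" by (rule u_tendsto_g) (use that assms in auto)
  qed
  then show ?thesis using unif[OF assms] unfolding eventually_sequentially by metis
qed

lemma lim_upper_integral:
  assumes \<psi>: "continuous_on UNIV \<psi>" "\<And>x. x \<notin> cball 0 R \<Longrightarrow> \<psi> x = 0"
  shows "(\<lambda>k. LINT w|lborel. indicator upper w * u k w * \<psi> w) \<longlonglongrightarrow> (LINT w|lborel. indicator upper w * Q w * \<psi> w)"
proof (rule integral_dominated_convergence[where w = "\<lambda>w. bnd R * \<bar>\<psi> w\<bar>"])
  have l\<psi>: "locbdd \<psi>" by (rule locbdd_continuous[OF \<psi>(1)])
  show "(\<lambda>w. indicator upper w * Q w * \<psi> w) \<in> borel_measurable lborel"
    using locbdd_measurable[OF locbdd_mult[OF locbdd_mult[OF locbdd_upper locbdd_Q] l\<psi>]] by simp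
  show "(\<lambda>w. indicator upper w * u k w * \<psi> w) \<in> borel_measurable lborel" for k
    using locbdd_measurable[OF locbdd_mult[OF locbdd_mult[OF locbdd_upper locbdd_u] l\<psi>]] by simp
  show "integrable lborel (\<lambda>w. bnd R * \<bar>\<psi> w\<bar>)"
    by (intro integrable_mult_right integrable_abs locbdd_integrable[OF l\<psi> \<psi>(2)])
  show "AE w in lborel. (\<lambda>k. indicator upper w * u k w * \<psi> w) \<longlonglongrightarrow> indicator upper w * Q w * \<psi> w"
  proof (rule AE_I2)
    fix w :: "'a \<times> real"
    show "(\<lambda>k. indicator upper w * u k w * \<psi> w) \<longlonglongrightarrow> indicator upper w * Q w * \<psi> w"
      using u_tendsto[of w] by (cases "w \<in> upper") (auto intro!: tendsto_intros)
  qed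
  show "AE w in lborel. norm (indicator upper w * u k w * \<psi> w) \<le> bnd R * \<bar>\<psi> w\<bar>" for k
  proof (rule AE_I2)
    fix w :: "'a \<times> real"
    show "norm (indicator upper w * u k w * \<psi> w) \<le> bnd R * \<bar>\<psi> w\<bar>"
    proof (cases "w \<in> cball 0 R")
      case True
      then have "\<bar>indicator upper w * u k w\<bar> \<le> bnd R"
        using u_bound[of w R k] bnd_ge[of R] by (auto simp: indicator_def)
      then have "\<bar>indicator upper w * u k w\<bar> * \<bar>\<psi> w\<bar> \<le> bnd R * \<bar>\<psi> w\<bar>" by (rule mult_right_mono) simp
      then show ?thesis by (simp add: abs_mult)
    qed (simp add: \<psi>(2))
  qed
qed

lemma ker_outside: "norm a + 1 \<le> R \<Longrightarrow> x \<notin> cball 0 R \<Longrightarrow> ker 1 a x = 0" for a x :: "'a \<times> real"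
proof -
  assume "norm a + 1 \<le> R" "x \<notin> cball 0 R"
  then have "x \<notin> ball a 1" using norm_triangle_sub[of x a] by (auto simp: dist_norm norm_minus_commute)
  then show ?thesis by (rule ker_zero[OF zero_less_one])
qed

lemma Q_mean_mirror: "(LINT w|lborel. Q w * ker 1 (mirror x) w) = - (LINT w|lborel. Q w * ker 1 x w)"
proof -
  have "(LINT w|lborel. Q w * ker 1 (mirror x) w) = (LINT w|lborel. Q (mirror w) * ker 1 (mirror x) (mirror w))"
    by (rule lint_mirror[symmetric])
      (intro locbdd_measurable locbdd_mult locbdd_Q locbdd_continuous smooth_continuous smooth_ker)
  also have "\<dots> = - (LINT w|lborel. Q w * ker 1 x w)" unfolding Q_mirror ker_mirror by simp
  finally show ?thesis .
qed

text \<open>The trace error in \<open>smear_estimate\<close> tends to zero, so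
  \<open>smear k x\<close> converges to \<open>kmass\<close> times \<open>Q x\<close>; by dominated
  convergence it also converges to the integral with \<open>Q\<close> in place of
  \<open>u k\<close>. Reflecting the second kernel and using that \<open>Q\<close> is odd turns this
  half-space integral into one over the whole space.\<close>

lemma Q_mean_upper:
  assumes "snd x > 0" shows "kmass TYPE('a \<times> real) * Q x = (LINT w|lborel. Q w * ker 1 x w)"
proof -
  let ?N = "DIM('a \<times> real)"
  define h where "h = min 1 (snd x)"
  have "(\<lambda>k. smear k x - kmass TYPE('a \<times> real) * u k x) \<longlonglongrightarrow> 0"
  proof (rule Lim_null_comparison)
    show "\<forall>\<^sub>F k in sequentially. norm (smear k x - kmass TYPE('a \<times> real) * u k x)
      \<le> 4 / h ^ ?N * (LINT x'|lborel. indicator (cball 0 (norm (fst x) + 1)) x' * u k (x', 0))"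
      unfolding real_norm_def
      by (intro always_eventually allI smear_estimate) (use assms in \<open>auto simp: h_def\<close>)
    show "(\<lambda>k. 4 / h ^ ?N * (LINT x'|lborel. indicator (cball 0 (norm (fst x) + 1)) x' * u k (x', 0))) \<longlonglongrightarrow> 0"
      by (intro tendsto_mult_right_zero trace_tendsto_0) (simp add: add_nonneg_pos)
  qed
  moreover have "(\<lambda>k. kmass TYPE('a \<times> real) * u k x) \<longlonglongrightarrow> kmass TYPE('a \<times> real) * Q x"
    by (intro tendsto_intros u_tendsto assms)
  ultimately have "(\<lambda>k. (smear k x - kmass TYPE('a \<times> real) * u k x) + kmass TYPE('a \<times> real) * u k x)
      \<longlonglongrightarrow> 0 + kmass TYPE('a \<times> real) * Q x" by (rule tendsto_add)
  then have 1: "(\<lambda>k. smear k x) \<longlonglongrightarrow> kmass TYPE('a \<times> real) * Q x" by simp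
  have 2: "(\<lambda>k. smear k x) \<longlonglongrightarrow> (LINT w|lborel. indicator upper w * Q w * (ker 1 x w - ker 1 (mirror x) w))"
    unfolding smear_def mirror_def[symmetric] prod.collapse
  proof (rule lim_upper_integral[where R = "norm x + 1"])
    show "continuous_on UNIV (\<lambda>w. ker 1 x w - ker 1 (mirror x) w)"
      by (intro continuous_intros smooth_continuous smooth_ker)
    show "ker 1 x w - ker 1 (mirror x) w = 0" if "w \<notin> cball 0 (norm x + 1)" for w
      using ker_outside[OF _ that, of x] ker_outside[OF _ that, of "mirror x"] by simp
  qed
  have lu: "locbdd (\<lambda>w. indicator upper w * Q w)" by (intro locbdd_mult locbdd_upper locbdd_Q)
  have i: "integrable lborel (\<lambda>w. indicator upper w * Q w * ker 1 a w)" for a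
    by (rule integrable_ker[OF lu]) simp
  have m: "(\<lambda>w. indicator upper w * Q w * ker 1 (mirror x) w) \<in> borel_measurable borel"
    by (intro locbdd_measurable locbdd_mult[OF lu] locbdd_continuous smooth_continuous smooth_ker)
  have e: "indicator upper (mirror w) * Q (mirror w) * ker 1 (mirror x) (mirror w)
      = - (indicator {w. snd w < 0} w * Q w * ker 1 x w)" for w
    unfolding Q_mirror ker_mirror by (simp add: indicator_def)
  have lo: "locbdd (\<lambda>w. indicator {w::'a \<times> real. snd w < 0} w * Q w)"
    by (intro locbdd_mult locbdd_indicator locbdd_Q borel_open open_Collect_less continuous_intros)
  have i2: "integrable lborel (\<lambda>w. indicator {w. snd w < 0} w * Q w * ker 1 x w)"
    by (rule integrable_ker[OF lo]) simp
  have "(LINT w|lborel. indicator upper w * Q w * (ker 1 x w - ker 1 (mirror x) w))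
    = (LINT w|lborel. indicator upper w * Q w * ker 1 x w) - (LINT w|lborel. indicator upper w * Q w * ker 1 (mirror x) w)"
    using i by (simp add: right_diff_distrib)
  also have "(LINT w|lborel. indicator upper w * Q w * ker 1 (mirror x) w)
    = - (LINT w|lborel. indicator {w. snd w < 0} w * Q w * ker 1 x w)"
    unfolding lint_mirror[OF m, symmetric] e by simp
  also have "(LINT w|lborel. indicator upper w * Q w * ker 1 x w) - - (LINT w|lborel. indicator {w. snd w < 0} w * Q w * ker 1 x w)
    = (LINT w|lborel. indicator upper w * Q w * ker 1 x w + indicator {w. snd w < 0} w * Q w * ker 1 x w)"
    using i i2 by simp
  also have "\<dots> = (LINT w|lborel. Q w * ker 1 x w)"
  proof (rule Bochner_Integration.integral_cong[OF refl])
    fix w show "indicator upper w * Q w * ker 1 x w + indicator {w. snd w < 0} w * Q w * ker 1 x w = Q w * ker 1 x w"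
      using Q_thin[of "fst w"] by (cases w, cases "snd w" "0::real" rule: linorder_cases) auto
  qed
  finally show ?thesis using LIMSEQ_unique[OF 1 2] by simp
qed

text \<open>The lower half-space follows by reflection, and on the thin space both sides vanish by
  oddness.\<close>

lemma Q_mean: "kmass TYPE('a \<times> real) * Q x = (LINT w|lborel. Q w * ker 1 x w)"
proof (cases "snd x" "0::real" rule: linorder_cases)
  case less
  then have "kmass TYPE('a \<times> real) * Q (mirror x) = (LINT w|lborel. Q w * ker 1 (mirror x) w)"
    by (intro Q_mean_upper) simp
  then show ?thesis unfolding Q_mirror Q_mean_mirror by simp
next
  case equal
  then have "mirror x = x" by (simp add: mirror_def prod_eq_iff)
  then have "(LINT w|lborel. Q w * ker 1 x w) = 0" "Q x = 0" using Q_mean_mirror[of x] Q_mirror[of x] by auto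
  then show ?thesis by simp
qed (rule Q_mean_upper)

text \<open>By \<open>Q_mean\<close>, \<open>Q\<close> is a multiple of its own convolution with a
  smooth kernel. This gives smoothness across the thin space without any prior continuity
  there.\<close>

lemma smooth_Q: "smooth Q"
proof -
  have k: "ker 1 x w = ker 1 0 (x - w)" for x w :: "'a \<times> real"
    by (simp add: ker_def sqd_norm norm_minus_commute)
  have "Q = (\<lambda>x. inverse (kmass TYPE('a \<times> real)) * conv Q (ker 1 0) x)"
    using Q_mean kmass_pos[where 'a = "'a \<times> real"]
    by (auto simp: conv_def k[symmetric] field_simps intro!: ext)
  moreover have "smooth (conv Q (ker 1 0))"
    by (rule conv_smooth[OF locbdd_Q smooth_ker, of 1]) (rule ker_outside, auto)
  ultimately show ?thesis using smooth_mult[OF smooth_const] by metis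
qed

lemma continuous_Q: "continuous_on UNIV Q" by (rule smooth_continuous[OF smooth_Q])

text \<open>The mean value identity is known for radius 1 at every centre; homogeneity of
  \<open>Q\<close> carries it to every radius.\<close>

lemma harmonic_Q: "laplacian Q x = 0"
proof (rule mean_value_imp_harmonic[OF smooth_Q])
  fix a and r :: real assume r: "r > 0"
  have hQ: "Q (t *\<^sub>R x) = t powr d * Q x" if "t > 0" for t x
    using Q_homogeneous that unfolding homogeneous_def by blast
  have "(LINT w|lborel. Q w * ker r a w) / r ^ DIM('a \<times> real) = (LINT z|lborel. Q (a + r *\<^sub>R z) * ker 1 0 z)"
    by (rule mean_rescale[OF locbdd_Q r])
  also have "\<dots> = (LINT z|lborel. r powr d * (Q ((1 / r) *\<^sub>R a + 1 *\<^sub>R z) * ker 1 0 z))"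
  proof -
    have "a + r *\<^sub>R z = r *\<^sub>R ((1 / r) *\<^sub>R a + 1 *\<^sub>R z)" for z using r by (simp add: scaleR_add_right)
    then show ?thesis using hQ[OF r] by (simp add: mult.assoc)
  qed
  also have "\<dots> = r powr d * ((LINT w|lborel. Q w * ker 1 ((1 / r) *\<^sub>R a) w) / 1 ^ DIM('a \<times> real))"
    using mean_rescale[OF locbdd_Q zero_less_one, of "(1 / r) *\<^sub>R a"] by simp
  also have "\<dots> = kmass TYPE('a \<times> real) * (r powr d * Q ((1 / r) *\<^sub>R a))"
    using Q_mean[of "(1 / r) *\<^sub>R a"] by simp
  also have "\<dots> = kmass TYPE('a \<times> real) * Q a" using hQ[OF r, of "(1 / r) *\<^sub>R a"] r by simp
  finally show "(LINT w|lborel. Q w * ker r a w) / r ^ DIM('a \<times> real) = kmass TYPE('a \<times> real) * Q a" .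
qed

lemma Q_identity:
  assumes "R > 0"
  shows "(LINT x'|lborel. u k (x', 0) * (partial ey Q (x', 0) * bump R 0 (x', 0 :: real)))
    = 2 / R\<^sup>2 * (d - \<mu> k) * (LINT x|lborel. indicator upper x * u k x * Q x * ker R 0 x)"
  by (rule frequency_identity[OF cont harm upper_sub hom smooth_Q harmonic_Q Q_homogeneous Q_thin assms])

lemma distr_eq_minus: "distr_laplacian_eq_0_on S (\<lambda>x. - v x)" if "distr_laplacian_eq_0_on S v"
  using that unfolding distr_laplacian_eq_0_on_def by (auto simp: set_lebesgue_integral_def)

text \<open>If \<open>Q\<close> vanished above the thin space, \<open>u k\<close> would be below 1/4
  in absolute value off a thin strip. The point where it has absolute value 1 lies in that strip,
  and the barrier about the projection of this point bounds the value there by 3/4.\<close>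

lemma Q_nontrivial: obtains x where "snd x > 0" "Q x \<noteq> 0"
proof (rule ccontr)
  note found = that
  assume not_found: "\<not> thesis"
  have Q0: "Q x = 0" if "snd x > 0" for x using found[OF that] not_found by blast
  obtain K where K: "K > 0" "(LINT z|lborel. saddle K (0::'a) z * ker 1 0 z) < 0"
    using saddle_constant_exists by blast
  define M where "M = bnd 2"
  have M: "M \<ge> 1" by (simp add: M_def bnd_ge)
  define h where "h = min (1/2) (1 / (16 * M * K))"
  have h: "0 < h" "h \<le> 1/2" "h \<le> 1 / (16 * M * K)" using K M by (auto simp: h_def)
  have "h * h \<le> 1 * (1 / (16 * M * K))" using h by (intro mult_mono) auto
  then have "16 * M * K * (h * h) \<le> 16 * M * K * (1 / (16 * M * K))" using K M by (intro mult_left_mono) auto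
  then have Kh: "16 * M * (K * h\<^sup>2) \<le> 1" using K M by (simp add: power2_eq_square mult_ac)
  have "16 * (K * h\<^sup>2) \<le> 16 * M * (K * h\<^sup>2)" using M K by (intro mult_right_mono) auto
  then have Kh': "K * h\<^sup>2 \<le> 1 / 16" using Kh by simp
  have "\<forall>\<^sub>F k in sequentially. \<forall>x. norm x \<le> 2 \<longrightarrow> snd x \<ge> h \<longrightarrow> \<bar>u k x - Q x\<bar> < 1/4"
    by (rule unif_Q) (use h in auto)
  then obtain k where k: "\<And>x. norm x \<le> 2 \<Longrightarrow> snd x \<ge> h \<Longrightarrow> \<bar>u k x - Q x\<bar> < 1/4"
    unfolding eventually_sequentially by blast
  have small: "\<bar>u k x\<bar> < 1/4" if "norm x \<le> 2" "\<bar>snd x\<bar> \<ge> h" for x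
  proof (cases "snd x > 0")
    case True then show ?thesis using k[of x] Q0[of x] that by auto
  next
    case False
    then show ?thesis using k[of "mirror x"] Q0[of "mirror x"] that h(1) by (auto simp: u_mirror)
  qed
  obtain z where z: "norm z \<le> 1" "\<bar>u k z\<bar> = 1" using attained by blast
  define a where "a = fst z"
  have na: "norm a \<le> 1" using z(1) norm_thin_le[of "fst z" "snd z"] by (simp add: a_def)
  have in2: "norm x \<le> 2" if "norm (fst x - a) \<le> 1/2" "\<bar>snd x\<bar> \<le> h" for x
  proof -
    have "norm x \<le> norm (fst x) + \<bar>snd x\<bar>" using norm_Pair_le[of "fst x" "snd x"] by simp
    moreover have "norm (fst x) \<le> norm a + norm (fst x - a)" using norm_triangle_sub[of "fst x" a] by simp
    ultimately show ?thesis using that na h by linarith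
  qed
  have zin: "\<bar>snd z\<bar> < h" using small[of z] z by force
  have B0: "8 * M * (K * h\<^sup>2) + 1/4 \<ge> 0" using M K by simp
  have ins: "saddle K a x = (norm (fst x - a))\<^sup>2 - K * (snd x)\<^sup>2" for x
    by (simp add: saddle_def power2_norm_eq_inner)
  have comp: "v z \<le> 8 * M * saddle K a z + (8 * M * (K * h\<^sup>2) + 1/4)"
    if v: "continuous_on UNIV v" "distr_laplacian_eq_0_on (contact_complement (u k)) v" "\<And>x. \<bar>v x\<bar> = \<bar>u k x\<bar>" for v
  proof (rule cylinder_comparison[OF v(1,2) open_contact_complement _ K(2) _ B0, where \<rho> = "1/2" and h = h])
    show "snd x = 0 \<and> v x \<le> 0" if "x \<notin> contact_complement (u k)" for x
      using contact_complement_outside[OF that] v(3)[of x] by simp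
    show "v x \<le> 8 * M * saddle K a x + (8 * M * (K * h\<^sup>2) + 1/4)" if x: "norm (fst x - a) = 1/2" "\<bar>snd x\<bar> \<le> h" for x
    proof -
      have vM: "\<bar>v x\<bar> \<le> M" unfolding v(3) M_def by (rule u_bound[OF in2]) (use x in auto)
      have "K * (snd x)\<^sup>2 \<le> K * h\<^sup>2" using x(2) h K by (intro mult_left_mono) (auto simp: abs_le_square_iff[symmetric])
      moreover have "(norm (fst x - a))\<^sup>2 = 1/4" unfolding x(1) by (simp add: power2_eq_square)
      ultimately have "saddle K a x \<ge> 1/4 - 1/16" using Kh' unfolding ins by linarith
      then have s1: "8 * M * saddle K a x \<ge> 8 * M * (1/4 - 1/16)" using M by (intro mult_left_mono) auto
      have s2: "8 * M * (K * h\<^sup>2) \<ge> 0" using M K by simp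
      have "8 * M * (1/4 - 1/16) = M * (3/2)" by simp
      then have "M \<le> 8 * M * saddle K a x" using s1 M by linarith
      then show ?thesis using s2 vM by linarith
    qed
    show "v x \<le> 8 * M * saddle K a x + (8 * M * (K * h\<^sup>2) + 1/4)" if x: "norm (fst x - a) \<le> 1/2" "\<bar>snd x\<bar> = h" for x
    proof -
      have v4: "\<bar>v x\<bar> < 1/4" unfolding v(3) by (rule small[OF in2]) (use x in auto)
      have "(snd x)\<^sup>2 = h\<^sup>2" using x(2) by (metis power2_abs)
      then have "saddle K a x \<ge> - (K * h\<^sup>2)" by (simp add: ins)
      then have "8 * M * saddle K a x \<ge> 8 * M * (- (K * h\<^sup>2))" using M by (intro mult_left_mono) auto
      then have "8 * M * saddle K a x + 8 * M * (K * h\<^sup>2) \<ge> 0"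
        unfolding mult_minus_right by linarith
      then show ?thesis using v4 by linarith
    qed
  qed (use M zin in \<open>auto simp: a_def\<close>)
  have "\<bar>u k z\<bar> \<le> 8 * M * saddle K a z + (8 * M * (K * h\<^sup>2) + 1/4)"
    using comp[OF cont harm refl] comp[OF continuous_on_minus[OF cont] distr_eq_minus[OF harm]] by simp
  also have "saddle K a z \<le> 0" unfolding ins using K by (simp add: a_def)
  then have "8 * M * saddle K a z \<le> 0" using M by (intro mult_nonneg_nonpos) auto
  finally show False using z(2) Kh by simp
qed

text \<open>A positive slope at \<open>(a, 0)\<close> would make the even reflection of
  \<open>Q\<close> positive nearby off the thin space. Superharmonicity of \<open>u k\<close>
  survives in the limit as an inequality for averages, so the positive average at
  \<open>(a, 0)\<close> would be at most \<open>kmass\<close> times the value there, which is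
  zero.\<close>

lemma partial_Q_thin_le_0: "partial ey Q (a, 0) \<le> 0"
proof (rule ccontr)
  assume "\<not> ?thesis"
  then have pos: "partial ey Q (a, 0) > 0" by simp
  let ?c = "kmass TYPE('a \<times> real)"
  have "open {x. partial ey Q x > 0}"
    by (intro open_Collect_less smooth_continuous[OF smooth_partial[OF smooth_Q ey_Basis]]) simp
  then obtain e where e: "e > 0" "ball (a, 0) e \<subseteq> {x. partial ey Q x > 0}" using pos openE by blast
  have Qpos: "Q (z', y) > 0" if y: "(z', y) \<in> ball (a, 0) e" "y > 0" for z' y
  proof -
    obtain s where s: "0 < s" "s < y" "Q (z', y) - Q (z', 0) = (y - 0) * partial ey Q (z', s)"
      using MVT2[OF y(2), of "\<lambda>y. Q (z', y)" "\<lambda>y. partial ey Q (z', y)"] has_derivative_last[OF smooth_Q] by blast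
    have "norm (a - z', - s) \<le> norm (a - z', - y)"
      unfolding norm_Pair using s by (intro real_sqrt_le_mono add_left_mono power_mono) auto
    then have "(z', s) \<in> ball (a, 0) e" using y(1) by (simp add: dist_norm norm_minus_commute)
    then have "partial ey Q (z', s) > 0" using e by blast
    then show ?thesis using s y(2) Q_thin[of z'] by simp
  qed
  define q where "q w = Q (fst w, \<bar>snd w\<bar>)" for w
  have cq: "continuous_on UNIV q" unfolding q_def
    by (rule continuous_on_compose2[OF continuous_Q]) (auto intro!: continuous_intros)
  have lq: "locbdd q" by (rule locbdd_continuous[OF cq])
  have qlim: "(\<lambda>k. u k w) \<longlonglongrightarrow> q w" if "snd w \<noteq> 0" for w
  proof (cases "snd w > 0")
    case True then show ?thesis using u_tendsto[OF True] by (simp add: q_def)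
  next
    case False
    then have "(\<lambda>k. u k (mirror w)) \<longlonglongrightarrow> Q (mirror w)" using that by (intro u_tendsto) simp
    moreover have "Q (mirror w) = q w" using False by (simp add: q_def mirror_def)
    ultimately show ?thesis by (simp add: u_mirror)
  qed
  \<comment> \<open>The inequality is passed to the limit at centres above the thin space, where
    \<open>u k\<close> is known to converge to \<open>Q\<close>. Under the integral the thin space
    may be ignored as a null set.\<close>
  have le: "(LINT w|lborel. q w * ker e x w) / e ^ DIM('a \<times> real) \<le> ?c * Q x" if x: "snd x > 0" for x
  proof (rule LIMSEQ_le)
    show "(\<lambda>k. ?c * u k x) \<longlonglongrightarrow> ?c * Q x" by (intro tendsto_intros u_tendsto x)
    show "\<exists>N. \<forall>k\<ge>N. (LINT w|lborel. u k w * ker e x w) / e ^ DIM('a \<times> real) \<le> ?c * u k x"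
      using super_mean_value[OF cont super _ e(1)] by blast
    show "(\<lambda>k. (LINT w|lborel. u k w * ker e x w) / e ^ DIM('a \<times> real)) \<longlonglongrightarrow> (LINT w|lborel. q w * ker e x w) / e ^ DIM('a \<times> real)"
    proof (rule tendsto_divide[OF _ tendsto_const], rule integral_dominated_convergence[where w = "\<lambda>w. bnd (norm x + e) * ker e x w"])
      show "(\<lambda>w. q w * ker e x w) \<in> borel_measurable lborel"
        using locbdd_measurable[OF locbdd_mult[OF lq locbdd_continuous[OF smooth_continuous[OF smooth_ker]]]] by simp
      show "(\<lambda>w. u k w * ker e x w) \<in> borel_measurable lborel" for k
        using locbdd_measurable[OF locbdd_mult[OF locbdd_u locbdd_continuous[OF smooth_continuous[OF smooth_ker]]]] by simp
      show "integrable lborel (\<lambda>w. bnd (norm x + e) * ker e x w)" by (intro integrable_mult_right integrable_ker1 e)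
      have "AE w in (lborel :: ('a \<times> real) measure). snd w \<noteq> 0"
      proof -
        have "negligible {w :: 'a \<times> real. ey \<bullet> w = 0}" by (rule negligible_hyperplane) (simp add: zero_prod_def)
        moreover have "{w :: 'a \<times> real. ey \<bullet> w = 0} = {w. snd w = 0}" by (auto simp: inner_prod_def)
        moreover have "closed {w :: 'a \<times> real. snd w = 0}" by (intro closed_Collect_eq continuous_intros)
        then have s: "{w :: 'a \<times> real. snd w = 0} \<in> sets lborel" by (simp add: borel_closed)
        ultimately have "{w :: 'a \<times> real. snd w = 0} \<in> null_sets lborel"
          using null_sets_completion_iff[OF s] by (simp add: negligible_iff_null_sets)
        then show ?thesis by (rule AE_I') auto
      qed
      then show "AE w in lborel. (\<lambda>k. u k w * ker e x w) \<longlonglongrightarrow> q w * ker e x w"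
        by (rule AE_mp) (intro AE_I2 impI tendsto_intros qlim)
      show "AE w in lborel. norm (u k w * ker e x w) \<le> bnd (norm x + e) * ker e x w" for k
      proof (rule AE_I2)
        fix w
        show "norm (u k w * ker e x w) \<le> bnd (norm x + e) * ker e x w"
        proof (cases "w \<in> ball x e")
          case True
          then have "norm w \<le> norm x + e" using norm_triangle_sub[of w x] by (auto simp: dist_norm norm_minus_commute)
          then have "\<bar>u k w\<bar> * ker e x w \<le> bnd (norm x + e) * ker e x w"
            by (intro mult_right_mono u_bound ker_nonneg)
          then show ?thesis by (simp add: abs_mult ker_nonneg)
        qed (simp add: ker_zero[OF e(1)])
      qed
    qed (use e in simp)
  qed
  have kc: "ker e x w = ker e 0 (x - w)" for x w :: "'a \<times> real"
    by (simp add: ker_def sqd_norm norm_minus_commute)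
  have cc: "continuous_on UNIV (\<lambda>x. LINT w|lborel. q w * ker e x w)"
  proof -
    have "smooth (conv q (ker e 0))"
    proof (rule conv_smooth[OF lq smooth_ker, of e])
      fix x :: "'a \<times> real" assume "x \<notin> cball 0 e"
      then have "x \<notin> ball 0 e" by auto
      then show "ker e 0 x = 0" by (rule ker_zero[OF e(1)])
    qed
    then show ?thesis using smooth_continuous by (simp add: conv_def[abs_def] kc[symmetric])
  qed
  \<comment> \<open>The thin point is now approached from above, using continuity of the average and
    of \<open>Q\<close> in the centre.\<close>
  have s: "(\<lambda>j. (a, inverse (real (Suc j)))) \<longlonglongrightarrow> (a, 0)" by (intro tendsto_intros LIMSEQ_inverse_real_of_nat)
  have at0: "(LINT w|lborel. q w * ker e (a, 0) w) / e ^ DIM('a \<times> real) \<le> ?c * Q (a, 0)"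
  proof (rule LIMSEQ_le)
    have c: "isCont (\<lambda>x. (LINT w|lborel. q w * ker e x w)) (a, 0)" "isCont Q (a, 0)"
      using cc continuous_Q continuous_on_eq_continuous_at by blast+
    show "(\<lambda>j. (LINT w|lborel. q w * ker e (a, inverse (real (Suc j))) w) / e ^ DIM('a \<times> real))
      \<longlonglongrightarrow> (LINT w|lborel. q w * ker e (a, 0) w) / e ^ DIM('a \<times> real)"
      by (intro tendsto_divide tendsto_const isCont_tendsto_compose[OF c(1) s]) (use e in simp)
    show "(\<lambda>j. ?c * Q (a, inverse (real (Suc j)))) \<longlonglongrightarrow> ?c * Q (a, 0)"
      by (intro tendsto_mult tendsto_const isCont_tendsto_compose[OF c(2) s])
    show "\<exists>N. \<forall>j\<ge>N. (LINT w|lborel. q w * ker e (a, inverse (real (Suc j))) w) / e ^ DIM('a \<times> real)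
        \<le> ?c * Q (a, inverse (real (Suc j)))"
      by (intro exI[of _ 0] allI impI le) simp
  qed
  have "(LINT w|lborel. q w * ker e (a, 0) w) > 0"
  proof (rule lint_pos[where ?x0.0 = "(a, e / 2)"])
    show "continuous_on UNIV (\<lambda>w. q w * ker e (a, 0) w)" by (intro continuous_on_mult cq smooth_continuous smooth_ker)
    show "integrable lborel (\<lambda>w. q w * ker e (a, 0) w)" by (rule integrable_ker[OF lq e(1)])
    have b: "(a, e / 2) \<in> ball (a, 0) e" using e(1) by (simp add: dist_Pair_Pair dist_real_def)
    show "q (a, e / 2) * ker e (a, 0) (a, e / 2) > 0"
      using Qpos[OF b] ker_pos[OF e(1) b] e(1) by (simp add: q_def)
    show "q w * ker e (a, 0) w \<ge> 0" for w
    proof (cases "w \<in> ball (a, 0) e")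
      case True
      have "dist (a, 0) (fst w, \<bar>snd w\<bar>) = dist (a, 0) w"
        by (cases w) (simp add: dist_Pair_Pair dist_real_def)
      then have "(fst w, \<bar>snd w\<bar>) \<in> ball (a, 0) e" using True by simp
      then have "q w \<ge> 0"
        using Qpos[of "fst w" "\<bar>snd w\<bar>"] Q_thin[of "fst w"] unfolding q_def by (cases "snd w = 0") (auto intro: less_imp_le)
      then show ?thesis by (simp add: ker_nonneg)
    qed (simp add: ker_zero[OF e(1)])
  qed
  then have "(LINT w|lborel. q w * ker e (a, 0) w) / e ^ DIM('a \<times> real) > 0" using e(1) by simp
  with at0 show False by (simp add: Q_thin)
qed

end

section \<open>Vanishing of the trace and the contradiction\<close>

context blow_up_limit
begin

text \<open>Both normal derivatives are homogeneous of degree d - 1, so the unit sphere of the thin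
  space suffices, and compactness there makes all constants uniform in the point. In a small
  cylinder about such a point \<open>Q\<close> is at most a negative multiple of the height, hence
  \<open>u k\<close> is negative at the top and the barrier forces its value at the centre to be at
  most zero.\<close>

lemma trace_vanishes:
  assumes "\<delta> > 0"
  shows "\<forall>\<^sub>F k in sequentially. \<forall>x'. - partial ey Q (x', 0) > \<delta> * partial ey (hpoly (2 * m + 1)) (x', 0)
    \<longrightarrow> u k (x', 0) = 0"
proof -
  define q where "q x' = - partial ey Q (x', 0)" for x'
  define p where "p x' = partial ey (hpoly (2 * m + 1)) (x' :: 'a, 0)" for x'
  have sQy: "smooth (partial ey Q)" by (rule smooth_partial[OF smooth_Q ey_Basis])
  have cp: "continuous_on UNIV p" unfolding p_def
    by (intro continuous_thin smooth_continuous smooth_partial smooth_hpoly ey_Basis)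
  obtain e1 :: 'a where "norm e1 = 1" using vector_choose_size[of 1] by auto
  then have "sphere 0 1 \<noteq> ({} :: 'a set)" by auto
  then obtain x1 where x1: "x1 \<in> sphere 0 1" "\<And>x'. x' \<in> sphere 0 1 \<Longrightarrow> p x1 \<le> p x'"
    using continuous_attains_inf[OF compact_sphere _ continuous_on_subset[OF cp]] by blast
  have "p x1 > 0" unfolding p_def by (rule partial_hpoly_thin_pos) (use x1(1) in auto)
  \<comment> \<open>On the sphere the normal derivative of \<open>hpoly\<close> is at least
    \<open>p x1\<close>, so the hypothesis yields the uniform lower bound \<delta>0 for
    \<open>q\<close>.\<close>
  define \<delta>0 where "\<delta>0 = \<delta> * p x1"
  have \<delta>0: "\<delta>0 > 0" unfolding \<delta>0_def using assms \<open>p x1 > 0\<close> by simp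
  have "uniformly_continuous_on (cball 0 2) (partial ey Q)"
    by (intro compact_uniformly_continuous continuous_on_subset[OF smooth_continuous[OF sQy]]) auto
  then obtain \<rho>1 where \<rho>1: "\<rho>1 > 0"
    "\<And>x y. x \<in> cball 0 2 \<Longrightarrow> y \<in> cball 0 2 \<Longrightarrow> dist y x < \<rho>1 \<Longrightarrow> dist (partial ey Q y) (partial ey Q x) < \<delta>0 / 2"
    using \<delta>0 unfolding uniformly_continuous_on_def by (meson half_gt_zero)
  define \<rho> where "\<rho> = min (1/2) (\<rho>1 / 4)"
  have \<rho>: "0 < \<rho>" "\<rho> \<le> 1/2" "2 * \<rho> < \<rho>1" using \<rho>1(1) by (auto simp: \<rho>_def)
  obtain K where K: "K > 0" "(LINT z|lborel. saddle K (0::'a) z * ker 1 0 z) < 0"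
    using saddle_constant_exists by blast
  define M where "M = bnd 2"
  have M: "M \<ge> 1" by (simp add: M_def bnd_ge)
  define A where "A = 2 * M / \<rho>\<^sup>2"
  have A: "A > 0" using M \<rho> by (simp add: A_def)
  define h where "h = min \<rho> (min (\<rho>\<^sup>2 / (2 * K)) (\<delta>0 / (4 * A * K)))"
  have h0: "h > 0" using \<rho> K A \<delta>0 by (simp add: h_def)
  have h: "h \<le> \<rho>" "h \<le> \<rho>\<^sup>2 / (2 * K)" "h \<le> \<delta>0 / (4 * A * K)" by (auto simp: h_def)
  have hh: "h\<^sup>2 \<le> h" using h(1) \<rho>(2) h0 by (simp add: power2_eq_square mult_left_le)
  have Kh: "K * h\<^sup>2 \<le> \<rho>\<^sup>2 / 2"
  proof -
    have "K * h\<^sup>2 \<le> K * h" using hh K by simp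
    also have "\<dots> \<le> K * (\<rho>\<^sup>2 / (2 * K))" using h(2) K by (intro mult_left_mono) auto
    finally show ?thesis using K by simp
  qed
  have AKh: "A * (K * h\<^sup>2) \<le> \<delta>0 / 4 * h"
  proof -
    have "A * K * h \<le> A * K * (\<delta>0 / (4 * A * K))" using h(3) A K by (intro mult_left_mono) auto
    then have "A * K * h \<le> \<delta>0 / 4" using A K by simp
    then have "A * K * h * h \<le> \<delta>0 / 4 * h" using h0 by (intro mult_right_mono) auto
    then show ?thesis by (simp add: power2_eq_square mult_ac)
  qed
  have sphere: "\<forall>\<^sub>F k in sequentially. \<forall>a. norm a = 1 \<longrightarrow> q a \<ge> \<delta>0 \<longrightarrow> u k (a, 0) = 0"
  proof -
    have "\<forall>\<^sub>F k in sequentially. \<forall>x. norm x \<le> 2 \<longrightarrow> snd x \<ge> h \<longrightarrow> \<bar>u k x - Q x\<bar> < \<delta>0 / 4 * h"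
      by (rule unif_Q) (use h0 \<delta>0 in auto)
    then show ?thesis
    proof eventually_elim
      case (elim k)
      show ?case
      proof (intro allI impI)
        fix a :: 'a assume a: "norm a = 1" "q a \<ge> \<delta>0"
        have in2: "norm x \<le> 2" if "norm (fst x - a) \<le> \<rho>" "\<bar>snd x\<bar> \<le> h" for x
        proof -
          have "norm x \<le> norm (fst x) + \<bar>snd x\<bar>" using norm_Pair_le[of "fst x" "snd x"] by simp
          moreover have "norm (fst x) \<le> norm a + norm (fst x - a)" using norm_triangle_sub[of "fst x" a] by simp
          ultimately show ?thesis using that a h \<rho> by linarith
        qed
        have Qy: "partial ey Q x \<le> - (\<delta>0 / 2)" if x: "norm (fst x - a) \<le> \<rho>" "\<bar>snd x\<bar> \<le> h" for x
        proof -
          have "dist x (a, 0) = norm (fst x - a, snd x)" by (cases x) (simp add: dist_norm)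
          also have "\<dots> \<le> norm (fst x - a) + norm (snd x)" by (rule norm_Pair_le)
          also have "\<dots> < \<rho>1" using x h \<rho> by simp
          finally have "dist (partial ey Q x) (partial ey Q (a, 0)) < \<delta>0 / 2"
            using \<rho>1(2)[of "(a, 0)" x] in2[OF x] a(1) by (simp add: norm_Pair)
          then show ?thesis using a(2) unfolding q_def dist_real_def by linarith
        qed
        have Qtop: "Q (z', h) \<le> - (\<delta>0 / 2) * h" if z': "norm (z' - a) \<le> \<rho>" for z'
        proof -
          obtain s where s: "0 < s" "s < h" "Q (z', h) - Q (z', 0) = (h - 0) * partial ey Q (z', s)"
            using MVT2[OF h0, of "\<lambda>y. Q (z', y)" "\<lambda>y. partial ey Q (z', y)"] has_derivative_last[OF smooth_Q] by blast
          have "partial ey Q (z', s) \<le> - (\<delta>0 / 2)" by (rule Qy) (use z' s in auto)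
          then have "h * partial ey Q (z', s) \<le> h * (- (\<delta>0 / 2))" using h0 by (intro mult_left_mono) auto
          then show ?thesis using s(3) Q_thin[of z'] by (simp add: mult.commute)
        qed
        have ins: "saddle K a x = (norm (fst x - a))\<^sup>2 - K * (snd x)\<^sup>2" for x
          by (simp add: saddle_def power2_norm_eq_inner)
        \<comment> \<open>The additive constant is zero and the saddle vanishes at its centre, so
          the comparison gives exactly \<open>u k (a, 0) \<le> 0\<close>.\<close>
        have "u k (a, 0) \<le> A * saddle K a (a, 0) + 0"
        proof (rule cylinder_comparison[OF cont harm open_contact_complement _ K(2) A, where \<rho> = \<rho> and h = h])
          show "snd z = 0 \<and> u k z \<le> 0" if "z \<notin> contact_complement (u k)" for z
            using contact_complement_outside[OF that] by simp
          show "u k z \<le> A * saddle K a z + 0" if z: "norm (fst z - a) = \<rho>" "\<bar>snd z\<bar> \<le> h" for z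
          proof -
            have 1: "\<bar>u k z\<bar> \<le> M" unfolding M_def by (rule u_bound[OF in2]) (use z in auto)
            have "K * (snd z)\<^sup>2 \<le> K * h\<^sup>2" using z(2) h0 K by (intro mult_left_mono) (auto simp: abs_le_square_iff[symmetric])
            then have "saddle K a z \<ge> \<rho>\<^sup>2 / 2" using Kh unfolding ins z(1) by linarith
            then have "A * saddle K a z \<ge> A * (\<rho>\<^sup>2 / 2)" using A by (intro mult_left_mono) auto
            moreover have "A * (\<rho>\<^sup>2 / 2) = M" using \<rho> by (simp add: A_def)
            ultimately show ?thesis using 1 by simp
          qed
          show "u k z \<le> A * saddle K a z + 0" if z: "norm (fst z - a) \<le> \<rho>" "\<bar>snd z\<bar> = h" for z
          proof -
            have "snd z = h \<or> snd z = - h" using z(2) by auto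
            then have "z = (fst z, h) \<or> z = (fst z, - h)" by (metis prod.collapse)
            then have uz: "u k z = u k (fst z, h)" using even[of k "fst z" h] by auto
            have "\<bar>u k (fst z, h) - Q (fst z, h)\<bar> < \<delta>0 / 4 * h"
              using elim in2[of "(fst z, h)"] z h0 by simp
            then have "u k z < Q (fst z, h) + \<delta>0 / 4 * h" unfolding uz by linarith
            moreover have "- (\<delta>0 / 2) * h = - 2 * (\<delta>0 / 4 * h)" by simp
            ultimately have uz4: "u k z \<le> - (\<delta>0 / 4 * h)" using Qtop[OF z(1)] by linarith
            have "(snd z)\<^sup>2 = h\<^sup>2" using z(2) by (metis power2_abs)
            then have "saddle K a z \<ge> - (K * h\<^sup>2)" by (simp add: ins)
            then have "A * saddle K a z \<ge> A * (- (K * h\<^sup>2))" using A by (intro mult_left_mono) auto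
            then show ?thesis using AKh uz4 unfolding mult_minus_right by linarith
          qed
        qed (use h0 \<rho> in auto)
        then show "u k (a, 0) = 0" using nonneg[of k a] by (simp add: saddle_def)
      qed
    qed
  qed
  show ?thesis
    using sphere
  proof eventually_elim
    case (elim k)
    show ?case
    proof (intro allI impI)
      fix x' assume x': "- partial ey Q (x', 0) > \<delta> * partial ey (hpoly (2 * m + 1)) (x', 0)"
      show "u k (x', 0) = 0"
      proof (cases "x' = 0")
        case True
        \<comment> \<open>The origin cannot be scaled to the sphere. There homogeneity of positive
          degree alone forces the value zero.\<close>
        have "u k (2 *\<^sub>R (0::'a, 0::real)) = 2 powr \<mu> k * u k (0, 0)" by (rule homog) simp
        then have "u k (0, 0) * (2 powr \<mu> k - 1) = 0" by (simp add: zero_prod_def algebra_simps)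
        then show ?thesis using True \<mu>_pos[of k] by auto
      next
        case False
        define t where "t = norm x'"
        have t: "t > 0" using False by (simp add: t_def)
        define a where "a = (1 / t) *\<^sub>R x'"
        have a: "norm a = 1" "x' = t *\<^sub>R a" using t by (auto simp: a_def t_def)
        have e: "(x', 0) = t *\<^sub>R (a, 0::real)" by (simp add: a)
        have "q x' = t powr (d - 1) * q a"
          unfolding q_def e by (simp only: partial_homogeneous[OF smooth_Q Q_homogeneous t] mult_minus_right)
        moreover have "p x' = t powr (d - 1) * p a"
          unfolding p_def e d_def by (rule partial_homogeneous[OF smooth_hpoly homogeneous_hpoly t])
        ultimately have "t powr (d - 1) * (\<delta> * p a) < t powr (d - 1) * q a"
          using x' unfolding q_def[symmetric] p_def[symmetric] by (simp add: mult_ac)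
        then have "\<delta> * p a < q a" using t by simp
        moreover have "\<delta> * p x1 \<le> \<delta> * p a" using x1(2)[of a] a(1) assms by simp
        ultimately have "u k (a, 0) = 0" using elim a(1) by (simp add: \<delta>0_def)
        then show ?thesis unfolding e homog[OF t] by simp
      qed
    qed
  qed
qed

lemma blow_up_limit_contradiction: False
proof -
  obtain x0 where x0: "snd x0 > 0" "Q x0 \<noteq> 0" using Q_nontrivial by blast
  \<comment> \<open>The radius makes \<open>x0\<close> an interior point of the weight's support, so
    that the limit integral \<open>J0\<close> is positive.\<close>
  define R where "R = norm x0 + 1"
  have R: "R > 0" by (simp add: R_def add_nonneg_pos)
  define J where "J k = (LINT x|lborel. indicator upper x * u k x * Q x * ker R 0 x)" for k
  define J0 where "J0 = (LINT x|lborel. indicator upper x * Q x * Q x * ker R 0 x)"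
  have cQk: "continuous_on UNIV (\<lambda>x. Q x * ker R 0 x)" by (intro continuous_on_mult continuous_Q smooth_continuous smooth_ker)
  have Jlim: "J \<longlonglongrightarrow> J0"
  proof -
    have "(\<lambda>k. LINT w|lborel. indicator upper w * u k w * (Q w * ker R 0 w))
        \<longlonglongrightarrow> (LINT w|lborel. indicator upper w * Q w * (Q w * ker R 0 w))"
      by (rule lim_upper_integral[OF cQk, of R]) (auto simp: ker_zero[OF R])
    then show ?thesis unfolding J_def J0_def by (simp add: mult.assoc)
  qed
  have J0: "J0 > 0" unfolding J0_def
  proof (rule lint_pos_open)
    show "integrable lborel (\<lambda>x. indicator upper x * Q x * Q x * ker R 0 x)"
      by (intro integrable_ker locbdd_mult locbdd_upper locbdd_Q R)
    show "indicator upper x * Q x * Q x * ker R 0 x \<ge> 0" for x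
      by (simp add: ker_nonneg mult.assoc[of _ "Q x"])
    let ?S = "upper \<inter> ball 0 R \<inter> {x. Q x \<noteq> 0}"
    show "open ?S"
      by (intro open_Int open_ball open_Collect_less open_Collect_neq continuous_Q continuous_intros)
    show "?S \<noteq> {}" using x0 by (auto simp: R_def intro!: exI[of _ x0] simp del: split_paired_Ex)
    fix x assume x: "x \<in> ?S"
    then have "ker R 0 x > 0" by (intro ker_pos R) blast
    moreover have "(Q x)\<^sup>2 > 0" using x by simp
    ultimately show "indicator upper x * Q x * Q x * ker R 0 x > 0"
      using x by (simp add: power2_eq_square)
  qed
  obtain C where C: "C \<ge> 0" "\<And>k. \<bar>LINT x|lborel. indicator upper x * u k x * hpoly (2 * m + 1) x * ker R 0 x\<bar> \<le> C"
    using weight_bounded[OF R smooth_hpoly] by blast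
  \<comment> \<open>Chosen so that \<delta>C < J0/2; the added 1 allows C = 0.\<close>
  define \<delta> where "\<delta> = J0 / (2 * (C + 1))"
  have \<delta>: "\<delta> > 0" using J0 C by (simp add: \<delta>_def)
  have \<delta>C: "\<delta> * C < J0 / 2" using J0 C by (simp add: \<delta>_def field_simps)
  have "\<forall>\<^sub>F k in sequentially. J k > J0 / 2" using order_tendstoD(1)[OF Jlim, of "J0 / 2"] J0 by simp
  with trace_vanishes[OF \<delta>] have "\<forall>\<^sub>F k in sequentially. J k > J0 / 2 \<and>
    (\<forall>x'. - partial ey Q (x', 0) > \<delta> * partial ey (hpoly (2 * m + 1)) (x', 0) \<longrightarrow> u k (x', 0) = 0)"
    by eventually_elim blast
  then obtain k where k: "J k > J0 / 2"
    "\<And>x'. - partial ey Q (x', 0) > \<delta> * partial ey (hpoly (2 * m + 1)) (x', 0) \<Longrightarrow> u k (x', 0) = 0"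
    unfolding eventually_sequentially by blast
  define b where "b x' = bump R 0 (x', 0 :: real)" for x' :: 'a
  have b0: "b x' \<ge> 0" for x' by (simp add: b_def bump_nonneg)
  define H where "H = (LINT x|lborel. indicator upper x * u k x * hpoly (2 * m + 1) x * ker R 0 x)"
  have id1: "(LINT x'|lborel. u k (x', 0) * (partial ey Q (x', 0) * b x')) = 2 / R\<^sup>2 * (d - \<mu> k) * J k"
    unfolding b_def J_def by (rule Q_identity[OF R])
  have id2: "(LINT x'|lborel. u k (x', 0) * (partial ey (hpoly (2 * m + 1)) (x', 0) * b x')) = 2 / R\<^sup>2 * (d - \<mu> k) * H"
    unfolding b_def H_def by (rule hpoly_identity[OF R])
  have int: "integrable lborel (\<lambda>x'. u k (x', 0) * (partial ey P (x', 0) * b x'))" if "smooth P" for P :: "'a \<times> real \<Rightarrow> real"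
  proof (rule locbdd_integrable[of _ 0 R])
    show "locbdd (\<lambda>x'. u k (x', 0) * (partial ey P (x', 0) * b x'))" unfolding b_def
      by (intro locbdd_mult locbdd_continuous continuous_thin cont smooth_continuous smooth_partial that ey_Basis smooth_bump)
    fix x' :: 'a assume "x' \<notin> cball 0 R"
    then have "(x', 0::real) \<notin> ball 0 R" by (auto simp: norm_Pair)
    then show "u k (x', 0) * (partial ey P (x', 0) * b x') = 0" by (simp add: b_def bump_zero[OF R] del: mem_ball)
  qed
  have Jk: "J k > 0" using k(1) J0 by simp
  show False
  proof (cases "\<mu> k < d")
    case True
    \<comment> \<open>For frequencies below \<open>d\<close> the signs already conflict: the trace
      side is nonpositive and the half-space side is positive.\<close>
    have "(LINT x'|lborel. u k (x', 0) * (partial ey Q (x', 0) * b x')) \<le> (LINT x'::'a|lborel. 0)"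
    proof (rule integral_mono[OF int[OF smooth_Q]])
      show "u k (x', 0) * (partial ey Q (x', 0) * b x') \<le> 0" for x'
        by (intro mult_nonneg_nonpos mult_nonpos_nonneg nonneg partial_Q_thin_le_0 b0)
    qed simp
    moreover have "2 / R\<^sup>2 * (d - \<mu> k) * J k > 0" using True R Jk by simp
    ultimately show False unfolding id1 by simp
  next
    case False
    then have gt: "\<mu> k > d" using \<mu>_ne[of k] by (simp add: d_def)
    \<comment> \<open>Pointwise, either the slope of \<open>Q\<close> is steep compared with
      \<delta> times that of \<open>hpoly\<close>, and then the trace vanishes, or the inequality
      between the slopes holds as needed.\<close>
    have "(LINT x'|lborel. - (u k (x', 0) * (partial ey Q (x', 0) * b x')))
      \<le> (LINT x'|lborel. \<delta> * (u k (x', 0) * (partial ey (hpoly (2 * m + 1)) (x', 0) * b x')))"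
    proof (rule integral_mono)
      show "integrable lborel (\<lambda>x'. - (u k (x', 0) * (partial ey Q (x', 0) * b x')))" using int[OF smooth_Q] by simp
      show "integrable lborel (\<lambda>x'. \<delta> * (u k (x', 0) * (partial ey (hpoly (2 * m + 1)) (x', 0) * b x')))"
        by (intro integrable_mult_right int smooth_hpoly)
      fix x' :: 'a
      show "- (u k (x', 0) * (partial ey Q (x', 0) * b x')) \<le> \<delta> * (u k (x', 0) * (partial ey (hpoly (2 * m + 1)) (x', 0) * b x'))"
      proof (cases "- partial ey Q (x', 0) > \<delta> * partial ey (hpoly (2 * m + 1)) (x', 0)")
        case True
        then show ?thesis using k(2) by simp
      next
        case False
        have "(u k (x', 0) * b x') * (- partial ey Q (x', 0)) \<le> (u k (x', 0) * b x') * (\<delta> * partial ey (hpoly (2 * m + 1)) (x', 0))"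
          using False by (intro mult_left_mono mult_nonneg_nonneg nonneg b0) simp
        then show ?thesis by (simp add: mult_ac)
      qed
    qed
    then have "- (2 / R\<^sup>2 * (d - \<mu> k) * J k) \<le> \<delta> * (2 / R\<^sup>2 * (d - \<mu> k) * H)"
      by (simp only: Bochner_Integration.integral_minus integral_mult_right_zero id1 id2)
    \<comment> \<open>Both sides carry the same positive factor. Cancelling it leaves a bound on
      \<open>J k\<close> that no longer sees how close \<open>\<mu> k\<close> is to
      \<open>d\<close>.\<close>
    then have "(2 / R\<^sup>2 * (\<mu> k - d)) * J k \<le> (2 / R\<^sup>2 * (\<mu> k - d)) * (\<delta> * (- H))"
      by (simp add: divide_inverse algebra_simps)
    moreover have "2 / R\<^sup>2 * (\<mu> k - d) > 0" using gt R by simp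
    ultimately have "J k \<le> \<delta> * (- H)" using mult_le_cancel_left_pos by blast
    also have "\<dots> \<le> \<delta> * C" using C(2)[of k] \<delta> unfolding H_def by (intro mult_left_mono) auto
    finally show False using \<delta>C k(1) by simp
  qed
qed

end

lemma blow_up_contradiction: "\<not> blow_up u \<mu> m"
proof
  assume "blow_up u \<mu> m"
  then interpret blow_up u \<mu> m .
  show False
  proof (rule subsequence_converges)
    fix g and r :: "nat \<Rightarrow> nat"
    assume r: "strict_mono r"
      and lim: "\<And>h e. h > 0 \<Longrightarrow> e > 0 \<Longrightarrow> \<exists>k0. \<forall>k\<ge>k0. \<forall>x. norm x \<le> 2 \<longrightarrow> snd x \<ge> h \<longrightarrow> \<bar>u (r k) x - g x\<bar> < e"
    have "blow_up_limit (\<lambda>k. u (r k)) (\<lambda>k. \<mu> (r k)) m g"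
    proof (intro blow_up_limit.intro blow_up.intro blow_up_limit_axioms.intro)
      show "(\<lambda>k. \<mu> (r k)) \<longlonglongrightarrow> real (2 * m + 1)"
        using LIMSEQ_subseq_LIMSEQ[OF \<mu>_lim r] by (simp add: comp_def)
    qed (fact cont harm super nonneg even hom \<mu>_pos \<mu>_le \<mu>_ne attained | erule le_1 | erule (1) lim)+
    then show False by (rule blow_up_limit.blow_up_limit_contradiction)
  qed
qed

section \<open>Normalization and passage to the theorem\<close>

text \<open>The hypotheses of \<open>blow_up\<close> for a single index, without those on the limit
  of the frequencies, so that a sequence can be chosen term by term.\<close>

definition normalized_solution :: "real \<Rightarrow> ('b::euclidean_space \<times> real \<Rightarrow> real) \<Rightarrow> bool" where
  "normalized_solution \<mu> u \<longleftrightarrow> continuous_on UNIV u \<and> distr_laplacian_eq_0_on (contact_complement u) u \<and>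
    distr_laplacian_le_0_on UNIV u \<and> (\<forall>x'. u (x', 0) \<ge> 0) \<and> (\<forall>x' y. u (x', - y) = u (x', y)) \<and>
    homogeneous \<mu> u \<and> \<mu> > 0 \<and> (\<forall>x. norm x \<le> 1 \<longrightarrow> \<bar>u x\<bar> \<le> 1) \<and> (\<exists>x. norm x \<le> 1 \<and> \<bar>u x\<bar> = 1)"

text \<open>Division by the maximum of |w| over the closed unit ball. This maximum is positive
  because homogeneity moves a point where \<open>w\<close> is nonzero into the ball; the equations
  and signs survive a positive factor.\<close>

lemma admissible_normalized:
  assumes "\<mu> \<in> admissible_frequencies TYPE('n::finite)"
  shows "\<exists>u :: (real ^ 'n) \<times> real \<Rightarrow> real. normalized_solution \<mu> u"
proof -
  obtain w :: "(real ^ 'n) \<times> real \<Rightarrow> real" and x1 where \<mu>: "\<mu> > 0" and w: "thin_obstacle_solution UNIV w" "homogeneous \<mu> w" "w x1 \<noteq> 0"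
    using assms unfolding admissible_frequencies_def by blast
  have wc: "continuous_on UNIV w" and w1: "distr_laplacian_eq_0_on (contact_complement w) w"
    and w2: "distr_laplacian_le_0_on UNIV w" and w3: "\<And>x'. w (x', 0) \<ge> 0" and w4: "\<And>x' y. w (x', y) = w (x', - y)"
    using w(1) unfolding thin_obstacle_solution_def contact_complement_def by auto
  obtain x0 where x0: "x0 \<in> cball 0 1" "\<And>x. x \<in> cball 0 1 \<Longrightarrow> \<bar>w x\<bar> \<le> \<bar>w x0\<bar>"
  proof -
    have "continuous_on (cball 0 1) (\<lambda>x. \<bar>w x\<bar>)"
      by (intro continuous_on_rabs continuous_on_subset[OF wc]) auto
    from continuous_attains_sup[OF compact_cball _ this] show ?thesis using that by auto
  qed
  define s where "s = \<bar>w x0\<bar>"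
  have s: "s > 0"
  proof -
    define t where "t = 1 / (norm x1 + 1)"
    have t: "t > 0" by (simp add: t_def add_nonneg_pos)
    have "norm (t *\<^sub>R x1) \<le> 1" using t by (simp add: t_def divide_simps add_nonneg_pos)
    moreover have "w (t *\<^sub>R x1) = t powr \<mu> * w x1" using w(2) t unfolding homogeneous_def by blast
    then have "w (t *\<^sub>R x1) \<noteq> 0" using w(3) t by simp
    ultimately show ?thesis using x0(2)[of "t *\<^sub>R x1"] by (auto simp: s_def)
  qed
  have scale: "(LINT x:S|lborel. w x / s * f x) = (LINT x:S|lborel. w x * f x) / s" for S f
    unfolding set_lebesgue_integral_def by simp
  have "normalized_solution \<mu> (\<lambda>x. w x / s)"
    unfolding normalized_solution_def
  proof (intro conjI allI impI)
    show "continuous_on UNIV (\<lambda>x. w x / s)" using s by (intro continuous_intros wc) auto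
    have "contact_complement (\<lambda>x. w x / s) = contact_complement w" using s by (simp add: contact_complement_def)
    then show "distr_laplacian_eq_0_on (contact_complement (\<lambda>x. w x / s)) (\<lambda>x. w x / s)"
      using w1 unfolding distr_laplacian_eq_0_on_def scale by simp
    show "distr_laplacian_le_0_on UNIV (\<lambda>x. w x / s)"
      using w2 s unfolding distr_laplacian_le_0_on_def scale by (simp add: divide_nonpos_pos)
    show "homogeneous \<mu> (\<lambda>x. w x / s)" using w(2) unfolding homogeneous_def by simp
    show "\<bar>w x / s\<bar> \<le> 1" if "norm x \<le> 1" for x using x0(2)[of x] that s by (simp add: s_def)
    show "\<exists>x. norm x \<le> 1 \<and> \<bar>w x / s\<bar> = 1" using x0(1) s by (intro exI[of _ x0]) (simp add: s_def)
  qed (use s \<mu> w3 w4 in auto)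
  then show ?thesis by blast
qed

theorem theorem1p4:
  fixes m :: nat
  shows "\<exists>c_plus c_minus :: real. c_plus > 0 \<and> c_minus > 0 \<and>
    admissible_frequencies TYPE('n::finite) \<inter>
      ({2 * real m + 1 - c_minus <..< 2 * real m + 1} \<union>
       {2 * real m + 1 <..< 2 * real m + 1 + c_plus}) = {}"
proof -
  define d where "d = real (2 * m + 1)"
  have "\<exists>c>0. \<forall>\<mu>\<in>admissible_frequencies TYPE('n). \<bar>\<mu> - d\<bar> < c \<longrightarrow> \<mu> = d"
  proof (rule ccontr)
    assume "\<not> ?thesis"
    then have neg: "\<exists>\<mu>\<in>admissible_frequencies TYPE('n). \<bar>\<mu> - d\<bar> < c \<and> \<mu> \<noteq> d" if "c > 0" for c
      using that by blast
    have "\<forall>k. \<exists>\<mu>\<in>admissible_frequencies TYPE('n). \<bar>\<mu> - d\<bar> < inverse (real (Suc k)) \<and> \<mu> \<noteq> d"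
      by (intro allI neg) simp
    then obtain \<mu> where \<mu>: "\<And>k. \<mu> k \<in> admissible_frequencies TYPE('n)"
      "\<And>k. \<bar>\<mu> k - d\<bar> < inverse (real (Suc k))" "\<And>k. \<mu> k \<noteq> d" by metis
    have "\<forall>k. \<exists>u :: (real ^ 'n) \<times> real \<Rightarrow> real. normalized_solution (\<mu> k) u"
      by (intro allI admissible_normalized \<mu>(1))
    then obtain u :: "nat \<Rightarrow> (real ^ 'n) \<times> real \<Rightarrow> real" where u: "\<And>k. normalized_solution (\<mu> k) (u k)"
      by metis
    have "blow_up u \<mu> m"
    proof
      have "(\<lambda>k. \<mu> k - d) \<longlonglongrightarrow> 0"
      proof (rule Lim_null_comparison)
        show "\<forall>\<^sub>F k in sequentially. norm (\<mu> k - d) \<le> inverse (real (Suc k))"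
          using \<mu>(2) by (auto intro!: always_eventually less_imp_le simp del: of_nat_Suc)
      qed (rule LIMSEQ_inverse_real_of_nat)
      then show "\<mu> \<longlonglongrightarrow> real (2 * m + 1)" unfolding d_def by (rule LIM_zero_cancel)
      \<comment> \<open>The distance of \<open>\<mu> k\<close> from \<open>d\<close> is below 1/(k +
        1), hence at most 1 already for k = 0.\<close>
      show "\<mu> k \<le> real (2 * m + 2)" for k
      proof -
        have "inverse (real (Suc k)) \<le> 1" by (simp add: inverse_le_1_iff)
        then show ?thesis using \<mu>(2)[of k] by (simp add: d_def)
      qed
      show "\<mu> k \<noteq> real (2 * m + 1)" for k using \<mu>(3) by (simp add: d_def)
    qed (use u[unfolded normalized_solution_def] in auto)
    then show False using blow_up_contradiction by blast
  qed
  then obtain c where c: "c > 0" "\<And>\<mu>. \<mu> \<in> admissible_frequencies TYPE('n) \<Longrightarrow> \<bar>\<mu> - d\<bar> < c \<Longrightarrow> \<mu> = d" by blast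
  show ?thesis
  \<comment> \<open>The same radius serves on both sides of 2m + 1.\<close>
  proof (intro exI[of _ c] conjI c(1))
    show "admissible_frequencies TYPE('n) \<inter>
      ({2 * real m + 1 - c <..< 2 * real m + 1} \<union> {2 * real m + 1 <..< 2 * real m + 1 + c}) = {}"
    proof (rule equals0I)
      fix \<mu> assume a: "\<mu> \<in> admissible_frequencies TYPE('n) \<inter>
        ({2 * real m + 1 - c <..< 2 * real m + 1} \<union> {2 * real m + 1 <..< 2 * real m + 1 + c})"
      then have "\<bar>\<mu> - d\<bar> < c" by (auto simp: d_def)
      then have "\<mu> = d" using c(2) a by blast
      then show False using a by (auto simp: d_def)
    qed
  qed
qed

end
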